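(* Take any $p\in(0,1)$. Let $\widetilde F$ be a closed subset of $\widetilde{\mathcal{W}}$, with interior $\widetilde F^o$, satisfying $$\inf_{\widetilde h\in\widetilde F^o}I_p(\widetilde h)=\inf_{\widetilde h\in\widetilde F}I_p(\widetilde h)>0.$$ Let $\widetilde F^*$ be the subset of $\widetilde F$ where $I_p$ is minimized. Then $\widetilde F^*$ is non-empty and compact, and for each $n$, and each $\epsilon>0$, $$\mathbb{P}\big(\delta_\Box(G(n,p),\widetilde F^* )\ge\epsilon\ \big|\ G(n,p)\in\widetilde F\big)\le e^{-C(\epsilon,\widetilde F)n^2},$$ where $C(\epsilon,\widetilde F)$ is a positive constant depending only on $\epsilon$ and $\widetilde F$. In particular, if $\widetilde F^*$ contains only one element $\widetilde h^*$, then the conditional distribution of $G(n,p)$ given $G(n,p)\in\widetilde F$ converges to the point mass at $\widetilde h^*$ as $n\to\infty$.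
   Context: $\mathcal{W}$ is the set of measurable functions $f:[0,1]^2\to[0,1]$ with $f(x,y)=f(y,x)$. On $\mathcal{W}$ the cut distance is $d_\Box(f,g)=\sup_{S,T\subseteq[0,1]}\left|\int_{S\times T}[f(x,y)-g(x,y)]\,dx\,dy\right|$ (sup over measurable $S,T$). $\Sigma$ is the set of measure preserving bijections $\sigma:[0,1]\to[0,1]$, and $g_\sigma(x,y):=g(\sigma x,\sigma y)$. For $g\in\mathcal{W}$, $\widetilde g$ denotes the closure in $(\mathcal{W},d_\Box)$ of the orbit $\{g_\sigma:\sigma\in\Sigma\}$; the quotient space of all $\widetilde g$ is $\widetilde{\mathcal{W}}$, with metric $\delta_\Box(\widetilde f,\widetilde g)=\inf_{\sigma\in\Sigma}d_\Box(f,g_\sigma)$. For a set $\widetilde A\subseteq\widetilde{\mathcal{W}}$, $\delta_\Box(\widetilde g,\widetilde A):=\inf_{\widetilde h\in\widetilde A}\delta_\Box(\widetilde g,\widetilde h)$. For a finite simple graph $G$ on $\{1,\dots,n\}$, $f^G\in\mathcal{W}$ is defined by $f^G(x,y)=1$ if $(\lceil nx\rceil,\lceil ny\rceil)$ is an edge of $G$ and $0$ otherwise; $G$ is identified with the element $\widetilde{f^G}$ of $\widetilde{\mathcal{W}}$. $G(n,p)$ is the random graph on $n$ vertices in which each edge is present independently with probability $p$, viewed in this way as a random element of $\widetilde{\mathcal{W}}$. For $u\in[0,1]$, $I_p(u)=\frac12u\log\frac up+\frac12(1-u)\log\frac{1-u}{1-p}$ (with $0\log0=0$); for $h\in\mathcal{W}$,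 $I_p(h)=\int_0^1\int_0^1I_p(h(x,y))\,dx\,dy$; and $I_p(\widetilde h):=I_p(h)$ on $\widetilde{\mathcal{W}}$ (this does not depend on the choice of representative).
   Formalization: The bound is stated for all sufficiently large n (where P(G(n,p) in F)>0 is also proved) rather than each n, since for n=1 and F={edge density ≤ p/2} the conditional probability is 1; F is also assumed non-empty, as otherwise F* is empty. *)

theory Defs
  imports "HOL-Probability.Probability"
begin

section \<open>Graphons and the cut distance\<close>

text \<open>
  Functions on the unit square are extensional (\<^term>\<open>undefined\<close> outside the square), so that
  distinct elements of \<open>graphons\<close> are distinct functions on the square. Measurability is Borel.
\<close>

abbreviation unit_sq :: "(real \<times> real) set" where
  "unit_sq \<equiv> {0..1} \<times> {0..1}"

abbreviation unit_leb :: "real measure" where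
  "unit_leb \<equiv> restrict_space lborel {0..1}"

definition graphons :: "(real \<times> real \<Rightarrow> real) set" where
  "graphons = {f \<in> unit_sq \<rightarrow>\<^sub>E {0..1}.
     f \<in> borel_measurable (restrict_space borel unit_sq) \<and>
     (\<forall>x\<in>{0..1}. \<forall>y\<in>{0..1}. f (x, y) = f (y, x))}"

definition cut_dist :: "(real \<times> real \<Rightarrow> real) \<Rightarrow> (real \<times> real \<Rightarrow> real) \<Rightarrow> real" where
  "cut_dist f g = (SUP (S, T) \<in> {(S, T). S \<in> sets borel \<and> S \<subseteq> {0..1} \<and> T \<in> sets borel \<and> T \<subseteq> {0..1}}.
     \<bar>LINT z:S \<times> T|lborel. f z - g z\<bar>)"

text \<open>
  Measure preserving bijections of \<open>[0,1]\<close>, measurable in both directions. (Measurability of the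
  inverse is automatic by the Lusin-Souslin theorem.)
\<close>

definition mp_bijections :: "(real \<Rightarrow> real) set" where
  "mp_bijections = {\<sigma>. bij_betw \<sigma> {0..1} {0..1} \<and>
     \<sigma> \<in> measurable unit_leb unit_leb \<and>
     the_inv_into {0..1} \<sigma> \<in> measurable unit_leb unit_leb \<and>
     distr unit_leb unit_leb \<sigma> = unit_leb}"

definition relabel :: "(real \<times> real \<Rightarrow> real) \<Rightarrow> (real \<Rightarrow> real) \<Rightarrow> real \<times> real \<Rightarrow> real" where
  "relabel g \<sigma> = (\<lambda>(x, y)\<in>unit_sq. g (\<sigma> x, \<sigma> y))"


section \<open>The quotient space\<close>

text \<open>
  The closure of an orbit is spelled out: \<^term>\<open>cut_dist\<close> is only a pseudometric on
  \<^term>\<open>graphons\<close>, as it does not separate functions that agree almost everywhere.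
\<close>

definition graphon_class :: "(real \<times> real \<Rightarrow> real) \<Rightarrow> (real \<times> real \<Rightarrow> real) set" where
  "graphon_class g = {h \<in> graphons. \<forall>e>0. \<exists>\<sigma>\<in>mp_bijections. cut_dist h (relabel g \<sigma>) < e}"

definition graphon_space :: "(real \<times> real \<Rightarrow> real) set set" where
  "graphon_space = graphon_class ` graphons"

text \<open>
  The distance and the rate function on classes are given by their formula at representatives;
  the values do not depend on the choice. The value 0 of the distance off \<open>graphon_space\<close> is
  immaterial, but \<^locale>\<open>Metric_space\<close> asks for symmetry and nonnegativity on the whole type.
\<close>

definition class_rep :: "(real \<times> real \<Rightarrow> real) set \<Rightarrow> real \<times> real \<Rightarrow> real" where
  "class_rep A = (SOME f. f \<in> A)"

definition delta_cut :: "(real \<times> real \<Rightarrow> real) set \<Rightarrow> (real \<times> real \<Rightarrow> real) set \<Rightarrow> real" where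
  "delta_cut A B = (if A \<in> graphon_space \<and> B \<in> graphon_space
     then INF \<sigma>\<in>mp_bijections. cut_dist (class_rep A) (relabel (class_rep B) \<sigma>) else 0)"

definition delta_cut_set ::
    "(real \<times> real \<Rightarrow> real) set \<Rightarrow> (real \<times> real \<Rightarrow> real) set set \<Rightarrow> real" where
  "delta_cut_set g A = (INF h\<in>A. delta_cut g h)"

definition graphon_topology :: "(real \<times> real \<Rightarrow> real) set topology" where
  "graphon_topology = Metric_space.mtopology graphon_space delta_cut"


section \<open>The rate function\<close>

text \<open>The convention \<open>0 log 0 = 0\<close> holds since the factor in front of \<^term>\<open>ln\<close> vanishes.\<close>

definition rate :: "real \<Rightarrow> real \<Rightarrow> real" where
  "rate p u = 1/2 * u * ln (u / p) + 1/2 * (1 - u) * ln ((1 - u) / (1 - p))"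

definition graphon_rate :: "real \<Rightarrow> (real \<times> real \<Rightarrow> real) \<Rightarrow> real" where
  "graphon_rate p h = (LINT x:{0..1}|lborel. LINT y:{0..1}|lborel. rate p (h (x, y)))"

definition class_rate :: "real \<Rightarrow> (real \<times> real \<Rightarrow> real) set \<Rightarrow> real" where
  "class_rate p A = graphon_rate p (class_rep A)"

definition rate_minimizers ::
    "real \<Rightarrow> (real \<times> real \<Rightarrow> real) set set \<Rightarrow> (real \<times> real \<Rightarrow> real) set set" where
  "rate_minimizers p F = {h \<in> F. \<forall>g\<in>F. class_rate p h \<le> class_rate p g}"


section \<open>The random graph\<close>

text \<open>A simple graph on \<open>{1,\<dots>,n}\<close> is given by its set of edges, a set of two-element subsets.\<close>

definition possible_edges :: "nat \<Rightarrow> nat set set" where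
  "possible_edges n = {e. e \<subseteq> {1..n} \<and> card e = 2}"

definition graph_graphon :: "nat \<Rightarrow> nat set set \<Rightarrow> real \<times> real \<Rightarrow> real" where
  "graph_graphon n E =
     (\<lambda>(x, y)\<in>unit_sq. if {nat \<lceil>real n * x\<rceil>, nat \<lceil>real n * y\<rceil>} \<in> E then 1 else 0)"

definition gnp_edges :: "nat \<Rightarrow> real \<Rightarrow> nat set set pmf" where
  "gnp_edges n p = map_pmf (\<lambda>b. {e \<in> possible_edges n. b e})
     (Pi_pmf (possible_edges n) False (\<lambda>_. bernoulli_pmf p))"

definition gnp :: "nat \<Rightarrow> real \<Rightarrow> (real \<times> real \<Rightarrow> real) set pmf" where
  "gnp n p = map_pmf (\<lambda>E. graphon_class (graph_graphon n E)) (gnp_edges n p)"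

definition weakly_converges :: "'a topology \<Rightarrow> (nat \<Rightarrow> 'a pmf) \<Rightarrow> 'a pmf \<Rightarrow> bool" where
  "weakly_converges X \<mu> \<nu> \<longleftrightarrow>
     (\<forall>\<phi>. continuous_map X euclideanreal \<phi> \<and> bounded (\<phi> ` topspace X) \<longrightarrow>
        (\<lambda>n. measure_pmf.expectation (\<mu> n) \<phi>) \<longlonglongrightarrow> measure_pmf.expectation \<nu> \<phi>)"

end

theory Submission
  imports Defs "HOL-Real_Asymp.Real_Asymp"
begin

text \<open>
  The theorem follows from a large deviation principle in the cut metric, lower semicontinuity of
  \<open>I_p\<close> and compactness of the quotient space, all obtained from step graphons on the \<open>n \<times> n\<close> grid.

  Upper bound: by weak regularity every graph on \<open>n\<close> vertices is within \<open>\<epsilon>\<close>, in cut distance, of the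
  step graphon \<open>u\<close> of its block densities for some vertex colouring with \<open>k(\<epsilon>)\<close> colours. Given the
  colouring and the densities, the likelihood of the graph under \<open>G(n,p)\<close> is \<open>exp (- n\<^sup>2 I_p(u))\<close> times
  its likelihood under the inhomogeneous random graph with edge probabilities \<open>u\<close>, and there are only
  \<open>exp (o(n\<^sup>2))\<close> choices of colouring and densities.

  Lower bound: let \<open>h\<^sub>n\<close> be the average of \<open>h\<close> over the grid. It tends to \<open>h\<close> in \<open>L\<^sup>1\<close>, and
  \<open>I_p(h\<^sub>n) \<le> I_p(h)\<close> by convexity. The random graph with edge probabilities \<open>h\<^sub>n\<close> is close to \<open>h\<close>
  by Hoeffding's inequality and a union bound over the \<open>4\<^sup>n\<close> test rectangles, and changing the measure
  to \<open>G(n,p)\<close> costs its relative entropy, which is \<open>n\<^sup>2 I_p(h\<^sub>n)\<close>.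

  Semicontinuity: \<open>I_p(h)\<close> is the supremum of the \<open>I_p(h\<^sub>n)\<close>, which depend continuously on \<open>h\<close>.
  Compactness: weak regularity and permutations of the grid cells give total boundedness, and a
  Cauchy sequence for the cut distance converges to its weak limit.

  In step graphons of edge weights the diagonal cells carry the value \<open>p\<close>, where \<open>I_p\<close> vanishes, so that
  \<open>I_p\<close> is exactly a sum over edges.
\<close>

section \<open>The square as a probability space\<close>

text \<open>Only two probability estimates are needed. Let \<open>r\<close> be the minimum of the
  rate on \<open>F\<close>. The classes of \<open>F\<close> at distance at least
  \<open>\<epsilon>\<close> from the minimizers form a compact set, on which the rate attains a
  minimum above \<open>r\<close>. By semicontinuity and compactness the excess persists on a whole
  \<open>d\<close>-neighbourhood of this set, and \<open>d\<close> is the accuracy asked of weak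
  regularity, so a single application of the upper bound covers the set. The hypothesis on the
  interior supplies a class of rate near \<open>r\<close> around which a ball lies in
  \<open>F\<close>; the lower bound is needed only for that ball.

  The obstacle is that probabilities have order \<open>exp (- c n^2)\<close>, so every count must be
  smaller than that. Vertex sets and colourings number \<open>exp (O(n))\<close>, the block
  densities are polynomially many, and the relabellings cost nothing, since distances only drop in
  the quotient. The \<open>1/2\<close> in \<open>rate\<close> fits this scale:
  \<open>2 * rate p u\<close> is the relative entropy of a Bernoulli variable of mean
  \<open>u\<close> against mean \<open>p\<close>, and each edge fills two of the \<open>n^2\<close>
  cells.\<close>

definition sqm :: "(real \<times> real) measure" where
  "sqm = unit_leb \<Otimes>\<^sub>M unit_leb"

lemma unit_sq_borel [simp]: "unit_sq \<in> sets borel"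
  by (intro borel_Times) auto

lemma prob_space_unit_leb: "prob_space unit_leb"
  by (rule prob_space_restrict_space) auto

lemma space_unit_leb [simp]: "space unit_leb = {0..1}"
  by (simp add: space_restrict_space)

lemma sets_unit_leb_iff: "S \<in> sets unit_leb \<longleftrightarrow> S \<in> sets borel \<and> S \<subseteq> {0..1}"
  by (subst sets_restrict_space_iff) auto

lemma emeasure_unit_leb: "S \<in> sets unit_leb \<Longrightarrow> emeasure unit_leb S = emeasure lborel S"
  by (subst emeasure_restrict_space) (auto simp: sets_unit_leb_iff)

lemma space_sqm [simp]: "space sqm = unit_sq"
  by (simp add: sqm_def space_pair_measure)

interpretation unit_leb: prob_space unit_leb
  by (rule prob_space_unit_leb)

interpretation unit_leb2: pair_prob_space unit_leb unit_leb ..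

interpretation sqm: prob_space sqm
  unfolding sqm_def by unfold_locales

lemma sets_sqm: "sets sqm = sets (restrict_space borel unit_sq)"
proof -
  have a: "S \<in> sets unit_leb \<Longrightarrow> T \<in> sets unit_leb \<Longrightarrow> S \<times> T \<in> sets (restrict_space borel unit_sq)" for S T
    by (subst sets_restrict_space_iff) (auto simp: sets_unit_leb_iff intro!: borel_Times)
  have "sets sqm \<subseteq> sets (restrict_space borel unit_sq)"
    unfolding sqm_def sets_pair_measure
    by (rule sets.sigma_sets_subset'[where M = "restrict_space borel unit_sq", simplified])
       (use a in \<open>auto intro: a[of "{0..1}" "{0..1}"] simp: sets_unit_leb_iff\<close>)
  moreover have "A \<in> sets sqm" if A: "A \<in> sets (restrict_space borel unit_sq)" for A
  proof -
    have "A \<in> sets (borel \<Otimes>\<^sub>M borel)" "A \<subseteq> unit_sq"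
      using A unfolding borel_prod by (auto simp: sets_restrict_space_iff)
    \<comment> \<open>A Borel subset of the square is its own preimage under the inclusion of the
      square into the plane, which is measurable componentwise.\<close>
    moreover have "(\<lambda>z. z) \<in> measurable sqm (borel \<Otimes>\<^sub>M borel)"
    proof -
      have "(\<lambda>z. (fst z, snd z)) \<in> measurable sqm (borel \<Otimes>\<^sub>M borel)"
        unfolding sqm_def
        by (intro measurable_Pair measurable_compose[OF measurable_fst measurable_restrict_space1]
            measurable_compose[OF measurable_snd measurable_restrict_space1] measurable_ident_sets) auto
      then show ?thesis by simp
    qed
    ultimately have "(\<lambda>z. z) -` A \<inter> space sqm \<in> sets sqm"
      by (intro measurable_sets)
    with \<open>A \<subseteq> unit_sq\<close> show ?thesis by (simp add: Int_absorb2)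
  qed
  ultimately show ?thesis by auto
qed

text \<open>The product form gives Fubini, transposition and image measures; the restricted form is
  the one in which \<open>cut_dist\<close> is defined.\<close>

lemma sqm_eq: "sqm = restrict_space lborel unit_sq"
  unfolding sqm_def
proof (rule pair_measure_eqI)
  show "sets (unit_leb \<Otimes>\<^sub>M unit_leb) = sets (restrict_space lborel unit_sq)"
    using sets_sqm unfolding sqm_def by (simp add: sets_restrict_space)
  fix A B assume A: "A \<in> sets unit_leb" and B: "B \<in> sets unit_leb"
  have "emeasure (restrict_space lborel unit_sq) (A \<times> B) = emeasure lborel (A \<times> B)"
    using A B by (subst emeasure_restrict_space) (auto simp: sets_unit_leb_iff intro!: borel_Times)
  also have "\<dots> = emeasure (lborel \<Otimes>\<^sub>M lborel) (A \<times> B)"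
    by (simp add: lborel_prod)
  also have "\<dots> = emeasure lborel A * emeasure lborel B"
    using A B by (intro lborel.emeasure_pair_measure_Times) (auto simp: sets_unit_leb_iff)
  finally show "emeasure unit_leb A * emeasure unit_leb B =
      emeasure (restrict_space lborel unit_sq) (A \<times> B)"
    using A B by (simp add: emeasure_unit_leb)
qed (rule unit_leb.sigma_finite_measure_axioms)+

lemma rect_sets [intro, measurable]:
  "S \<in> sets unit_leb \<Longrightarrow> T \<in> sets unit_leb \<Longrightarrow> S \<times> T \<in> sets sqm"
  unfolding sqm_def by (rule pair_measureI)

lemma measure_rect:
  assumes "S \<in> sets unit_leb" "T \<in> sets unit_leb"
  shows "measure sqm (S \<times> T) = measure unit_leb S * measure unit_leb T"
  unfolding sqm_def measure_def
  using assms by (simp add: unit_leb.emeasure_pair_measure_Times enn2real_mult)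

lemma integrable_sqm:
  fixes f :: "real \<times> real \<Rightarrow> real"
  assumes "f \<in> borel_measurable sqm" "\<And>z. z \<in> unit_sq \<Longrightarrow> \<bar>f z\<bar> \<le> B"
  shows "integrable sqm f"
  by (rule sqm.integrable_const_bound[where B = B]) (use assms in \<open>auto intro!: AE_I2\<close>)

lemma integral_le_sqm:
  fixes f :: "real \<times> real \<Rightarrow> real"
  assumes "f \<in> borel_measurable sqm" "\<And>z. z \<in> unit_sq \<Longrightarrow> \<bar>f z\<bar> \<le> B"
  shows "\<bar>integral\<^sup>L sqm f\<bar> \<le> B"
proof -
  have "\<bar>integral\<^sup>L sqm f\<bar> \<le> integral\<^sup>L sqm (\<lambda>z. \<bar>f z\<bar>)" by (rule integral_abs_bound)
  also have "\<dots> \<le> integral\<^sup>L sqm (\<lambda>z. B)"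
    using assms by (intro integral_mono integrable_abs integrable_sqm[where B=B] sqm.integrable_const) auto
  finally show ?thesis using sqm.prob_space by simp
qed

section \<open>Graphons and the cut distance\<close>

lemma graphon_measurable [measurable_dest]: "f \<in> graphons \<Longrightarrow> f \<in> borel_measurable sqm"
  using measurable_cong_sets[OF sets_sqm refl, of borel] by (auto simp: graphons_def)

lemma graphon_ge_0: "f \<in> graphons \<Longrightarrow> z \<in> unit_sq \<Longrightarrow> 0 \<le> f z"
  and graphon_le_1: "f \<in> graphons \<Longrightarrow> z \<in> unit_sq \<Longrightarrow> f z \<le> 1"
  unfolding graphons_def by (force simp: PiE_iff)+

lemma graphon_sym: "f \<in> graphons \<Longrightarrow> x \<in> {0..1} \<Longrightarrow> y \<in> {0..1} \<Longrightarrow> f (x, y) = f (y, x)"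
  unfolding graphons_def by auto

lemma graphonI:
  assumes "f \<in> borel_measurable sqm" "\<And>z. z \<in> unit_sq \<Longrightarrow> 0 \<le> f z \<and> f z \<le> 1"
    "\<And>x y. x \<in> {0..1} \<Longrightarrow> y \<in> {0..1} \<Longrightarrow> f (x, y) = f (y, x)" "\<And>z. z \<notin> unit_sq \<Longrightarrow> f z = undefined"
  shows "f \<in> graphons"
  using assms measurable_cong_sets[OF sets_sqm refl, of borel] by (auto simp: graphons_def PiE_iff extensional_def)

definition l1_dist :: "(real \<times> real \<Rightarrow> real) \<Rightarrow> (real \<times> real \<Rightarrow> real) \<Rightarrow> real" where
  "l1_dist f g = (\<integral>z. \<bar>f z - g z\<bar> \<partial>sqm)"

text \<open>The rectangle enters as a factor of the integrand, so that the integral over a test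
  rectangle can itself be split over grid cells.\<close>

definition rect_integral :: "(real \<times> real \<Rightarrow> real) \<Rightarrow> real set \<Rightarrow> real set \<Rightarrow> real" where
  "rect_integral f S T = (\<integral>z. indicator (S \<times> T) z * f z \<partial>sqm)"

lemma graphon_diff_le: "f \<in> graphons \<Longrightarrow> g \<in> graphons \<Longrightarrow> z \<in> unit_sq \<Longrightarrow> \<bar>f z - g z\<bar> \<le> 1"
  using graphon_ge_0[of f z] graphon_le_1[of f z] graphon_ge_0[of g z] graphon_le_1[of g z]
  by (auto simp: abs_le_iff)

lemma graphon_integrable: "f \<in> graphons \<Longrightarrow> integrable sqm f"
  by (rule integrable_sqm[where B=1]) (auto intro: graphon_measurable simp: graphon_ge_0 graphon_le_1)

lemma graphon_diff_integrable:
  "f \<in> graphons \<Longrightarrow> g \<in> graphons \<Longrightarrow> integrable sqm (\<lambda>z. \<bar>f z - g z\<bar>)"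
  by (intro integrable_abs Bochner_Integration.integrable_diff graphon_integrable)

lemma integrable_rect:
  "S \<in> sets unit_leb \<Longrightarrow> T \<in> sets unit_leb \<Longrightarrow> integrable sqm f \<Longrightarrow>
    integrable sqm (\<lambda>z. indicator (S \<times> T) z * f z)" for f :: "real \<times> real \<Rightarrow> real"
  using integrable_real_mult_indicator[of "S \<times> T" sqm f] by (simp add: mult.commute rect_sets)

lemma rect_integral_diff:
  assumes "f \<in> graphons" "g \<in> graphons" "S \<in> sets unit_leb" "T \<in> sets unit_leb"
  shows "rect_integral (\<lambda>z. f z - g z) S T = rect_integral f S T - rect_integral g S T"
  unfolding rect_integral_def using assms
  by (simp add: right_diff_distrib integrable_rect graphon_integrable)

lemma rect_integral_diff_le_1:
  assumes "f \<in> graphons" "g \<in> graphons" "S \<in> sets unit_leb" "T \<in> sets unit_leb"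
  shows "\<bar>rect_integral (\<lambda>z. f z - g z) S T\<bar> \<le> 1"
  unfolding rect_integral_def using assms
  by (intro integral_le_sqm borel_measurable_times borel_measurable_diff graphon_measurable
       borel_measurable_indicator rect_sets)
     (auto simp: indicator_def intro!: graphon_diff_le)

lemma cut_dist_eq:
  "cut_dist f g = (SUP (S, T) \<in> sets unit_leb \<times> sets unit_leb. \<bar>rect_integral (\<lambda>z. f z - g z) S T\<bar>)"
proof -
  have "(LINT z:S \<times> T|lborel. f z - g z) = rect_integral (\<lambda>z. f z - g z) S T"
    if "S \<subseteq> {0..1}" "T \<subseteq> {0..1}" for S T
  proof -
    have "rect_integral (\<lambda>z. f z - g z) S T =
        integral\<^sup>L lborel (\<lambda>z. indicator unit_sq z *\<^sub>R (indicator (S \<times> T) z * (f z - g z)))"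
      unfolding rect_integral_def sqm_eq by (subst integral_restrict_space) auto
    also have "\<dots> = (LINT z:S \<times> T|lborel. f z - g z)"
      unfolding set_lebesgue_integral_def using that
      by (intro Bochner_Integration.integral_cong) (auto simp: indicator_def split: if_splits)
    finally show ?thesis by simp
  qed
  then have *: "(case r of (S, T) \<Rightarrow> \<bar>LINT z:S \<times> T|lborel. f z - g z\<bar>) =
      (case r of (S, T) \<Rightarrow> \<bar>rect_integral (\<lambda>z. f z - g z) S T\<bar>)"
    if "r \<in> sets unit_leb \<times> sets unit_leb" for r
    using that by (cases r) (simp add: sets_unit_leb_iff)
  have "{(S, T). S \<in> sets borel \<and> S \<subseteq> {0..1} \<and> T \<in> sets borel \<and> T \<subseteq> {0..1}} =
      sets unit_leb \<times> sets unit_leb"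
    by (simp add: set_eq_iff sets_unit_leb_iff)
  with * show ?thesis unfolding cut_dist_def by (intro SUP_cong) simp_all
qed

lemma cut_dist_bdd:
  assumes "f \<in> graphons" "g \<in> graphons"
  shows "bdd_above ((\<lambda>(S, T). \<bar>rect_integral (\<lambda>z. f z - g z) S T\<bar>) ` (sets unit_leb \<times> sets unit_leb))"
  using rect_integral_diff_le_1[OF assms] by (intro bdd_aboveI[where M=1]) auto

lemma rect_integral_le_cut_dist:
  assumes "f \<in> graphons" "g \<in> graphons" "S \<in> sets unit_leb" "T \<in> sets unit_leb"
  shows "\<bar>rect_integral f S T - rect_integral g S T\<bar> \<le> cut_dist f g"
proof -
  have "\<bar>rect_integral (\<lambda>z. f z - g z) S T\<bar> \<le> cut_dist f g"
    unfolding cut_dist_eq using assms cut_dist_bdd[OF assms(1,2)]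
    by (intro cSUP_upper2[where x="(S,T)"]) auto
  then show ?thesis using rect_integral_diff[OF assms] by simp
qed

lemma cut_dist_leI:
  assumes "f \<in> graphons" "g \<in> graphons"
    "\<And>S T. S \<in> sets unit_leb \<Longrightarrow> T \<in> sets unit_leb \<Longrightarrow>
      \<bar>rect_integral f S T - rect_integral g S T\<bar> \<le> e"
  shows "cut_dist f g \<le> e"
  unfolding cut_dist_eq
  by (rule cSUP_least) (use assms in \<open>auto simp: rect_integral_diff\<close>)

lemma cut_dist_nonneg: "f \<in> graphons \<Longrightarrow> g \<in> graphons \<Longrightarrow> 0 \<le> cut_dist f g"
  using rect_integral_le_cut_dist[of f g "{}" "{}"] by auto

lemma cut_dist_self [simp]: "f \<in> graphons \<Longrightarrow> cut_dist f f = 0"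
  by (intro antisym cut_dist_leI cut_dist_nonneg) auto

lemma cut_dist_commute: "cut_dist f g = cut_dist g f"
proof -
  have "\<bar>rect_integral (\<lambda>z. f z - g z) S T\<bar> = \<bar>rect_integral (\<lambda>z. g z - f z) S T\<bar>" for S T
  proof -
    have "rect_integral (\<lambda>z. f z - g z) S T = - rect_integral (\<lambda>z. g z - f z) S T"
      unfolding rect_integral_def Bochner_Integration.integral_minus[symmetric]
      by (simp add: algebra_simps)
    then show ?thesis by simp
  qed
  then show ?thesis unfolding cut_dist_eq by simp
qed

lemma cut_dist_triangle:
  assumes "f \<in> graphons" "g \<in> graphons" "h \<in> graphons"
  shows "cut_dist f h \<le> cut_dist f g + cut_dist g h"
proof (rule cut_dist_leI)
  fix S T assume "S \<in> sets unit_leb" "T \<in> sets unit_leb"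
  then show "\<bar>rect_integral f S T - rect_integral h S T\<bar> \<le> cut_dist f g + cut_dist g h"
    using rect_integral_le_cut_dist[of f g S T] rect_integral_le_cut_dist[of g h S T] assms by linarith
qed (use assms in auto)

lemma cut_dist_le_l1_dist:
  assumes "f \<in> graphons" "g \<in> graphons"
  shows "cut_dist f g \<le> l1_dist f g"
proof (rule cut_dist_leI[OF assms])
  fix S T assume ST: "S \<in> sets unit_leb" "T \<in> sets unit_leb"
  have "\<bar>rect_integral (\<lambda>z. f z - g z) S T\<bar> \<le> (\<integral>z. \<bar>indicator (S \<times> T) z * (f z - g z)\<bar> \<partial>sqm)"
    unfolding rect_integral_def by (rule integral_abs_bound)
  also have "\<dots> \<le> l1_dist f g"
    unfolding l1_dist_def using ST assms
    by (intro integral_mono integrable_abs integrable_rect Bochner_Integration.integrable_diff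
        graphon_integrable) (auto simp: indicator_def)
  finally show "\<bar>rect_integral f S T - rect_integral g S T\<bar> \<le> l1_dist f g"
    using rect_integral_diff[OF assms ST] by simp
qed

section \<open>Relabelling\<close>

lemma mp_bijectionsD:
  assumes "\<sigma> \<in> mp_bijections"
  shows "bij_betw \<sigma> {0..1} {0..1}" "\<sigma> \<in> measurable unit_leb unit_leb"
    "the_inv_into {0..1} \<sigma> \<in> measurable unit_leb unit_leb" "distr unit_leb unit_leb \<sigma> = unit_leb"
  using assms by (auto simp: mp_bijections_def)

lemma mp_bijections_in: "\<sigma> \<in> mp_bijections \<Longrightarrow> x \<in> {0..1} \<Longrightarrow> \<sigma> x \<in> {0..1}"
  using mp_bijectionsD(1) bij_betwE by blast

text \<open>On the unit interval \<open>the_inv_into\<close> must agree with any explicit inverse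
  \<open>\<tau>\<close>, whose measurability can be checked directly.\<close>

lemma mp_bijectionsI:
  assumes "bij_betw \<sigma> {0..1} {0..1}" "\<sigma> \<in> measurable unit_leb unit_leb"
    "\<And>x. x \<in> {0..1} \<Longrightarrow> \<sigma> (\<tau> x) = x" "\<tau> \<in> measurable unit_leb unit_leb"
    "distr unit_leb unit_leb \<sigma> = unit_leb"
  shows "\<sigma> \<in> mp_bijections"
proof -
  have \<tau>: "x \<in> {0..1} \<Longrightarrow> \<tau> x \<in> {0..1}" for x
    using measurable_space[OF assms(4)] by auto
  have "the_inv_into {0..1} \<sigma> \<in> measurable unit_leb unit_leb"
    by (subst measurable_cong[where g = \<tau>])
       (use assms \<tau> in \<open>auto intro!: the_inv_into_f_eq simp: bij_betw_def\<close>)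
  with assms show ?thesis by (auto simp: mp_bijections_def)
qed

lemma mp_id: "id \<in> mp_bijections"
proof (rule mp_bijectionsI[where \<tau> = id])
  show "distr unit_leb unit_leb id = unit_leb" unfolding id_def by (rule distr_id)
qed auto

lemma mp_comp:
  assumes \<sigma>: "\<sigma> \<in> mp_bijections" and \<tau>: "\<tau> \<in> mp_bijections"
  shows "\<sigma> \<circ> \<tau> \<in> mp_bijections"
proof (rule mp_bijectionsI[where \<tau> = "the_inv_into {0..1} \<tau> \<circ> the_inv_into {0..1} \<sigma>"])
  note s = mp_bijectionsD[OF \<sigma>] and t = mp_bijectionsD[OF \<tau>]
  show "bij_betw (\<sigma> \<circ> \<tau>) {0..1} {0..1}" using s t by (intro bij_betw_trans)
  show "\<sigma> \<circ> \<tau> \<in> measurable unit_leb unit_leb" using s t by (intro measurable_comp)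
  show "the_inv_into {0..1} \<tau> \<circ> the_inv_into {0..1} \<sigma> \<in> measurable unit_leb unit_leb"
    using s t by (intro measurable_comp)
  show "(\<sigma> \<circ> \<tau>) ((the_inv_into {0..1} \<tau> \<circ> the_inv_into {0..1} \<sigma>) x) = x" if "x \<in> {0..1}" for x
  proof -
    have "the_inv_into {0..1} \<sigma> x \<in> {0..1}" using measurable_space[OF s(3)] that by auto
    then have "\<tau> (the_inv_into {0..1} \<tau> (the_inv_into {0..1} \<sigma> x)) = the_inv_into {0..1} \<sigma> x"
      using t(1) by (intro f_the_inv_into_f_bij_betw) auto
    moreover have "\<sigma> (the_inv_into {0..1} \<sigma> x) = x"
      using s(1) that by (intro f_the_inv_into_f_bij_betw) auto
    ultimately show ?thesis by simp
  qed
  have "distr unit_leb unit_leb (\<sigma> \<circ> \<tau>) = distr (distr unit_leb unit_leb \<tau>) unit_leb \<sigma>"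
    using s t by (subst distr_distr) auto
  then show "distr unit_leb unit_leb (\<sigma> \<circ> \<tau>) = unit_leb" using s t by simp
qed

lemma mp_inv:
  assumes \<sigma>: "\<sigma> \<in> mp_bijections"
  obtains \<tau> where "\<tau> \<in> mp_bijections" "\<And>x. x \<in> {0..1} \<Longrightarrow> \<sigma> (\<tau> x) = x" "\<And>x. x \<in> {0..1} \<Longrightarrow> \<tau> (\<sigma> x) = x"
proof
  note s = mp_bijectionsD[OF \<sigma>]
  let ?t = "the_inv_into {0..1} \<sigma>"
  show 1: "x \<in> {0..1} \<Longrightarrow> \<sigma> (?t x) = x" for x using s(1) by (intro f_the_inv_into_f_bij_betw) auto
  show 2: "x \<in> {0..1} \<Longrightarrow> ?t (\<sigma> x) = x" for x using s(1) by (intro the_inv_into_f_f) (auto simp: bij_betw_def)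
  show "?t \<in> mp_bijections"
  proof (rule mp_bijectionsI[where \<tau> = \<sigma>])
    show "bij_betw ?t {0..1} {0..1}" using s(1) by (rule bij_betw_the_inv_into)
    \<comment> \<open>Writing \<open>unit_leb\<close> as its own image under \<open>\<sigma>\<close>
      turns the image under \<open>?t\<close> into the image under the identity.\<close>
    have "distr unit_leb unit_leb ?t = distr (distr unit_leb unit_leb \<sigma>) unit_leb ?t"
      using s by simp
    also have "\<dots> = distr unit_leb unit_leb (?t \<circ> \<sigma>)"
      using s by (subst distr_distr) auto
    also have "\<dots> = distr unit_leb unit_leb (\<lambda>x. x)"
      using 2 by (intro distr_cong) auto
    finally show "distr unit_leb unit_leb ?t = unit_leb" by (simp add: distr_id)
  qed (use s 2 in auto)
qed

lemma measurable_pair_relabel: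
  assumes \<sigma>: "\<sigma> \<in> mp_bijections"
  shows "(\<lambda>(x, y). (\<sigma> x, \<sigma> y)) \<in> measurable sqm sqm"
  unfolding sqm_def using mp_bijectionsD(2)[OF \<sigma>] by measurable

lemma integral_relabel:
  fixes \<phi> :: "real \<times> real \<Rightarrow> real"
  assumes \<sigma>: "\<sigma> \<in> mp_bijections" and \<phi>: "\<phi> \<in> borel_measurable sqm"
  shows "(\<integral>z. \<phi> (\<sigma> (fst z), \<sigma> (snd z)) \<partial>sqm) = integral\<^sup>L sqm \<phi>"
proof -
  note s = mp_bijectionsD[OF \<sigma>]
  have "sqm = distr unit_leb unit_leb \<sigma> \<Otimes>\<^sub>M distr unit_leb unit_leb \<sigma>"
    using s by (simp add: sqm_def)
  also have "\<dots> = distr sqm sqm (\<lambda>(x, y). (\<sigma> x, \<sigma> y))"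
    unfolding sqm_def using s unit_leb.sigma_finite_measure_axioms by (intro pair_measure_distr) auto
  finally have "integral\<^sup>L sqm \<phi> = integral\<^sup>L (distr sqm sqm (\<lambda>(x, y). (\<sigma> x, \<sigma> y))) \<phi>" by simp
  also have "\<dots> = (\<integral>z. \<phi> ((\<lambda>(x, y). (\<sigma> x, \<sigma> y)) z) \<partial>sqm)"
    using measurable_pair_relabel[OF \<sigma>] \<phi> by (rule integral_distr)
  finally show ?thesis by (simp add: case_prod_beta)
qed

lemma relabel_graphon [intro]:
  assumes \<sigma>: "\<sigma> \<in> mp_bijections" and g: "g \<in> graphons"
  shows "relabel g \<sigma> \<in> graphons"
proof (rule graphonI)
  have "(\<lambda>z. g ((\<lambda>(x, y). (\<sigma> x, \<sigma> y)) z)) \<in> borel_measurable sqm"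
    by (rule measurable_compose[OF measurable_pair_relabel[OF \<sigma>] graphon_measurable[OF g]])
  then show "relabel g \<sigma> \<in> borel_measurable sqm"
    by (rule measurable_cong[THEN iffD1, rotated]) (auto simp: relabel_def)
qed (use graphon_ge_0[OF g] graphon_le_1[OF g] graphon_sym[OF g] mp_bijections_in[OF \<sigma>] in
     \<open>auto simp: relabel_def\<close>)

lemma relabel_relabel:
  assumes "\<tau> \<in> mp_bijections"
  shows "relabel (relabel g \<sigma>) \<tau> = relabel g (\<sigma> \<circ> \<tau>)"
  using mp_bijections_in[OF assms] by (auto simp: relabel_def restrict_def fun_eq_iff)

lemma relabel_id: "f \<in> graphons \<Longrightarrow> (\<And>x. x \<in> {0..1} \<Longrightarrow> \<sigma> x = x) \<Longrightarrow> relabel f \<sigma> = f"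
  by (auto simp: relabel_def restrict_def fun_eq_iff graphons_def PiE_def extensional_def)

text \<open>A change of variables turns a test rectangle for the relabelled functions into the
  rectangle of preimages under the inverse, which is again a test rectangle. The opposite inequality
  is the same fact for the inverse.\<close>

lemma cut_dist_relabel_le:
  assumes \<sigma>: "\<sigma> \<in> mp_bijections" and f: "f \<in> graphons" and g: "g \<in> graphons"
  shows "cut_dist (relabel f \<sigma>) (relabel g \<sigma>) \<le> cut_dist f g"
proof (rule cut_dist_leI)
  fix S T assume S: "S \<in> sets unit_leb" and T: "T \<in> sets unit_leb"
  obtain \<tau> where \<tau>: "\<tau> \<in> mp_bijections" "\<And>x. x \<in> {0..1} \<Longrightarrow> \<sigma> (\<tau> x) = x" "\<And>x. x \<in> {0..1} \<Longrightarrow> \<tau> (\<sigma> x) = x"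
    by (rule mp_inv[OF \<sigma>]) blast
  let ?S = "\<tau> -` S \<inter> {0..1}" and ?T = "\<tau> -` T \<inter> {0..1}"
  have ST: "?S \<in> sets unit_leb" "?T \<in> sets unit_leb"
    using measurable_sets[OF mp_bijectionsD(2)[OF \<tau>(1)]] S T by auto
  have *: "rect_integral (relabel h \<sigma>) S T = rect_integral h ?S ?T" if h: "h \<in> graphons" for h
  proof -
    have "rect_integral h ?S ?T =
        (\<integral>z. indicator (?S \<times> ?T) (\<sigma> (fst z), \<sigma> (snd z)) * h (\<sigma> (fst z), \<sigma> (snd z)) \<partial>sqm)"
      unfolding rect_integral_def
      by (rule integral_relabel[OF \<sigma>, symmetric])
         (use ST h in \<open>auto intro!: borel_measurable_times borel_measurable_indicator graphon_measurable rect_sets\<close>)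
    also have "\<dots> = rect_integral (relabel h \<sigma>) S T"
      unfolding rect_integral_def using \<tau> mp_bijections_in[OF \<sigma>] 
      by (intro Bochner_Integration.integral_cong)
         (auto simp: relabel_def indicator_def split: if_splits)
    finally show ?thesis by simp
  qed
  show "\<bar>rect_integral (relabel f \<sigma>) S T - rect_integral (relabel g \<sigma>) S T\<bar> \<le> cut_dist f g"
    using rect_integral_le_cut_dist[OF f g ST] by (simp add: * f g)
qed (use assms in auto)

text \<open>Applying the inverse relabelling to both arguments shifts a relabelling from one side to
  the other. The symmetry of \<open>orbit_dist\<close> rests on this.\<close>

lemma cut_dist_relabel_left:
  assumes \<sigma>: "\<sigma> \<in> mp_bijections" and f: "f \<in> graphons" and g: "g \<in> graphons"
  shows "\<exists>\<tau>\<in>mp_bijections. cut_dist (relabel f \<sigma>) g = cut_dist f (relabel g \<tau>) \<and>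
    cut_dist f (relabel g \<sigma>) = cut_dist (relabel f \<tau>) g"
proof -
  obtain \<tau> where \<tau>: "\<tau> \<in> mp_bijections" "\<And>x. x \<in> {0..1} \<Longrightarrow> \<sigma> (\<tau> x) = x" "\<And>x. x \<in> {0..1} \<Longrightarrow> \<tau> (\<sigma> x) = x"
    by (rule mp_inv[OF \<sigma>]) blast
  have 1: "relabel (relabel h \<sigma>) \<tau> = h" "relabel (relabel h \<tau>) \<sigma> = h" if "h \<in> graphons" for h
    using that \<tau> \<sigma> by (auto simp: relabel_relabel intro!: relabel_id)
  have "cut_dist f (relabel g \<tau>) \<le> cut_dist (relabel f \<sigma>) g" "cut_dist (relabel f \<tau>) g \<le> cut_dist f (relabel g \<sigma>)"
    using cut_dist_relabel_le[OF \<tau>(1), of "relabel f \<sigma>" g] cut_dist_relabel_le[OF \<tau>(1), of f "relabel g \<sigma>"]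
    f g \<sigma> by (auto simp: 1)
  moreover have "cut_dist (relabel f \<sigma>) g \<le> cut_dist f (relabel g \<tau>)"  "cut_dist f (relabel g \<sigma>) \<le> cut_dist (relabel f \<tau>) g"
    using cut_dist_relabel_le[OF \<sigma>(1), of f "relabel g \<tau>"] cut_dist_relabel_le[OF \<sigma>(1), of "relabel f \<tau>" g]
    f g \<tau> by (auto simp: 1)
  ultimately show ?thesis using \<tau>(1) by (intro bexI[of _ \<tau>]) auto
qed

section \<open>The quotient metric\<close>

text \<open>The quotient distance on functions rather than classes. It is only a pseudometric on
  graphons, but estimates made with it need no \<open>class_rep\<close>.\<close>

definition orbit_dist :: "(real \<times> real \<Rightarrow> real) \<Rightarrow> (real \<times> real \<Rightarrow> real) \<Rightarrow> real" where
  "orbit_dist f g = (INF \<sigma>\<in>mp_bijections. cut_dist f (relabel g \<sigma>))"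

lemma orbit_dist_bdd:
  assumes "f \<in> graphons" "g \<in> graphons"
  shows "bdd_below ((\<lambda>\<sigma>. cut_dist f (relabel g \<sigma>)) ` mp_bijections)"
  using assms by (intro bdd_belowI[where m=0]) (auto intro!: cut_dist_nonneg)

lemma orbit_dist_le:
  assumes "f \<in> graphons" "g \<in> graphons" "\<sigma> \<in> mp_bijections"
  shows "orbit_dist f g \<le> cut_dist f (relabel g \<sigma>)"
  unfolding orbit_dist_def by (intro cINF_lower orbit_dist_bdd assms)

lemma orbit_dist_lessD:
  assumes "f \<in> graphons" "g \<in> graphons" "orbit_dist f g < e"
  obtains \<sigma> where "\<sigma> \<in> mp_bijections" "cut_dist f (relabel g \<sigma>) < e"
proof -
  have "mp_bijections \<noteq> {}" using mp_id by auto
  then show ?thesis using assms(3) that unfolding orbit_dist_def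
    by (subst (asm) cINF_less_iff) (auto intro: orbit_dist_bdd assms)
qed

lemma orbit_dist_nonneg: "f \<in> graphons \<Longrightarrow> g \<in> graphons \<Longrightarrow> 0 \<le> orbit_dist f g"
  unfolding orbit_dist_def using mp_id by (intro cINF_greatest cut_dist_nonneg) auto

lemma orbit_dist_le_cut_dist: "f \<in> graphons \<Longrightarrow> g \<in> graphons \<Longrightarrow> orbit_dist f g \<le> cut_dist f g"
  using orbit_dist_le[of f g id] mp_id by (simp add: relabel_id)

lemma orbit_dist_self [simp]: "f \<in> graphons \<Longrightarrow> orbit_dist f f = 0"
  using orbit_dist_le_cut_dist[of f f] orbit_dist_nonneg[of f f] by simp

lemma orbit_dist_commute_le:
  assumes f: "f \<in> graphons" and g: "g \<in> graphons"
  shows "orbit_dist f g \<le> orbit_dist g f"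
proof (subst (2) orbit_dist_def, rule cINF_greatest)
  fix \<sigma> assume \<sigma>: "\<sigma> \<in> mp_bijections"
  obtain \<tau> where "\<tau> \<in> mp_bijections" "cut_dist (relabel f \<sigma>) g = cut_dist f (relabel g \<tau>)"
    using cut_dist_relabel_left[OF \<sigma> f g] by blast
  then show "orbit_dist f g \<le> cut_dist g (relabel f \<sigma>)"
    using orbit_dist_le[OF f g] by (simp add: cut_dist_commute[of g])
qed (use mp_id in auto)

lemma orbit_dist_commute: "f \<in> graphons \<Longrightarrow> g \<in> graphons \<Longrightarrow> orbit_dist f g = orbit_dist g f"
  by (intro antisym orbit_dist_commute_le)

text \<open>Near-optimal relabellings are composed. The second term survives because relabelling
  both arguments by \<open>\<sigma>\<close> does not increase the cut distance.\<close>

lemma orbit_dist_triangle: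
  assumes f: "f \<in> graphons" and g: "g \<in> graphons" and h: "h \<in> graphons"
  shows "orbit_dist f h \<le> orbit_dist f g + orbit_dist g h"
proof (rule field_le_epsilon)
  fix e :: real assume "e > 0"
  obtain \<sigma> where \<sigma>: "\<sigma> \<in> mp_bijections" "cut_dist f (relabel g \<sigma>) < orbit_dist f g + e/2"
    by (rule orbit_dist_lessD[OF f g, of "orbit_dist f g + e/2"]) (use \<open>e > 0\<close> in auto)
  obtain \<tau> where \<tau>: "\<tau> \<in> mp_bijections" "cut_dist g (relabel h \<tau>) < orbit_dist g h + e/2"
    by (rule orbit_dist_lessD[OF g h, of "orbit_dist g h + e/2"]) (use \<open>e > 0\<close> in auto)
  have "orbit_dist f h \<le> cut_dist f (relabel h (\<tau> \<circ> \<sigma>))"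
    using orbit_dist_le[OF f h mp_comp[OF \<tau>(1) \<sigma>(1)]] .
  also have "\<dots> \<le> cut_dist f (relabel g \<sigma>) + cut_dist (relabel g \<sigma>) (relabel h (\<tau> \<circ> \<sigma>))"
    using f g h \<sigma> \<tau> by (intro cut_dist_triangle relabel_graphon mp_comp)
  also have "cut_dist (relabel g \<sigma>) (relabel h (\<tau> \<circ> \<sigma>)) \<le> cut_dist g (relabel h \<tau>)"
    using cut_dist_relabel_le[OF \<sigma>(1) g relabel_graphon[OF \<tau>(1) h]] \<sigma> by (simp add: relabel_relabel)
  finally show "orbit_dist f h \<le> orbit_dist f g + orbit_dist g h + e" using \<sigma> \<tau> by simp
qed

lemma orbit_dist_relabel_self:
  assumes f: "f \<in> graphons" and \<sigma>: "\<sigma> \<in> mp_bijections"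
  shows "orbit_dist f (relabel f \<sigma>) = 0"
  using orbit_dist_le[of "relabel f \<sigma>" f \<sigma>] orbit_dist_nonneg[of "relabel f \<sigma>" f] assms
  by (simp add: orbit_dist_commute[of f] relabel_graphon)

section \<open>Classes as zero sets of the pseudometric\<close>

lemma graphon_class_eq:
  assumes g: "g \<in> graphons"
  shows "graphon_class g = {h \<in> graphons. orbit_dist h g = 0}"
proof -
  have "(\<forall>e>0. \<exists>\<sigma>\<in>mp_bijections. cut_dist h (relabel g \<sigma>) < e) \<longleftrightarrow> orbit_dist h g = 0"
    if h: "h \<in> graphons" for h
  proof
    assume a: "\<forall>e>0. \<exists>\<sigma>\<in>mp_bijections. cut_dist h (relabel g \<sigma>) < e"
    have "orbit_dist h g \<le> 0 + e" if "e > 0" for e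
      using a that orbit_dist_le[OF h g] by force
    then have "orbit_dist h g \<le> 0" by (rule field_le_epsilon)
    then show "orbit_dist h g = 0" using orbit_dist_nonneg[OF h g] by simp
  next
    assume "orbit_dist h g = 0"
    then show "\<forall>e>0. \<exists>\<sigma>\<in>mp_bijections. cut_dist h (relabel g \<sigma>) < e"
      using orbit_dist_lessD[OF h g] by metis
  qed
  then show ?thesis unfolding graphon_class_def by auto
qed

lemma graphon_class_eq_iff:
  assumes f: "f \<in> graphons" and g: "g \<in> graphons"
  shows "graphon_class f = graphon_class g \<longleftrightarrow> orbit_dist f g = 0"
proof
  assume "graphon_class f = graphon_class g"
  moreover have "f \<in> graphon_class f" using f by (simp add: graphon_class_eq)
  ultimately show "orbit_dist f g = 0" using g by (simp add: graphon_class_eq)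
next
  assume z: "orbit_dist f g = 0"
  have "orbit_dist h f = 0 \<longleftrightarrow> orbit_dist h g = 0" if h: "h \<in> graphons" for h
    using orbit_dist_triangle[OF h f g] orbit_dist_triangle[OF h g f] z orbit_dist_commute[OF f g]
      orbit_dist_nonneg[OF h f] orbit_dist_nonneg[OF h g] by auto
  then show "graphon_class f = graphon_class g" using f g by (auto simp: graphon_class_eq)
qed

lemma class_rep:
  assumes "A \<in> graphon_space"
  shows "class_rep A \<in> graphons" "graphon_class (class_rep A) = A"
proof -
  obtain f where f: "f \<in> graphons" "A = graphon_class f" using assms by (auto simp: graphon_space_def)
  then have "f \<in> A" by (simp add: graphon_class_eq)
  then have "class_rep A \<in> A" unfolding class_rep_def by (rule someI[of "\<lambda>f. f \<in> A"])
  with f have "class_rep A \<in> graphons" "orbit_dist (class_rep A) f = 0"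
    by (auto simp: graphon_class_eq)
  with f show "class_rep A \<in> graphons" "graphon_class (class_rep A) = A"
    by (auto simp only: graphon_class_eq_iff)
qed

lemma graphon_class_in_space [intro]: "f \<in> graphons \<Longrightarrow> graphon_class f \<in> graphon_space"
  by (auto simp: graphon_space_def)

lemma orbit_dist_class_rep: "f \<in> graphons \<Longrightarrow> orbit_dist (class_rep (graphon_class f)) f = 0"
  by (subst graphon_class_eq_iff[symmetric]) (simp_all add: class_rep graphon_class_in_space)

lemma delta_cut_eq: "A \<in> graphon_space \<Longrightarrow> B \<in> graphon_space \<Longrightarrow>
    delta_cut A B = orbit_dist (class_rep A) (class_rep B)"
  by (simp add: delta_cut_def orbit_dist_def)

text \<open>Independence of the representatives: each lies at distance zero from the function it
  replaces.\<close>

lemma delta_cut_class: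
  assumes f: "f \<in> graphons" and g: "g \<in> graphons"
  shows "delta_cut (graphon_class f) (graphon_class g) = orbit_dist f g"
proof -
  let ?f = "class_rep (graphon_class f)" and ?g = "class_rep (graphon_class g)"
  have G: "?f \<in> graphons" "?g \<in> graphons" using f g by (auto intro: class_rep)
  have 0: "orbit_dist ?f f = 0" "orbit_dist ?g g = 0" "orbit_dist f ?f = 0" "orbit_dist g ?g = 0"
    using orbit_dist_class_rep[OF f] orbit_dist_class_rep[OF g] orbit_dist_commute[OF f G(1)]
      orbit_dist_commute[OF g G(2)] by auto
  have "orbit_dist ?f ?g \<le> orbit_dist f g"
    using orbit_dist_triangle[OF G(1) f G(2)] orbit_dist_triangle[OF f g G(2)] 0 by linarith
  moreover have "orbit_dist f g \<le> orbit_dist ?f ?g"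
    using orbit_dist_triangle[OF f G(1) g] orbit_dist_triangle[OF G(1) G(2) g] 0 by linarith
  ultimately show ?thesis using f g by (simp add: delta_cut_eq graphon_class_in_space)
qed

lemma Metric_space_graphon_space: "Metric_space graphon_space delta_cut"
proof
  fix x y z
  show "0 \<le> delta_cut x y"
    by (cases "x \<in> graphon_space \<and> y \<in> graphon_space")
       (auto simp: delta_cut_eq class_rep orbit_dist_nonneg, auto simp: delta_cut_def)
  show "delta_cut x y = delta_cut y x"
    by (cases "x \<in> graphon_space \<and> y \<in> graphon_space")
       (auto simp: delta_cut_eq class_rep intro: orbit_dist_commute, auto simp: delta_cut_def)
  assume x: "x \<in> graphon_space" and y: "y \<in> graphon_space"
  show "delta_cut x y = 0 \<longleftrightarrow> x = y"
    using x y graphon_class_eq_iff[of "class_rep x" "class_rep y"] by (simp add: delta_cut_eq class_rep)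
  assume "z \<in> graphon_space"
  with x y show "delta_cut x z \<le> delta_cut x y + delta_cut y z"
    by (simp add: delta_cut_eq class_rep orbit_dist_triangle)
qed

interpretation graphon: Metric_space graphon_space delta_cut
  by (rule Metric_space_graphon_space)

section \<open>The rate function\<close>

text \<open>The inequality \<open>ln t \<le> t - 1\<close> at \<open>t = a / x\<close>. At
  \<open>x = 0\<close> the factor in front of the logarithm leaves
  \<open>- a \<le> 0\<close>.\<close>

lemma xlogx_ge: "0 \<le> x \<Longrightarrow> 0 < a \<Longrightarrow> x - a \<le> x * ln (x / a)" for x a :: real
proof (cases "x = 0")
  case False
  assume "0 \<le> x" "0 < a"
  with False have "x * ln (a / x) \<le> x * (a / x - 1)" by (intro mult_left_mono ln_le_minus_one) auto
  with False \<open>0 \<le> x\<close> \<open>0 < a\<close> show ?thesis by (simp add: ln_div algebra_simps)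
qed simp

text \<open>The left side is the tangent to \<open>rate p\<close> at \<open>a\<close>, evaluated at
  \<open>u\<close>. The difference of the two sides is half the relative entropy of Bernoulli laws
  with means \<open>u\<close> and \<open>a\<close>.\<close>

lemma rate_tangent:
  assumes p: "0 < p" "p < 1" and a: "0 < a" "a < 1" and u: "0 \<le> u" "u \<le> 1"
  shows "1/2 * (u * ln (a / p) + (1 - u) * ln ((1 - a) / (1 - p))) \<le> rate p u"
proof -
  have 1: "u * ln (u / p) = u * ln (u / a) + u * ln (a / p)"
    using p a u by (cases "u = 0") (auto simp: ln_div algebra_simps)
  have 2: "(1 - u) * ln ((1 - u) / (1 - p)) = (1 - u) * ln ((1 - u) / (1 - a)) + (1 - u) * ln ((1 - a) / (1 - p))"
    using p a u by (cases "u = 1") (auto simp: ln_div algebra_simps)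
  have "u - a \<le> u * ln (u / a)" "(1 - u) - (1 - a) \<le> (1 - u) * ln ((1 - u) / (1 - a))"
    using a u xlogx_ge[of u a] xlogx_ge[of "1 - u" "1 - a"] by auto
  moreover have "rate p u = 1/2 * (u * ln (u / p) + (1 - u) * ln ((1 - u) / (1 - p)))"
    unfolding rate_def by (simp only: distrib_left mult.assoc)
  \<comment> \<open>The lower bounds \<open>u - a\<close> and \<open>(1 - u) - (1 - a)\<close>
    cancel. Letters stand for the logarithmic terms, since only linear arithmetic is left.\<close>
  moreover have "1/2 * (A2 + B2) \<le> r"
    if "r = 1/2 * (A + B)" "A = A1 + A2" "B = B1 + B2" "u - a \<le> A1" "(1 - u) - (1 - a) \<le> B1"
    for r A B A1 A2 B1 B2 :: real using that by simp
  ultimately show ?thesis using 1 2 by blast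
qed

lemma rate_self [simp]: "0 < p \<Longrightarrow> p < 1 \<Longrightarrow> rate p p = 0"
  by (simp add: rate_def)

lemma rate_nonneg: "0 < p \<Longrightarrow> p < 1 \<Longrightarrow> 0 \<le> u \<Longrightarrow> u \<le> 1 \<Longrightarrow> 0 \<le> rate p u"
  using rate_tangent[of p p u] by simp

lemma continuous_xlogx: "continuous_on {0..} (\<lambda>x::real. x * ln x)"
  unfolding continuous_on_def
proof
  fix x :: real assume "x \<in> {0..}"
  show "((\<lambda>x. x * ln x) \<longlongrightarrow> x * ln x) (at x within {0..})"
  proof (cases "x = 0")
    case True
    have "at (0::real) within {0..} = at_right 0"
      by (simp add: at_within_Ici_at_right)
    moreover have "((\<lambda>x::real. x * ln x) \<longlongrightarrow> 0) (at_right 0)" by real_asymp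
    ultimately show ?thesis using True by simp
  next
    case False
    then show ?thesis by (auto intro!: tendsto_intros)
  qed
qed

lemma continuous_rate:
  assumes p: "0 < p" "p < 1"
  shows "continuous_on {0..1} (rate p)"
proof -
  have "continuous_on {0..1} (\<lambda>u::real. 1/2 * (u * ln u) - 1/2 * u * ln p + 1/2 * ((1-u) * ln (1-u)) - 1/2 * (1-u) * ln (1-p))"
    by (intro continuous_intros continuous_on_subset[OF continuous_xlogx]
        continuous_on_compose2[OF continuous_xlogx, of "{0..1}" "\<lambda>u. 1 - u"]) auto
  moreover have "1/2 * (u * ln u) - 1/2 * u * ln p + 1/2 * ((1-u) * ln (1-u)) - 1/2 * (1-u) * ln (1-p) = rate p u"
    if "u \<in> {0..1}" for u
  proof -
    have "u * ln (u/p) = u * ln u - u * ln p" using p that by (cases "u = 0") (auto simp: ln_div algebra_simps)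
    moreover have "(1-u) * ln ((1-u)/(1-p)) = (1-u) * ln (1-u) - (1-u) * ln (1-p)"
      using p that by (cases "u = 1") (auto simp: ln_div algebra_simps)
    ultimately show ?thesis unfolding rate_def mult.assoc by (simp add: right_diff_distrib)
  qed
  ultimately show ?thesis by (rule continuous_on_eq)
qed

lemma rate_bounded:
  assumes p: "0 < p" "p < 1"
  obtains M where "M > 0" "\<And>u. 0 \<le> u \<Longrightarrow> u \<le> 1 \<Longrightarrow> \<bar>rate p u\<bar> \<le> M"
proof -
  have "bounded (rate p ` {0..1})"
    by (intro compact_imp_bounded compact_continuous_image continuous_rate p) auto
  then show ?thesis using that unfolding bounded_pos by force
qed

text \<open>The slope of \<open>rate p\<close> is infinite at 0 and 1, so no Lipschitz bound holds.
  Uniform continuity settles close arguments within the slack \<open>\<eta>\<close>; for arguments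
  at distance \<open>d\<close> or more, the linear term exceeds the total oscillation
  \<open>2 * M\<close>. A bound affine in the distance integrates to one in terms of
  \<open>l1_dist\<close>.\<close>

lemma rate_modulus:
  assumes p: "0 < p" "p < 1" and "\<eta> > 0"
  obtains C where "C \<ge> 0"
    "\<And>u v. 0 \<le> u \<Longrightarrow> u \<le> 1 \<Longrightarrow> 0 \<le> v \<Longrightarrow> v \<le> 1 \<Longrightarrow> \<bar>rate p u - rate p v\<bar> \<le> \<eta> + C * \<bar>u - v\<bar>"
proof -
  obtain M where M: "M > 0" "\<And>u. 0 \<le> u \<Longrightarrow> u \<le> 1 \<Longrightarrow> \<bar>rate p u\<bar> \<le> M" by (rule rate_bounded[OF p]) blast
  have "uniformly_continuous_on {0..1} (rate p)"
    by (intro compact_uniformly_continuous continuous_rate p) auto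
  then obtain d where d: "d > 0" "\<And>u v. u \<in> {0..1} \<Longrightarrow> v \<in> {0..1} \<Longrightarrow> \<bar>v - u\<bar> < d \<Longrightarrow> \<bar>rate p v - rate p u\<bar> < \<eta>"
    using \<open>\<eta> > 0\<close> unfolding uniformly_continuous_on_def dist_real_def by metis
  show ?thesis
  proof (rule that[of "2 * M / d"])
    fix u v :: real assume uv: "0 \<le> u" "u \<le> 1" "0 \<le> v" "v \<le> 1"
    have C: "2 * M / d * \<bar>u - v\<bar> \<ge> 0" using M d by auto
    show "\<bar>rate p u - rate p v\<bar> \<le> \<eta> + 2 * M / d * \<bar>u - v\<bar>"
    proof (cases "\<bar>u - v\<bar> < d")
      case True
      then show ?thesis using d(2)[of v u] uv C by auto
    next
      case False
      then have "2 * M * 1 \<le> 2 * M * (\<bar>u - v\<bar> / d)" using d M by (intro mult_left_mono) auto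
      then show ?thesis using M(2)[of u] M(2)[of v] uv \<open>\<eta> > 0\<close> by (auto simp: abs_le_iff)
    qed
  qed (use M d in auto)
qed

lemma rate_measurable [measurable]: "rate p \<in> borel_measurable borel"
  unfolding rate_def[abs_def] by measurable

lemma rate_graphon_measurable: "h \<in> graphons \<Longrightarrow> (\<lambda>z. rate p (h z)) \<in> borel_measurable sqm"
  by (rule measurable_compose[OF graphon_measurable rate_measurable])

lemma rate_graphon_integrable:
  assumes p: "0 < p" "p < 1" and h: "h \<in> graphons"
  shows "integrable sqm (\<lambda>z. rate p (h z))"
proof -
  obtain M where M: "M > 0" "\<And>u. 0 \<le> u \<Longrightarrow> u \<le> 1 \<Longrightarrow> \<bar>rate p u\<bar> \<le> M" by (rule rate_bounded[OF p]) blast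
  show ?thesis
    by (rule integrable_sqm[where B=M]) (use M h graphon_ge_0[OF h] graphon_le_1[OF h] in \<open>auto intro: rate_graphon_measurable\<close>)
qed

lemma graphon_rate_eq:
  assumes p: "0 < p" "p < 1" and h: "h \<in> graphons"
  shows "graphon_rate p h = (\<integral>z. rate p (h z) \<partial>sqm)"
proof -
  have *: "(LINT x:{0..1}|lborel. g x) = (\<integral>x. g x \<partial>unit_leb)" for g :: "real \<Rightarrow> real"
    by (subst integral_restrict_space) (auto simp: set_lebesgue_integral_def)
  show ?thesis
    unfolding graphon_rate_def * sqm_def
    using rate_graphon_integrable[OF p h] unfolding sqm_def by (rule unit_leb2.integral_fst')
qed

lemma graphon_rate_relabel:
  assumes p: "0 < p" "p < 1" and h: "h \<in> graphons" and \<sigma>: "\<sigma> \<in> mp_bijections"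
  shows "graphon_rate p (relabel h \<sigma>) = graphon_rate p h"
proof -
  have "graphon_rate p (relabel h \<sigma>) = (\<integral>z. rate p (h (\<sigma> (fst z), \<sigma> (snd z))) \<partial>sqm)"
    unfolding graphon_rate_eq[OF p relabel_graphon[OF \<sigma> h]]
    by (intro Bochner_Integration.integral_cong) (auto simp: relabel_def)
  then show ?thesis
    using integral_relabel[OF \<sigma> rate_graphon_measurable[OF h]] graphon_rate_eq[OF p h] by simp
qed

lemma graphon_rate_nonneg:
  assumes p: "0 < p" "p < 1" and h: "h \<in> graphons"
  shows "0 \<le> graphon_rate p h"
  unfolding graphon_rate_eq[OF assms]
  using graphon_ge_0[OF h] graphon_le_1[OF h] p by (intro Bochner_Integration.integral_nonneg) (auto intro!: rate_nonneg)

lemma graphon_rate_modulus: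
  assumes p: "0 < p" "p < 1" and "\<eta> > 0"
  obtains C where "C \<ge> 0"
    "\<And>f g. f \<in> graphons \<Longrightarrow> g \<in> graphons \<Longrightarrow> \<bar>graphon_rate p f - graphon_rate p g\<bar> \<le> \<eta> + C * l1_dist f g"
proof -
  obtain C where C: "C \<ge> 0"
    "\<And>u v. 0 \<le> u \<Longrightarrow> u \<le> 1 \<Longrightarrow> 0 \<le> v \<Longrightarrow> v \<le> 1 \<Longrightarrow> \<bar>rate p u - rate p v\<bar> \<le> \<eta> + C * \<bar>u - v\<bar>"
    by (rule rate_modulus[OF assms]) blast
  show ?thesis
  proof (rule that[OF C(1)])
    fix f g assume f: "f \<in> graphons" and g: "g \<in> graphons"
    have I: "integrable sqm (\<lambda>z. \<bar>f z - g z\<bar>)" by (rule graphon_diff_integrable[OF f g])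
    note fI = graphon_integrable[OF f] graphon_integrable[OF g]
    have "\<bar>graphon_rate p f - graphon_rate p g\<bar> = \<bar>\<integral>z. rate p (f z) - rate p (g z) \<partial>sqm\<bar>"
      using f g p by (simp add: graphon_rate_eq rate_graphon_integrable)
    also have "\<dots> \<le> (\<integral>z. \<bar>rate p (f z) - rate p (g z)\<bar> \<partial>sqm)" by (rule integral_abs_bound)
    also have "\<dots> \<le> (\<integral>z. \<eta> + C * \<bar>f z - g z\<bar> \<partial>sqm)"
      using f g p I fI graphon_ge_0[OF f] graphon_le_1[OF f] graphon_ge_0[OF g] graphon_le_1[OF g]
      by (intro integral_mono integrable_abs Bochner_Integration.integrable_diff rate_graphon_integrable
            Bochner_Integration.integrable_add sqm.integrable_const integrable_mult_right C(2)) auto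
    also have "\<dots> = \<eta> + C * l1_dist f g"
      unfolding l1_dist_def using I sqm.prob_space by simp
    finally show "\<bar>graphon_rate p f - graphon_rate p g\<bar> \<le> \<eta> + C * l1_dist f g" .
  qed
qed

text \<open>The tangent at the mean \<open>a\<close> of \<open>h\<close> is integrated over the
  rectangle. No tangent exists at \<open>a = 0\<close> or \<open>a = 1\<close>, but then
  \<open>h\<close> equals its mean almost everywhere on the rectangle and equality holds.\<close>

lemma rate_jensen:
  assumes p: "0 < p" "p < 1" and h: "h \<in> graphons"
    and S: "S \<in> sets unit_leb" and T: "T \<in> sets unit_leb" and m: "measure sqm (S \<times> T) > 0"
  shows "rate p (rect_integral h S T / measure sqm (S \<times> T)) * measure sqm (S \<times> T)
    \<le> rect_integral (\<lambda>z. rate p (h z)) S T"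
proof -
  let ?m = "measure sqm (S \<times> T)" and ?i = "indicator (S \<times> T) :: real \<times> real \<Rightarrow> real"
  define a where "a = rect_integral h S T / ?m"
  have hI: "integrable sqm (\<lambda>z. ?i z * h z)" using S T h by (intro integrable_rect graphon_integrable)
  have rI: "integrable sqm (\<lambda>z. ?i z * rate p (h z))" using S T h p by (intro integrable_rect rate_graphon_integrable)
  have iI: "integrable sqm ?i" using S T by (intro integrable_sqm[where B=1]) (auto simp: indicator_def)
  have im: "(\<integral>z. ?i z \<partial>sqm) = ?m" using sets.Int_space_eq2[OF rect_sets[OF S T]] by simp
  have ri: "rect_integral h S T = a * ?m" using m by (simp add: a_def)
  have h01: "z \<in> unit_sq \<Longrightarrow> 0 \<le> h z \<and> h z \<le> 1" for z using graphon_ge_0[OF h] graphon_le_1[OF h] by auto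
  have "0 \<le> rect_integral h S T" unfolding rect_integral_def
    using h01 by (intro Bochner_Integration.integral_nonneg) auto
  then have a0: "0 \<le> a" using m by (simp add: a_def)
  have "rect_integral h S T \<le> (\<integral>z. ?i z \<partial>sqm)" unfolding rect_integral_def
    by (rule integral_mono[OF hI iI]) (use h01 in \<open>auto simp: indicator_def\<close>)
  then have a1: "a \<le> 1" using m im by (simp add: a_def)
  consider "a = 0" | "a = 1" | "0 < a" "a < 1" using a0 a1 by fastforce
  then have "rate p a * ?m \<le> rect_integral (\<lambda>z. rate p (h z)) S T"
  proof cases
    case 1
    have "AE z in sqm. ?i z * h z = 0"
      using integral_nonneg_eq_0_iff_AE[OF hI AE_I2] h01 ri 1 unfolding rect_integral_def by simp
    then have "AE z in sqm. ?i z * rate p a = ?i z * rate p (h z)"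
      by eventually_elim (auto simp: indicator_def 1)
    then have "(\<integral>z. ?i z * rate p a \<partial>sqm) = rect_integral (\<lambda>z. rate p (h z)) S T"
      unfolding rect_integral_def using rI iI by (intro integral_cong_AE) auto
    then show ?thesis using im iI by (simp add: mult.commute)
  next
    case 2
    have "integrable sqm (\<lambda>z. ?i z - ?i z * h z)" using iI hI by (rule Bochner_Integration.integrable_diff)
    moreover have "(\<integral>z. ?i z - ?i z * h z \<partial>sqm) = 0"
      using iI hI ri 2 im unfolding rect_integral_def by simp
    ultimately have "AE z in sqm. ?i z - ?i z * h z = 0"
      using integral_nonneg_eq_0_iff_AE[of sqm "\<lambda>z. ?i z - ?i z * h z", OF _ AE_I2] h01
      by (auto simp: indicator_def)
    then have "AE z in sqm. ?i z * rate p a = ?i z * rate p (h z)"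
      by eventually_elim (auto simp: indicator_def 2)
    then have "(\<integral>z. ?i z * rate p a \<partial>sqm) = rect_integral (\<lambda>z. rate p (h z)) S T"
      unfolding rect_integral_def using rI iI by (intro integral_cong_AE) auto
    then show ?thesis using im iI by (simp add: mult.commute)
  next
    case 3
    \<comment> \<open>The values at \<open>u = 1\<close> and \<open>u = 0\<close> of the tangent at
      \<open>a\<close>.\<close>
    define c d where "c = ln (a / p) / 2" and "d = ln ((1 - a) / (1 - p)) / 2"
    have r: "rate p a = a * c + (1 - a) * d" by (simp add: rate_def c_def d_def)
    have "rate p a * ?m = (a * ?m) * (c - d) + ?m * d" unfolding r by (simp add: algebra_simps)
    also have "\<dots> = (\<integral>z. (?i z * h z) * (c - d) \<partial>sqm) + (\<integral>z. ?i z * d \<partial>sqm)"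
      unfolding ri[symmetric] rect_integral_def by (simp only: integral_mult_left_zero im)
    also have "\<dots> = (\<integral>z. (?i z * h z) * (c - d) + ?i z * d \<partial>sqm)"
      using hI iI by (intro Bochner_Integration.integral_add[symmetric] integrable_mult_left) auto
    also have "\<dots> \<le> rect_integral (\<lambda>z. rate p (h z)) S T"
      unfolding rect_integral_def
    proof (intro integral_mono rI)
      show "integrable sqm (\<lambda>z. (?i z * h z) * (c - d) + ?i z * d)"
        using hI iI by (intro Bochner_Integration.integrable_add integrable_mult_left) auto
      fix z assume "z \<in> space sqm"
      then show "(?i z * h z) * (c - d) + ?i z * d \<le> ?i z * rate p (h z)"
        using rate_tangent[OF p 3, of "h z"] h01[of z] by (auto simp: indicator_def c_def d_def field_simps)
    qed
    finally show ?thesis .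
  qed
  then show ?thesis by (simp add: a_def)
qed

section \<open>Completeness\<close>

lemma rect_integral_swap:
  assumes f: "f \<in> borel_measurable sqm" and S: "S \<in> sets unit_leb" and T: "T \<in> sets unit_leb"
  shows "rect_integral (\<lambda>(x, y). f (y, x)) S T = rect_integral f T S"
proof -
  have "(\<lambda>z. indicator (T \<times> S) z * f z) \<in> borel_measurable sqm"
    using assms by (intro borel_measurable_times borel_measurable_indicator rect_sets)
  then have "(\<integral>(x, y). indicator (T \<times> S) (y, x) * f (y, x) \<partial>sqm) = rect_integral f T S"
    unfolding rect_integral_def sqm_def by (rule unit_leb2.integral_product_swap)
  moreover have "(\<integral>(x, y). indicator (T \<times> S) (y, x) * f (y, x) \<partial>sqm) = rect_integral (\<lambda>(x, y). f (y, x)) S T"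
    unfolding rect_integral_def by (intro Bochner_Integration.integral_cong) (auto simp: indicator_def)
  ultimately show ?thesis by simp
qed

lemma rect_integral_graphon_swap:
  assumes h: "h \<in> graphons" and S: "S \<in> sets unit_leb" and T: "T \<in> sets unit_leb"
  shows "rect_integral h S T = rect_integral h T S"
proof -
  have "rect_integral h S T = rect_integral (\<lambda>(x, y). h (y, x)) S T"
    unfolding rect_integral_def using graphon_sym[OF h]
    by (intro Bochner_Integration.integral_cong) auto
  then show ?thesis using rect_integral_swap[OF graphon_measurable[OF h] S T] by simp
qed

lemma set_integral_sqm_bounds:
  assumes h: "h \<in> graphons" and B: "B \<in> sets sqm"
  shows "0 \<le> (\<integral>z. indicator B z * h z \<partial>sqm)" "(\<integral>z. indicator B z * h z \<partial>sqm) \<le> measure sqm B"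
    "integrable sqm (\<lambda>z. indicator B z * h z)"
proof -
  have h01: "z \<in> unit_sq \<Longrightarrow> 0 \<le> h z \<and> h z \<le> 1" for z using graphon_ge_0[OF h] graphon_le_1[OF h] by auto
  show I: "integrable sqm (\<lambda>z. indicator B z * h z)"
    using integrable_real_mult_indicator[OF B graphon_integrable[OF h]] by (simp add: mult.commute)
  show "0 \<le> (\<integral>z. indicator B z * h z \<partial>sqm)"
    using h01 by (intro Bochner_Integration.integral_nonneg) auto
  have J: "integrable sqm (indicator B :: _ \<Rightarrow> real)" using B by (simp add: sqm.emeasure_finite less_top[symmetric])
  have "(\<integral>z. indicator B z * h z \<partial>sqm) \<le> (\<integral>z. indicator B z \<partial>sqm)"
    by (rule integral_mono[OF I J]) (use h01 in \<open>auto simp: indicator_def\<close>)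
  also have "\<dots> = measure sqm B" using sets.Int_space_eq2[OF B] by simp
  finally show "(\<integral>z. indicator B z * h z \<partial>sqm) \<le> measure sqm B" .
qed

lemma rect_generator_eq: "sets sqm = sigma_sets unit_sq {a \<times> b | a b. a \<in> sets unit_leb \<and> b \<in> sets unit_leb}"
  unfolding sqm_def sets_pair_measure by simp

text \<open>The weak limit of a sequence that is Cauchy for the cut distance is the density of the limiting
  set function, whose countable additivity comes from domination by Lebesgue measure.\<close>

lemma weak_limit_density:
  fixes g :: "nat \<Rightarrow> real \<times> real \<Rightarrow> real"
  assumes g: "\<And>m. g m \<in> graphons"
    and lim: "\<And>S T. S \<in> sets unit_leb \<Longrightarrow> T \<in> sets unit_leb \<Longrightarrow> convergent (\<lambda>m. rect_integral (g m) S T)"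
  obtains f :: "real \<times> real \<Rightarrow> ennreal" where "f \<in> borel_measurable sqm" "AE z in sqm. f z \<le> 1"
    "\<And>B. B \<in> sets sqm \<Longrightarrow>
      (\<integral>\<^sup>+z. f z * indicator B z \<partial>sqm) = ennreal (lim (\<lambda>m. \<integral>z. indicator B z * g m z \<partial>sqm))"
    "\<And>B. B \<in> sets sqm \<Longrightarrow> convergent (\<lambda>m. \<integral>z. indicator B z * g m z \<partial>sqm)"
proof -
  define I where "I m B = (\<integral>z. indicator B z * g m z \<partial>sqm)" for m B
  note bnd = set_integral_sqm_bounds[OF g, folded I_def]
  \<comment> \<open>Additivity is inherited from the measure with density \<open>g m\<close>, of
    which \<open>I m\<close> is the real-valued form.\<close>
  have sums: "(\<lambda>i. I m (A i)) sums I m (\<Union>i. A i)"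
    if A: "range A \<subseteq> sets sqm" "disjoint_family A" for A :: "nat \<Rightarrow> _" and m
  proof -
    define D where "D = density sqm (\<lambda>z. ennreal (g m z))"
    have D: "emeasure D B = ennreal (I m B)" if B: "B \<in> sets sqm" for B
    proof -
      have "emeasure D B = (\<integral>\<^sup>+z. ennreal (indicator B z * g m z) \<partial>sqm)"
        unfolding D_def using B graphon_measurable[OF g]
        by (subst emeasure_density) (auto intro!: nn_integral_cong simp: indicator_def)
      also have "\<dots> = ennreal (I m B)"
        unfolding I_def using graphon_ge_0[OF g] set_integral_sqm_bounds(3)[OF g B]
        by (intro nn_integral_eq_integral) (auto intro!: AE_I2)
      finally show ?thesis .
    qed
    have U: "(\<Union>i. A i) \<in> sets sqm" "\<And>i. A i \<in> sets sqm" using A by auto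
    have "(\<lambda>i. emeasure D (A i)) sums emeasure D (\<Union>i. A i)"
      using suminf_emeasure[of A D] A by (simp add: D_def sums_iff)
    then have "(\<lambda>i. ennreal (I m (A i))) sums ennreal (I m (\<Union>i. A i))" by (simp add: D U)
    then show ?thesis using bnd(1) U by (subst (asm) sums_ennreal) auto
  qed
  have Adm: "summable (\<lambda>i. measure sqm (A i))"
    if A: "range A \<subseteq> sets sqm" "disjoint_family A" for A :: "nat \<Rightarrow> _"
    using sqm.finite_measure_UNION[OF A] by (rule sums_summable)
  \<comment> \<open>The terms are dominated by the measures of the \<open>A i\<close>, uniformly in
    \<open>m\<close>, so that limit and sum may be exchanged. This serves twice: for convergence on
    disjoint unions, and for additivity of the limit.\<close>
  have tan: "(\<lambda>m. I m (\<Union>i. A i)) \<longlonglongrightarrow> (\<Sum>i. lim (\<lambda>m. I m (A i))) \<and> summable (\<lambda>i. lim (\<lambda>m. I m (A i)))"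
    if A: "range A \<subseteq> sets sqm" "disjoint_family A" and c: "\<And>i. convergent (\<lambda>m. I m (A i))" for A
  proof -
    have "eventually (\<lambda>m. summable (\<lambda>i. norm (I m (A i)))) sequentially \<and>
          summable (\<lambda>i. norm (lim (\<lambda>m. I m (A i)))) \<and>
          ((\<lambda>m. suminf (\<lambda>i. I m (A i))) \<longlonglongrightarrow> suminf (\<lambda>i. lim (\<lambda>m. I m (A i))))"
    proof (rule tannerys_theorem[where M = "\<lambda>i. measure sqm (A i)"])
      show "(\<lambda>m. I m (A k)) \<longlonglongrightarrow> lim (\<lambda>m. I m (A k))" for k
        using c by (simp add: convergent_LIMSEQ_iff)
      show "eventually (\<lambda>(k,n). norm (I n (A k)) \<le> measure sqm (A k)) (at_top \<times>\<^sub>F sequentially)"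
        by (rule always_eventually) (use bnd A in \<open>auto simp: abs_le_iff range_subsetD intro: order_trans[of _ 0]\<close>)
    qed (use Adm[OF A] in auto)
    moreover have "suminf (\<lambda>i. I m (A i)) = I m (\<Union>i. A i)" for m using sums[OF A] by (simp add: sums_iff)
    ultimately show ?thesis by (auto intro: summable_rabs_cancel)
  qed
  \<comment> \<open>Dynkin's argument: rectangles are stable under intersection and generate the
    sigma-algebra, complements are subtracted from the whole square, and disjoint unions are the
    previous step.\<close>
  have conv: "convergent (\<lambda>m. I m B)" if B: "B \<in> sets sqm" for B
  proof -
    have Bs: "B \<in> sigma_sets unit_sq {a \<times> b | a b. a \<in> sets unit_leb \<and> b \<in> sets unit_leb}"
      using B unfolding rect_generator_eq .
    have sub: "{a \<times> b | a b. a \<in> sets unit_leb \<and> b \<in> sets unit_leb} \<subseteq> Pow unit_sq"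
      using sets.sets_into_space[of _ unit_leb] by fastforce
    from Int_stable_pair_measure_generator[of unit_leb unit_leb] sub Bs show ?thesis
    proof (induct B rule: sigma_sets_induct_disjoint)
      case (basic A) then show ?case using lim by (auto simp: rect_integral_def I_def)
    next
      case (compl A)
      then have A: "A \<in> sets sqm" unfolding rect_generator_eq by blast
      have "I m (unit_sq - A) = I m unit_sq - I m A" for m
      proof -
        have u: "unit_sq \<in> sets sqm" using sets.top[of sqm] by simp
        have "I m unit_sq - I m A = (\<integral>z. indicator unit_sq z * g m z - indicator A z * g m z \<partial>sqm)"
          unfolding I_def using set_integral_sqm_bounds(3)[OF g] A u by simp
        also have "\<dots> = I m (unit_sq - A)" unfolding I_def
          using sets.sets_into_space[OF A]
          by (intro Bochner_Integration.integral_cong) (auto simp: indicator_def)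
        finally show ?thesis by simp
      qed
      moreover have "convergent (\<lambda>m. I m unit_sq)"
        using lim[of "{0..1}" "{0..1}"] unfolding I_def rect_integral_def by (simp add: sets_unit_leb_iff)
      ultimately show ?case using compl convergent_diff by auto
    next
      case (union A)
      then have "range A \<subseteq> sets sqm" unfolding rect_generator_eq by blast
      then show ?case using tan[of A] union by (auto simp: convergent_def)
    next
      case empty
      then show ?case by (simp add: I_def convergent_const)
    qed
  qed
  define \<nu> where "\<nu> B = lim (\<lambda>m. I m B)" for B
  have \<nu>: "(\<lambda>m. I m B) \<longlonglongrightarrow> \<nu> B" if "B \<in> sets sqm" for B
    using conv[OF that] by (simp add: convergent_LIMSEQ_iff \<nu>_def)
  have \<nu>0: "0 \<le> \<nu> B" if "B \<in> sets sqm" for B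
    using \<nu>[OF that] by (rule LIMSEQ_le_const) (use bnd that in auto)
  have \<nu>le: "\<nu> B \<le> measure sqm B" if "B \<in> sets sqm" for B
    using \<nu>[OF that] by (rule LIMSEQ_le_const2) (use bnd that in auto)
  define N where "N = measure_of (space sqm) (sets sqm) (\<lambda>B. ennreal (\<nu> B))"
  have N: "emeasure N B = ennreal (\<nu> B)" if "B \<in> sets sqm" for B
    unfolding N_def
  proof (rule emeasure_measure_of_sigma)
    show "sigma_algebra (space sqm) (sets sqm)" ..
    show "positive (sets sqm) (\<lambda>B. ennreal (\<nu> B))"
      by (simp add: positive_def \<nu>_def I_def)
    show "countably_additive (sets sqm) (\<lambda>B. ennreal (\<nu> B))"
      unfolding countably_additive_def
    proof (intro allI impI)
      fix A :: "nat \<Rightarrow> _" assume A: "range A \<subseteq> sets sqm" "disjoint_family A" "\<Union>(range A) \<in> sets sqm"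
      have "(\<lambda>m. I m (\<Union>i. A i)) \<longlonglongrightarrow> (\<Sum>i. \<nu> (A i))" "summable (\<lambda>i. \<nu> (A i))"
        using tan[OF A(1,2)] conv A unfolding \<nu>_def by auto
      moreover from this have "\<nu> (\<Union>i. A i) = (\<Sum>i. \<nu> (A i))" using \<nu>[OF A(3)] LIMSEQ_unique by blast
      ultimately have "(\<lambda>i. \<nu> (A i)) sums \<nu> (\<Union>i. A i)" by (simp add: summable_sums)
      then show "(\<Sum>i. ennreal (\<nu> (A i))) = ennreal (\<nu> (\<Union>(range A)))"
        using A \<nu>0 by (intro suminf_ennreal_eq) auto
    qed
  qed (rule that)
  have sN: "sets N = sets sqm" unfolding N_def by (rule sets.sets_measure_of_eq)
  have "absolutely_continuous sqm N"
    unfolding absolutely_continuous_def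
  proof
    fix B assume B: "B \<in> null_sets sqm"
    then have "measure sqm B = 0" "B \<in> sets sqm" by (auto simp: measure_def)
    then have "\<nu> B = 0" using \<nu>le[of B] \<nu>0[of B] by simp
    then show "B \<in> null_sets N" using N \<open>B \<in> sets sqm\<close> sN by (auto simp: null_sets_def)
  qed
  from sqm.Radon_Nikodym[OF this sN] obtain f where
    f: "f \<in> borel_measurable sqm" "density sqm f = N" by auto
  have fN: "(\<integral>\<^sup>+z. f z * indicator B z \<partial>sqm) = ennreal (\<nu> B)" if "B \<in> sets sqm" for B
    using N[OF that] f that by (auto simp: emeasure_density[symmetric])
  \<comment> \<open>The limit set function is dominated by the measure, so the excess of
    \<open>f\<close> over 1 integrates to a truncated difference in \<open>ennreal\<close>, which is
    0.\<close>
  let ?B = "{z \<in> space sqm. 1 < f z}"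
  have B: "?B \<in> sets sqm" using f by measurable
  have "(\<integral>\<^sup>+z. (f z - 1) * indicator ?B z \<partial>sqm) = (\<integral>\<^sup>+z. f z * indicator ?B z - indicator ?B z \<partial>sqm)"
    by (intro nn_integral_cong) (auto simp: indicator_def)
  also have "\<dots> = (\<integral>\<^sup>+z. f z * indicator ?B z \<partial>sqm) - (\<integral>\<^sup>+z. indicator ?B z \<partial>sqm)"
  proof (rule nn_integral_diff)
    show "(\<integral>\<^sup>+z. indicator ?B z \<partial>sqm) \<noteq> \<infinity>" using B sqm.emeasure_finite by simp
    show "AE z in sqm. indicator ?B z \<le> f z * indicator ?B z" by (intro AE_I2) (auto simp: indicator_def)
  qed (use B f in measurable)
  also have "\<dots> = ennreal (\<nu> ?B) - emeasure sqm ?B" using fN[OF B] B by simp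
  also have "\<dots> = 0"
    using \<nu>le[OF B] by (intro diff_eq_0_ennreal) (auto simp: sqm.emeasure_eq_measure)
  finally have "(\<integral>\<^sup>+z. (f z - 1) * indicator ?B z \<partial>sqm) = 0" .
  then have "AE z in sqm. (f z - 1) * indicator ?B z = 0"
    using f B by (subst (asm) nn_integral_0_iff_AE) auto
  then have "AE z in sqm. f z \<le> 1"
    using AE_space
  proof eventually_elim
    case (elim z)
    then show ?case by (cases "1 < f z") (auto simp: indicator_def diff_eq_0_iff_ennreal not_less)
  qed
  then show ?thesis using that[OF f(1)] fN conv unfolding \<nu>_def I_def by auto
qed

text \<open>Each rectangle integral is Cauchy, so the weak limit exists. Weak convergence is enough:
  the cut distance is a supremum over rectangles, and for each rectangle the Cauchy bound between
  \<open>g m\<close> and \<open>g n\<close> survives the limit in \<open>n\<close>, uniformly over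
  rectangles.\<close>

lemma cut_dist_complete:
  fixes g :: "nat \<Rightarrow> real \<times> real \<Rightarrow> real"
  assumes g: "\<And>m. g m \<in> graphons"
    and Cau: "\<And>e. e > 0 \<Longrightarrow> \<exists>N. \<forall>m\<ge>N. \<forall>n\<ge>N. cut_dist (g m) (g n) \<le> e"
  obtains h where "h \<in> graphons" "\<And>e. e > 0 \<Longrightarrow> \<exists>N. \<forall>m\<ge>N. cut_dist (g m) h \<le> e"
proof -
  have conv: "convergent (\<lambda>m. rect_integral (g m) S T)"
    if ST: "S \<in> sets unit_leb" "T \<in> sets unit_leb" for S T
  proof (rule Cauchy_convergent, rule metric_CauchyI)
    fix e :: real assume "0 < e"
    then obtain N where N: "\<forall>m\<ge>N. \<forall>n\<ge>N. cut_dist (g m) (g n) \<le> e/2" using Cau[of "e/2"] by auto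
    have "dist (rect_integral (g m) S T) (rect_integral (g n) S T) < e" if "m \<ge> N" "n \<ge> N" for m n
    proof -
      have "cut_dist (g m) (g n) \<le> e/2" using N that by blast
      then show ?thesis
        using rect_integral_le_cut_dist[OF g g ST, of m n] \<open>0 < e\<close> by (simp add: dist_real_def)
    qed
    then show "\<exists>M. \<forall>m\<ge>M. \<forall>n\<ge>M. dist (rect_integral (g m) S T) (rect_integral (g n) S T) < e" by blast
  qed
  obtain f where f: "f \<in> borel_measurable sqm" "AE z in sqm. f z \<le> (1::ennreal)"
    and fI: "\<And>B. B \<in> sets sqm \<Longrightarrow>
      (\<integral>\<^sup>+z. f z * indicator B z \<partial>sqm) = ennreal (lim (\<lambda>m. \<integral>z. indicator B z * g m z \<partial>sqm))"
    by (rule weak_limit_density[OF g conv]) blast+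
  \<comment> \<open>The density is at most 1 only almost everywhere, whereas a graphon takes values
    in the unit interval at every point.\<close>
  define k where "k z = min 1 (enn2real (f z))" for z
  have k[measurable]: "k \<in> borel_measurable sqm" unfolding k_def[abs_def] using f by measurable
  have k01: "0 \<le> k z" "k z \<le> 1" for z by (auto simp: k_def)
  have kf: "AE z in sqm. ennreal (k z) = f z"
    using f(2)
  proof eventually_elim
    case (elim z)
    then have "f z < top" by (rule le_less_trans) simp
    moreover have "enn2real (f z) \<le> 1" using elim by (metis enn2real_1 enn2real_mono ennreal_less_top one_ennreal.rep_eq ennreal_1)
    ultimately show ?case by (simp add: k_def min_absorb2)
  qed
  define l where "l S T = lim (\<lambda>m. rect_integral (g m) S T)" for S T
  have l: "(\<lambda>m. rect_integral (g m) S T) \<longlonglongrightarrow> l S T"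
    if ST: "S \<in> sets unit_leb" "T \<in> sets unit_leb" for S T
    using conv[OF that] by (simp add: convergent_LIMSEQ_iff l_def)
  have g0: "0 \<le> rect_integral (g m) S T" for m S T
    unfolding rect_integral_def using graphon_ge_0[OF g] by (intro Bochner_Integration.integral_nonneg) auto
  have kI: "rect_integral k S T = l S T" if ST: "S \<in> sets unit_leb" "T \<in> sets unit_leb" for S T
  proof -
    have "rect_integral k S T = enn2real (\<integral>\<^sup>+z. ennreal (indicator (S \<times> T) z * k z) \<partial>sqm)"
      unfolding rect_integral_def using ST k01
      by (intro integral_eq_nn_integral borel_measurable_times borel_measurable_indicator rect_sets k) auto
    also have "(\<integral>\<^sup>+z. ennreal (indicator (S \<times> T) z * k z) \<partial>sqm) = (\<integral>\<^sup>+z. f z * indicator (S \<times> T) z \<partial>sqm)"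
      using kf by (intro nn_integral_cong_AE) (auto elim!: eventually_mono simp: indicator_def)
    also have "\<dots> = ennreal (l S T)"
      using fI[OF rect_sets[OF ST]] by (simp add: l_def rect_integral_def)
    also have "enn2real \<dots> = l S T"
      by (rule enn2real_ennreal, rule LIMSEQ_le_const[OF l[OF ST]]) (use g0 in auto)
    finally show ?thesis .
  qed
  have lsym: "l S T = l T S" if ST: "S \<in> sets unit_leb" "T \<in> sets unit_leb" for S T
    unfolding l_def using rect_integral_graphon_swap[OF g ST] by simp
  \<comment> \<open>The limit \<open>l\<close> is symmetric in \<open>S\<close> and
    \<open>T\<close>, but nothing forces \<open>k\<close> to be symmetric pointwise. Averaging with
    the transpose repairs this and leaves the rectangle integrals unchanged.\<close>
  define h where "h = (\<lambda>(x, y)\<in>unit_sq. (k (x, y) + k (y, x)) / 2)"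
  have sw: "(\<lambda>(x, y). k (y, x)) \<in> borel_measurable sqm"
    using measurable_compose[OF measurable_pair_swap' k[unfolded sqm_def]] unfolding sqm_def
    by (simp add: case_prod_beta')
  have h: "h \<in> graphons"
  proof (rule graphonI)
    have "(\<lambda>z. (k z + (case z of (x, y) \<Rightarrow> k (y, x))) / 2) \<in> borel_measurable sqm"
      using sw k by measurable
    then show "h \<in> borel_measurable sqm"
      by (rule measurable_cong[THEN iffD1, rotated]) (auto simp: h_def)
    show "z \<in> unit_sq \<Longrightarrow> 0 \<le> h z \<and> h z \<le> 1" for z
      by (cases z) (use k01[of z] k01[of "prod.swap z"] in \<open>auto simp: h_def\<close>)
  qed (auto simp: h_def)
  have hI: "rect_integral h S T = l S T" if ST: "S \<in> sets unit_leb" "T \<in> sets unit_leb" for S T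
  proof -
    have i: "integrable sqm k" "integrable sqm (\<lambda>(x, y). k (y, x))"
      using k01 k sw by (auto intro!: integrable_sqm[where B=1])
    have "rect_integral h S T = (\<integral>z. (indicator (S \<times> T) z * k z + indicator (S \<times> T) z * (case z of (x, y) \<Rightarrow> k (y, x))) / 2 \<partial>sqm)"
      unfolding rect_integral_def
      by (intro Bochner_Integration.integral_cong) (auto simp: h_def indicator_def)
    also have "\<dots> = (rect_integral k S T + rect_integral (\<lambda>(x, y). k (y, x)) S T) / 2"
      unfolding rect_integral_def using i ST by (simp add: integrable_rect)
    also have "\<dots> = l S T" using rect_integral_swap[OF k ST] kI ST lsym[OF ST] by simp
    finally show ?thesis .
  qed
  show ?thesis
  proof (rule that[OF h])
    fix e :: real assume "e > 0"
    then obtain N where N: "\<forall>m\<ge>N. \<forall>n\<ge>N. cut_dist (g m) (g n) \<le> e" using Cau by blast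
    have "cut_dist (g m) h \<le> e" if m: "m \<ge> N" for m
    proof (rule cut_dist_leI[OF g h])
      fix S T assume ST: "S \<in> sets unit_leb" "T \<in> sets unit_leb"
      have "(\<lambda>n. \<bar>rect_integral (g m) S T - rect_integral (g n) S T\<bar>) \<longlonglongrightarrow> \<bar>rect_integral (g m) S T - l S T\<bar>"
        by (intro tendsto_intros l ST)
      then show "\<bar>rect_integral (g m) S T - rect_integral h S T\<bar> \<le> e"
        unfolding hI[OF ST]
      proof (rule LIMSEQ_le_const2, intro exI allI impI)
        fix n assume "n \<ge> N"
        then have "cut_dist (g m) (g n) \<le> e" using N m by blast
        then show "\<bar>rect_integral (g m) S T - rect_integral (g n) S T\<bar> \<le> e"
          using rect_integral_le_cut_dist[OF g g ST, of m n] by simp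
      qed
    qed
    then show "\<exists>N. \<forall>m\<ge>N. cut_dist (g m) h \<le> e" by blast
  qed
qed

text \<open>A Cauchy sequence of classes is lifted to one of functions: along a subsequence with
  distances below \<open>(1/2)^k\<close>, relabellings are chosen recursively so that each
  representative is close in cut distance to its already aligned predecessor. Convergence of a
  subsequence suffices for a Cauchy sequence.\<close>

lemma mcomplete_graphon_space: "graphon.mcomplete"
  unfolding graphon.mcomplete_def
proof (intro allI impI)
  fix s assume Cau: "graphon.MCauchy s"
  then have s: "s n \<in> graphon_space" for n by (auto simp: graphon.MCauchy_def)
  have "\<exists>r::nat \<Rightarrow> nat. \<forall>k. (\<forall>n\<ge>r k. \<forall>n'\<ge>r k. delta_cut (s n) (s n') < (1/2)^k) \<and> r k < r (Suc k)"
  proof (rule dependent_nat_choice)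
    show "\<exists>x. \<forall>n\<ge>x. \<forall>n'\<ge>x. delta_cut (s n) (s n') < (1/2)^0"
      using Cau unfolding graphon.MCauchy_def by (metis power_0 zero_less_one)
    fix x :: nat and k :: nat
    obtain N where "\<forall>n n'. N \<le> n \<longrightarrow> N \<le> n' \<longrightarrow> delta_cut (s n) (s n') < (1/2)^(Suc k)"
      using Cau unfolding graphon.MCauchy_def by (metis zero_less_power half_gt_zero_iff zero_less_one)
    then show "\<exists>y. (\<forall>n\<ge>y. \<forall>n'\<ge>y. delta_cut (s n) (s n') < (1/2)^(Suc k)) \<and> x < y"
      by (intro exI[of _ "max N (Suc x)"]) auto
  qed
  then obtain r :: "nat \<Rightarrow> nat" where
    r: "\<And>k n n'. n \<ge> r k \<Longrightarrow> n' \<ge> r k \<Longrightarrow> delta_cut (s n) (s n') < (1/2)^k" "\<And>k. r k < r (Suc k)"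
    by blast
  have mono: "strict_mono r" using r(2) by (simp add: strict_mono_Suc_iff)
  define f where "f k = class_rep (s (r k))" for k
  have f: "f k \<in> graphons" "graphon_class (f k) = s (r k)" for k
    using class_rep[OF s] by (auto simp: f_def)
  have fd: "orbit_dist (f k) (f (Suc k)) < (1/2)^k" for k
    using r(1)[of k "r k" "r (Suc k)"] r(2)[of k] s by (simp add: delta_cut_eq f_def)
  have "\<exists>\<tau>. \<forall>k. \<tau> k \<in> mp_bijections \<and>
    cut_dist (relabel (f k) (\<tau> k)) (relabel (f (Suc k)) (\<tau> (Suc k))) < (1/2)^k"
  proof (rule dependent_nat_choice)
    show "\<exists>x. x \<in> mp_bijections" using mp_id by blast
    fix \<tau> and k :: nat assume \<tau>: "\<tau> \<in> mp_bijections"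
    obtain \<sigma> where \<sigma>: "\<sigma> \<in> mp_bijections" "cut_dist (f k) (relabel (f (Suc k)) \<sigma>) < (1/2)^k"
      using orbit_dist_lessD[OF f(1) f(1) fd[of k]] by blast
    have "cut_dist (relabel (f k) \<tau>) (relabel (f (Suc k)) (\<sigma> \<circ> \<tau>)) \<le> cut_dist (f k) (relabel (f (Suc k)) \<sigma>)"
      using cut_dist_relabel_le[OF \<tau> f(1) relabel_graphon[OF \<sigma>(1) f(1)]] \<tau> by (simp add: relabel_relabel)
    then show "\<exists>y. y \<in> mp_bijections \<and> cut_dist (relabel (f k) \<tau>) (relabel (f (Suc k)) y) < (1/2)^k"
      using \<sigma> \<tau> by (intro exI[of _ "\<sigma> \<circ> \<tau>"]) (auto intro: mp_comp)
  qed
  then obtain \<tau> where \<tau>: "\<And>k. \<tau> k \<in> mp_bijections"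
    "\<And>k. cut_dist (relabel (f k) (\<tau> k)) (relabel (f (Suc k)) (\<tau> (Suc k))) < (1/2)^k" by blast
  define g where "g k = relabel (f k) (\<tau> k)" for k
  have g: "g k \<in> graphons" for k using \<tau> f by (auto simp: g_def)
  \<comment> \<open>The subtracted term is what makes the geometric estimate close under induction
    on \<open>j\<close>.\<close>
  have gd: "cut_dist (g k) (g (k + j)) \<le> 2 * (1/2)^k - 2 * (1/2)^(k+j)" for k j
  proof (induction j)
    case (Suc j)
    have "cut_dist (g k) (g (k + Suc j)) \<le> cut_dist (g k) (g (k + j)) + cut_dist (g (k + j)) (g (Suc (k + j)))"
      using cut_dist_triangle[OF g g g] by simp
    then show ?case using Suc \<tau>(2)[of "k + j"] by (simp add: g_def)
  qed (simp add: g)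
  have gd2: "cut_dist (g m) (g n) \<le> 2 * (1/2)^k" if "k \<le> m" "k \<le> n" for k m n
  proof -
    have a: "cut_dist (g m) (g n) \<le> 2 * (1/2)^k" if "k \<le> m" "m \<le> n" for m n
    proof -
      have "cut_dist (g m) (g n) \<le> 2 * (1/2)^m - 2 * (1/2)^n" using gd[of m "n - m"] that by simp
      also have "\<dots> \<le> 2 * (1/2)^m" by simp
      also have "\<dots> \<le> 2 * (1/2)^k" using that by (simp add: power_decreasing)
      finally show ?thesis .
    qed
    show ?thesis using a[of m n] a[of n m] that by (cases "m \<le> n") (auto simp: cut_dist_commute)
  qed
  have "\<exists>N. \<forall>m\<ge>N. \<forall>n\<ge>N. cut_dist (g m) (g n) \<le> e" if e: "e > 0" for e
  proof -
    obtain k where "(1/2)^k < e / 2" using real_arch_pow_inv[of "e/2" "1/2"] e by auto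
    then show ?thesis using gd2[of k] by (intro exI[of _ k]) force
  qed
  then obtain h where h: "h \<in> graphons" and hl: "\<And>e. e > 0 \<Longrightarrow> \<exists>N. \<forall>m\<ge>N. cut_dist (g m) h \<le> e"
    by - (rule cut_dist_complete[OF g], assumption, rule that)
  have d: "delta_cut (s (r k)) (graphon_class h) \<le> cut_dist (g k) h" for k
  proof -
    have "delta_cut (s (r k)) (graphon_class h) = orbit_dist (f k) h"
      using delta_cut_class[OF f(1) h] by (simp add: f)
    also have "\<dots> \<le> orbit_dist (f k) (g k) + orbit_dist (g k) h"
      using f g h by (intro orbit_dist_triangle)
    also have "orbit_dist (f k) (g k) = 0"
      unfolding g_def by (intro orbit_dist_relabel_self f \<tau>)
    finally show ?thesis using orbit_dist_le_cut_dist[OF g h, of k] by simp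
  qed
  have "limitin graphon.mtopology (s \<circ> r) (graphon_class h) sequentially"
    unfolding graphon.limitin_metric eventually_sequentially
  proof (intro conjI allI impI)
    fix e :: real assume "e > 0"
    then obtain N where "\<forall>m\<ge>N. cut_dist (g m) h \<le> e/2" using hl[of "e/2"] by auto
    then have "delta_cut ((s \<circ> r) m) (graphon_class h) < e" if "m \<ge> N" for m
      using d[of m] that \<open>e > 0\<close> by (fastforce simp: o_def)
    then show "\<exists>N. \<forall>n\<ge>N. (s \<circ> r) n \<in> graphon_space \<and> delta_cut ((s \<circ> r) n) (graphon_class h) < e"
      using s by auto
  qed (use h in auto)
  then show "\<exists>x. limitin graphon.mtopology s x sequentially"
    using graphon.MCauchy_convergent_subsequence[OF Cau mono] by blast
qed

section \<open>Step graphons\<close>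

text \<open>Open on the left because \<open>graph_graphon\<close> rounds up. The point 0 has index 0
  and lies in no cell; it is a null set, but it returns wherever equality must hold
  pointwise.\<close>

definition cell :: "nat \<Rightarrow> nat \<Rightarrow> real set" where
  "cell n i = {(real i - 1) / real n <.. real i / real n}"

abbreviation cell_index :: "nat \<Rightarrow> real \<Rightarrow> nat" where
  "cell_index n x \<equiv> nat \<lceil>real n * x\<rceil>"

lemma cell_index_iff:
  assumes "n > 0" "i > 0"
  shows "cell_index n x = i \<longleftrightarrow> x \<in> cell n i"
proof -
  have "cell_index n x = i \<longleftrightarrow> \<lceil>real n * x\<rceil> = int i" using assms by auto
  also have "\<dots> \<longleftrightarrow> real i - 1 < real n * x \<and> real n * x \<le> real i"
    by (simp add: ceiling_eq_iff)
  also have "\<dots> \<longleftrightarrow> x \<in> cell n i" using assms by (auto simp: cell_def field_simps)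
  finally show ?thesis .
qed

lemma cell_index_in:
  assumes "n > 0" "0 < x" "x \<le> 1"
  shows "cell_index n x \<in> {1..n}"
proof -
  have "0 < real n * x" "real n * x \<le> real n" using assms by (auto simp: mult_le_cancel_left1)
  then show ?thesis by (auto simp: le_nat_iff nat_le_iff ceiling_le_iff)
qed

lemma cell_subset: "i \<in> {1..n} \<Longrightarrow> cell n i \<subseteq> {0..1}"
proof
  fix x assume i: "i \<in> {1..n}" and x: "x \<in> cell n i"
  have "0 \<le> (real i - 1) / real n" "real i / real n \<le> 1" using i by (auto simp: field_simps)
  then show "x \<in> {0..1}" using x by (auto simp: cell_def)
qed

lemma cell_sets [intro]: "i \<in> {1..n} \<Longrightarrow> cell n i \<in> sets unit_leb"
  using cell_subset[of i n] by (simp add: sets_unit_leb_iff) (simp add: cell_def)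

lemma measure_cell: "i \<in> {1..n} \<Longrightarrow> measure unit_leb (cell n i) = 1 / real n"
proof -
  assume i: "i \<in> {1..n}"
  have "emeasure unit_leb (cell n i) = emeasure lborel (cell n i)"
    using i by (intro emeasure_unit_leb cell_sets)
  also have "\<dots> = ennreal (1 / real n)"
    using i by (simp add: cell_def field_simps)
  finally show ?thesis by (simp add: measure_def)
qed

lemma measure_cell_rect: "i \<in> {1..n} \<Longrightarrow> j \<in> {1..n} \<Longrightarrow> measure sqm (cell n i \<times> cell n j) = 1 / (real n)\<^sup>2"
  by (simp add: measure_rect cell_sets measure_cell power2_eq_square)

text \<open>The discarded points are those on the two axes, which no product of cells
  covers.\<close>

lemma AE_sqm_pos: "AE z in sqm. fst z > 0 \<and> snd z > 0"
proof (rule AE_I')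
  have s: "{0} \<in> sets unit_leb" "{0..1} \<in> sets unit_leb" by (auto simp: sets_unit_leb_iff)
  have "emeasure unit_leb {0} = 0" using s by (simp add: emeasure_unit_leb)
  then have "measure unit_leb {0} = 0" by (simp add: measure_def)
  then have "measure sqm ({0} \<times> {0..1}) = 0" "measure sqm ({0..1} \<times> {0}) = 0"
    using s by (simp_all add: measure_rect)
  then have "{0} \<times> {0..1} \<in> null_sets sqm" "{0..1} \<times> {0} \<in> null_sets sqm"
    using s by (auto simp: null_sets_def sqm.emeasure_eq_measure)
  then show "{0} \<times> {0..1} \<union> {0..1} \<times> {0} \<in> null_sets sqm" by (rule null_sets.Un)
  show "{z \<in> space sqm. \<not> (fst z > 0 \<and> snd z > 0)} \<subseteq> {0} \<times> {0..1} \<union> {0..1} \<times> {0}"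
    by auto
qed

lemma integral_cells:
  assumes n: "n > 0" and u: "integrable sqm u"
  shows "integral\<^sup>L sqm u = (\<Sum>i\<in>{1..n}. \<Sum>j\<in>{1..n}. rect_integral u (cell n i) (cell n j))"
proof -
  have I: "integrable sqm (\<lambda>z. indicator (cell n i \<times> cell n j) z * u z)" if "i \<in> {1..n}" "j \<in> {1..n}" for i j
    using that by (intro integrable_rect cell_sets u)
  have "(\<Sum>i\<in>{1..n}. \<Sum>j\<in>{1..n}. rect_integral u (cell n i) (cell n j)) =
      (\<integral>z. (\<Sum>i\<in>{1..n}. \<Sum>j\<in>{1..n}. indicator (cell n i \<times> cell n j) z * u z) \<partial>sqm)"
  proof -
    have "(\<integral>z. (\<Sum>i\<in>{1..n}. \<Sum>j\<in>{1..n}. indicator (cell n i \<times> cell n j) z * u z) \<partial>sqm) =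
        (\<Sum>i\<in>{1..n}. \<integral>z. (\<Sum>j\<in>{1..n}. indicator (cell n i \<times> cell n j) z * u z) \<partial>sqm)"
      using I by (intro Bochner_Integration.integral_sum Bochner_Integration.integrable_sum)
    also have "\<dots> = (\<Sum>i\<in>{1..n}. \<Sum>j\<in>{1..n}. \<integral>z. indicator (cell n i \<times> cell n j) z * u z \<partial>sqm)"
      using I by (intro sum.cong refl Bochner_Integration.integral_sum)
    finally show ?thesis unfolding rect_integral_def by simp
  qed
  also have "\<dots> = integral\<^sup>L sqm u"
  proof (rule integral_cong_AE)
    show "(\<lambda>z. \<Sum>i\<in>{1..n}. \<Sum>j\<in>{1..n}. indicator (cell n i \<times> cell n j) z * u z) \<in> borel_measurable sqm"
      using I by (intro borel_measurable_integrable Bochner_Integration.integrable_sum)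
    show "u \<in> borel_measurable sqm" using u by auto
    show "AE z in sqm. (\<Sum>i\<in>{1..n}. \<Sum>j\<in>{1..n}. indicator (cell n i \<times> cell n j) z * u z) = u z"
      using AE_sqm_pos AE_space
    proof eventually_elim
      case (elim z)
      obtain x y where z: "z = (x, y)" by (cases z)
      have xy: "cell_index n x \<in> {1..n}" "cell_index n y \<in> {1..n}"
        using elim n cell_index_in[of n x] cell_index_in[of n y] by (auto simp: z)
      have "(\<Sum>i\<in>{1..n}. \<Sum>j\<in>{1..n}. indicator (cell n i \<times> cell n j) z * u z) =
          (\<Sum>i\<in>{1..n}. \<Sum>j\<in>{1..n}. if j = cell_index n y then if i = cell_index n x then u z else 0 else 0)"
        using n by (intro sum.cong refl) (auto simp: z indicator_def cell_index_iff[symmetric] simp del: cell_index_iff)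
      also have "\<dots> = u z" using xy by simp
      finally show ?case .
    qed
  qed
  finally show ?thesis by simp
qed

text \<open>Weights on unordered pairs make symmetry automatic. The diagonal value is a parameter
  because graphs need 0 there and the exact rate formula needs \<open>p\<close>. On the axes
  \<open>w\<close> is evaluated at sets containing the index 0, hence bounds on \<open>w\<close> are
  asked for all sets.\<close>

definition egraphon :: "nat \<Rightarrow> real \<Rightarrow> (nat set \<Rightarrow> real) \<Rightarrow> real \<times> real \<Rightarrow> real" where
  "egraphon n d w = (\<lambda>(x, y)\<in>unit_sq. if cell_index n x = cell_index n y then d
     else w {cell_index n x, cell_index n y})"

lemma egraphon_graphon [intro]:
  assumes "0 \<le> d" "d \<le> 1" "\<And>e. 0 \<le> w e \<and> w e \<le> 1"
  shows "egraphon n d w \<in> graphons"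
proof (rule graphonI)
  have c: "(\<lambda>z. \<lceil>real n * fst z\<rceil>) \<in> measurable sqm (count_space UNIV)"
    "(\<lambda>z. \<lceil>real n * snd z\<rceil>) \<in> measurable sqm (count_space UNIV)"
    unfolding measurable_cong_sets[OF sets_sqm refl]
    unfolding borel_prod[symmetric] by (intro measurable_restrict_space1; measurable)+
  have "(\<lambda>z. (\<lambda>(k, l). if nat k = nat l then d else w {nat k, nat l}) (\<lceil>real n * fst z\<rceil>, \<lceil>real n * snd z\<rceil>))
     \<in> borel_measurable sqm"
    by (rule measurable_compose[OF measurable_Pair[OF c]]) (simp add: pair_measure_countable)
  then show "egraphon n d w \<in> borel_measurable sqm"
    by (rule measurable_cong[THEN iffD1, rotated]) (auto simp: egraphon_def)
next
  fix z :: "real \<times> real" assume "z \<in> unit_sq"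
  then show "0 \<le> egraphon n d w z \<and> egraphon n d w z \<le> 1"
    using assms by (cases z) (simp add: egraphon_def)
next
  fix x y :: real assume "x \<in> {0..1}" "y \<in> {0..1}"
  then show "egraphon n d w (x, y) = egraphon n d w (y, x)"
    by (simp add: egraphon_def insert_commute[of "cell_index n x"])
qed (auto simp: egraphon_def)

lemma graph_graphon_eq:
  assumes "E \<subseteq> possible_edges n"
  shows "graph_graphon n E = egraphon n 0 (\<lambda>e. if e \<in> E then 1 else 0)"
proof -
  have "{i} \<notin> E" for i using assms by (auto simp: possible_edges_def)
  then show ?thesis unfolding graph_graphon_def egraphon_def by (auto simp: restrict_def fun_eq_iff)
qed

lemma finite_possible_edges [simp]: "finite (possible_edges n)"
  by (rule finite_subset[of _ "Pow {1..n}"]) (auto simp: possible_edges_def)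

lemma pair_possible_edge: "i \<in> {1..n} \<Longrightarrow> j \<in> {1..n} \<Longrightarrow> i \<noteq> j \<Longrightarrow> {i, j} \<in> possible_edges n"
  by (auto simp: possible_edges_def card_insert_if)

definition edge_value :: "real \<Rightarrow> (nat set \<Rightarrow> real) \<Rightarrow> nat \<Rightarrow> nat \<Rightarrow> real" where
  "edge_value d w i j = (if i = j then d else w {i, j})"

lemma egraphon_on_cell:
  assumes "n > 0" "i \<in> {1..n}" "j \<in> {1..n}" "z \<in> cell n i \<times> cell n j"
  shows "egraphon n d w z = edge_value d w i j"
proof -
  obtain x y where z: "z = (x, y)" by (cases z)
  have xy: "x \<in> cell n i" "y \<in> cell n j" using assms z by auto
  then have "cell_index n x = i" "cell_index n y = j" using assms cell_index_iff[of n] by auto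
  moreover have "z \<in> unit_sq" using xy cell_subset[OF assms(2)] cell_subset[OF assms(3)] z by auto
  ultimately show ?thesis using z by (simp add: egraphon_def edge_value_def)
qed

section \<open>Integrals of step graphons and sums over edges\<close>

lemma rect_integral_egraphon_cell:
  assumes n: "n > 0" "i \<in> {1..n}" "j \<in> {1..n}"
  shows "rect_integral (\<lambda>z. f (egraphon n d w z)) (cell n i) (cell n j) = f (edge_value d w i j) / (real n)\<^sup>2"
proof -
  have "rect_integral (\<lambda>z. f (egraphon n d w z)) (cell n i) (cell n j) =
      (\<integral>z. indicator (cell n i \<times> cell n j) z * f (edge_value d w i j) \<partial>sqm)"
    unfolding rect_integral_def
    by (intro Bochner_Integration.integral_cong refl)
       (use egraphon_on_cell[OF n] in \<open>auto simp: indicator_def\<close>)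
  also have "\<dots> = f (edge_value d w i j) / (real n)\<^sup>2"
    using measure_cell_rect[OF n(2,3)] sets.Int_space_eq2[OF rect_sets[OF cell_sets[OF n(2)] cell_sets[OF n(3)]]]
    by simp
  finally show ?thesis .
qed

lemma rect_integral_egraphon:
  assumes n: "n > 0" and d: "0 \<le> d" "d \<le> 1" and w: "\<And>e. 0 \<le> w e \<and> w e \<le> 1"
    and S: "S \<in> sets unit_leb" and T: "T \<in> sets unit_leb"
  shows "rect_integral (egraphon n d w) S T =
    (\<Sum>i\<in>{1..n}. \<Sum>j\<in>{1..n}. measure unit_leb (S \<inter> cell n i) * measure unit_leb (T \<inter> cell n j) * edge_value d w i j)"
proof -
  have "rect_integral (egraphon n d w) S T =
     (\<Sum>i\<in>{1..n}. \<Sum>j\<in>{1..n}. rect_integral (\<lambda>z. indicator (S \<times> T) z * egraphon n d w z) (cell n i) (cell n j))"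
    unfolding rect_integral_def[of _ S T]
    by (intro integral_cells n integrable_rect S T graphon_integrable egraphon_graphon d w)
  also have "\<dots> = (\<Sum>i\<in>{1..n}. \<Sum>j\<in>{1..n}. measure unit_leb (S \<inter> cell n i) * measure unit_leb (T \<inter> cell n j) * edge_value d w i j)"
  proof (intro sum.cong refl)
    fix i j assume ij: "i \<in> {1..n}" "j \<in> {1..n}"
    have ST: "S \<inter> cell n i \<in> sets unit_leb" "T \<inter> cell n j \<in> sets unit_leb" using S T ij cell_sets by blast+
    have "rect_integral (\<lambda>z. indicator (S \<times> T) z * egraphon n d w z) (cell n i) (cell n j) =
      (\<integral>z. indicator ((S \<inter> cell n i) \<times> (T \<inter> cell n j)) z * edge_value d w i j \<partial>sqm)"
      unfolding rect_integral_def
      by (intro Bochner_Integration.integral_cong refl)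
         (use egraphon_on_cell[OF n ij] in \<open>auto simp: indicator_def\<close>)
    also have "\<dots> = measure unit_leb (S \<inter> cell n i) * measure unit_leb (T \<inter> cell n j) * edge_value d w i j"
      using sets.Int_space_eq2[OF rect_sets[OF ST]] measure_rect[OF ST] by simp
    finally show "rect_integral (\<lambda>z. indicator (S \<times> T) z * egraphon n d w z) (cell n i) (cell n j) = \<dots>" .
  qed
  finally show ?thesis .
qed

text \<open>The coefficient of an edge when a double sum over \<open>S\<close> and \<open>T\<close>
  is regrouped by edges. The regrouping matters because independence and block averages live on
  edges, not on ordered pairs.\<close>

definition incidence :: "nat set \<Rightarrow> nat set \<Rightarrow> nat set \<Rightarrow> real" where
  "incidence S T e = real (card {(i, j) \<in> S \<times> T. i \<noteq> j \<and> {i, j} = e})"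

lemma incidence_le_2:
  assumes "e \<in> possible_edges n"
  shows "0 \<le> incidence S T e" "incidence S T e \<le> 2"
proof -
  obtain a b where e: "e = {a, b}" using assms by (auto simp: possible_edges_def card_2_iff)
  have "card {(i, j) \<in> S \<times> T. i \<noteq> j \<and> {i, j} = e} \<le> card {(a, b), (b, a)}"
    by (intro card_mono) (auto simp: e doubleton_eq_iff)
  also have "\<dots> \<le> 2" using card_length[of "[(a, b), (b, a)]"] by simp
  finally show "incidence S T e \<le> 2" by (simp add: incidence_def)
qed (simp add: incidence_def)

lemma incidence_full:
  assumes "e \<in> possible_edges n"
  shows "incidence {1..n} {1..n} e = 2"
proof -
  obtain a b where e: "e = {a, b}" "a \<noteq> b" "a \<in> {1..n}" "b \<in> {1..n}"
    using assms by (auto simp: possible_edges_def card_2_iff)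
  have "{(i, j) \<in> {1..n} \<times> {1..n}. i \<noteq> j \<and> {i, j} = e} = {(a, b), (b, a)}"
    using e by (auto simp: doubleton_eq_iff)
  then show ?thesis using e by (simp add: incidence_def)
qed

lemma sum_offdiag_edges:
  fixes f :: "nat set \<Rightarrow> real"
  assumes S: "S \<subseteq> {1..n}" and T: "T \<subseteq> {1..n}"
  shows "(\<Sum>i\<in>S. \<Sum>j\<in>T. if i = j then 0 else f {i, j}) = (\<Sum>e\<in>possible_edges n. incidence S T e * f e)"
proof -
  have fin: "finite S" "finite T" using S T finite_subset by auto
  let ?P = "{(i, j) \<in> S \<times> T. i \<noteq> j}"
  have "(\<Sum>i\<in>S. \<Sum>j\<in>T. if i = j then 0 else f {i, j}) = (\<Sum>x\<in>S \<times> T. if fst x = snd x then 0 else f {fst x, snd x})"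
    using fin by (subst sum.cartesian_product) (auto intro!: sum.cong simp: split_beta)
  also have "\<dots> = (\<Sum>x\<in>?P. f {fst x, snd x})"
    using fin by (intro sum.mono_neutral_cong_right) auto
  also have "\<dots> = (\<Sum>e\<in>possible_edges n. \<Sum>x\<in>{x \<in> ?P. {fst x, snd x} = e}. f {fst x, snd x})"
  proof (rule sum.group[symmetric])
    have "?P \<subseteq> S \<times> T" by auto
    then show "finite ?P" using fin finite_subset by blast
    show "(\<lambda>x. {fst x, snd x}) ` ?P \<subseteq> possible_edges n"
    proof
      fix e assume "e \<in> (\<lambda>x. {fst x, snd x}) ` ?P"
      then obtain i j where "i \<in> S" "j \<in> T" "i \<noteq> j" "e = {i, j}" by auto
      then show "e \<in> possible_edges n" using S T pair_possible_edge[of i n j] by blast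
    qed
  qed simp
  also have "\<dots> = (\<Sum>e\<in>possible_edges n. incidence S T e * f e)"
  proof (intro sum.cong refl)
    fix e
    have eq: "{x \<in> ?P. {fst x, snd x} = e} = {(i, j) \<in> S \<times> T. i \<noteq> j \<and> {i, j} = e}" by auto
    show "(\<Sum>x\<in>{x \<in> ?P. {fst x, snd x} = e}. f {fst x, snd x}) = incidence S T e * f e"
      unfolding incidence_def eq[symmetric] by (simp add: sum.cong)
  qed
  finally show ?thesis .
qed

lemma card_possible_edges_le: "2 * real (card (possible_edges n)) \<le> (real n)\<^sup>2"
proof -
  have "2 * real (card (possible_edges n)) = (\<Sum>e\<in>possible_edges n. incidence {1..n} {1..n} e * 1)"
    using incidence_full by simp
  also have "\<dots> = (\<Sum>i\<in>{1..n}. \<Sum>j\<in>{1..n}. if i = j then 0 else 1)"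
    by (rule sum_offdiag_edges[symmetric]) auto
  also have "\<dots> \<le> (\<Sum>i\<in>{1..n}. \<Sum>j\<in>{1..n}. 1)" by (intro sum_mono) auto
  finally show ?thesis by (simp add: power2_eq_square)
qed

lemma graphon_rate_egraphon:
  assumes p: "0 < p" "p < 1" and n: "n > 0" and w: "\<And>e. 0 \<le> w e \<and> w e \<le> 1"
  shows "graphon_rate p (egraphon n p w) * (real n)\<^sup>2 = 2 * (\<Sum>e\<in>possible_edges n. rate p (w e))"
proof -
  have G: "egraphon n p w \<in> graphons" using p w by (intro egraphon_graphon) auto
  have "graphon_rate p (egraphon n p w) =
     (\<Sum>i\<in>{1..n}. \<Sum>j\<in>{1..n}. rect_integral (\<lambda>z. rate p (egraphon n p w z)) (cell n i) (cell n j))"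
    unfolding graphon_rate_eq[OF p G] by (intro integral_cells n rate_graphon_integrable p G)
  also have "\<dots> = (\<Sum>i\<in>{1..n}. \<Sum>j\<in>{1..n}. rate p (edge_value p w i j) / (real n)\<^sup>2)"
    using n by (intro sum.cong refl rect_integral_egraphon_cell)
  also have "\<dots> = (\<Sum>i\<in>{1..n}. \<Sum>j\<in>{1..n}. if i = j then 0 else rate p (w {i, j})) / (real n)\<^sup>2"
    unfolding sum_divide_distrib using p by (intro sum.cong refl) (auto simp: edge_value_def)
  also have "\<dots> = (\<Sum>e\<in>possible_edges n. 2 * rate p (w e)) / (real n)\<^sup>2"
    using incidence_full[of _ n] by (subst sum_offdiag_edges[of _ n _ "\<lambda>e. rate p (w e)"]) auto
  finally show ?thesis using n by (simp add: sum_distrib_left)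
qed

text \<open>A bilinear form on a box is largest at a vertex. For fixed \<open>t\<close>, keeping
  exactly the rows with positive sum and giving them weight \<open>c\<close> can only increase the
  value; then the same is done for the columns.\<close>

lemma bilinear_le_extreme:
  fixes D :: "'a \<Rightarrow> 'b \<Rightarrow> real"
  assumes fin: "finite I" "finite J" and s: "\<And>i. i \<in> I \<Longrightarrow> 0 \<le> s i \<and> s i \<le> c" and t: "\<And>j. j \<in> J \<Longrightarrow> 0 \<le> t j \<and> t j \<le> c"
    and c: "c \<ge> 0" and B: "\<And>S T. S \<subseteq> I \<Longrightarrow> T \<subseteq> J \<Longrightarrow> (\<Sum>i\<in>S. \<Sum>j\<in>T. D i j) \<le> B"
  shows "(\<Sum>i\<in>I. \<Sum>j\<in>J. s i * t j * D i j) \<le> c\<^sup>2 * B"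
proof -
  have ext: "(\<Sum>i\<in>K. s i * r i) \<le> c * (\<Sum>i\<in>{i \<in> K. 0 < r i}. r i)"
    if "finite K" "\<And>i. i \<in> K \<Longrightarrow> 0 \<le> s i \<and> s i \<le> c" for K :: "'c set" and s r :: "'c \<Rightarrow> real"
  proof -
    have "(\<Sum>i\<in>K. s i * r i) \<le> (\<Sum>i\<in>K. if 0 < r i then c * r i else 0)"
      using that by (intro sum_mono) (auto intro: mult_right_mono mult_nonneg_nonpos)
    also have "\<dots> = c * (\<Sum>i\<in>{i \<in> K. 0 < r i}. r i)"
      using that unfolding sum_distrib_left by (intro sum.mono_neutral_cong_right) auto
    finally show ?thesis .
  qed
  define r where "r i = (\<Sum>j\<in>J. t j * D i j)" for i
  define S where "S = {i \<in> I. 0 < r i}"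
  define q where "q j = (\<Sum>i\<in>S. D i j)" for j
  define T where "T = {j \<in> J. 0 < q j}"
  have "(\<Sum>i\<in>I. \<Sum>j\<in>J. s i * t j * D i j) = (\<Sum>i\<in>I. s i * r i)"
    by (simp add: r_def sum_distrib_left mult.assoc)
  also have "\<dots> \<le> c * (\<Sum>i\<in>S. r i)" unfolding S_def using fin s by (intro ext) auto
  also have "(\<Sum>i\<in>S. r i) = (\<Sum>j\<in>J. t j * q j)"
    unfolding r_def q_def sum_distrib_left by (rule sum.swap)
  also have "\<dots> \<le> c * (\<Sum>j\<in>T. q j)" unfolding T_def using fin t by (intro ext) auto
  also have "(\<Sum>j\<in>T. q j) = (\<Sum>i\<in>S. \<Sum>j\<in>T. D i j)" unfolding q_def by (rule sum.swap)
  also have "\<dots> \<le> B" by (rule B) (auto simp: S_def T_def)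
  finally show ?thesis using c by (simp add: power2_eq_square mult_left_mono mult.assoc)
qed

text \<open>The masses of \<open>S\<close> and \<open>T\<close> in the cells enter bilinearly and
  range over \<open>[0, 1/n]\<close>, so testing sets of vertices is enough. The \<open>n\<close>
  diagonal cells, each of measure \<open>1/n^2\<close>, account for the extra
  \<open>1 / n\<close>.\<close>

lemma cut_dist_egraphon_le:
  assumes n: "n > 0" and d: "0 \<le> d" "d \<le> 1" "0 \<le> d'" "d' \<le> 1"
    and w: "\<And>e. 0 \<le> w e \<and> w e \<le> 1" and w': "\<And>e. 0 \<le> w' e \<and> w' e \<le> 1"
    and B: "\<And>S T. S \<subseteq> {1..n} \<Longrightarrow> T \<subseteq> {1..n} \<Longrightarrow>
      \<bar>\<Sum>e\<in>possible_edges n. incidence S T e * (w e - w' e)\<bar> \<le> B * (real n)\<^sup>2"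
  shows "cut_dist (egraphon n d w) (egraphon n d' w') \<le> B + 1 / real n"
proof (rule cut_dist_leI)
  fix S T assume S: "S \<in> sets unit_leb" and T: "T \<in> sets unit_leb"
  define s where "s i = measure unit_leb (S \<inter> cell n i)" for i
  define t where "t i = measure unit_leb (T \<inter> cell n i)" for i
  have s: "0 \<le> s i \<and> s i \<le> 1 / real n" and t: "0 \<le> t i \<and> t i \<le> 1 / real n" if "i \<in> {1..n}" for i
    using measure_cell[OF that] cell_sets[OF that] unit_leb.finite_measure_mono[of "S \<inter> cell n i" "cell n i"]
      unit_leb.finite_measure_mono[of "T \<inter> cell n i" "cell n i"] by (auto simp: s_def t_def)
  define D where "D i j = (if i = j then 0 else w {i, j} - w' {i, j})" for i j
  have main: "\<bar>\<Sum>i\<in>{1..n}. \<Sum>j\<in>{1..n}. s i * t j * D i j\<bar> \<le> B"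
  proof -
    have DB: "\<bar>\<Sum>i\<in>S. \<Sum>j\<in>T. D i j\<bar> \<le> B * (real n)\<^sup>2" if "S \<subseteq> {1..n}" "T \<subseteq> {1..n}" for S T
      unfolding D_def using B[OF that] sum_offdiag_edges[OF that, of "\<lambda>e. w e - w' e"] by simp
    have "(\<Sum>i\<in>{1..n}. \<Sum>j\<in>{1..n}. s i * t j * D i j) \<le> (1 / real n)\<^sup>2 * (B * (real n)\<^sup>2)"
    proof (rule bilinear_le_extreme)
      fix S T assume "S \<subseteq> {1..n}" "T \<subseteq> {1..n}"
      from DB[OF this] show "(\<Sum>i\<in>S. \<Sum>j\<in>T. D i j) \<le> B * (real n)\<^sup>2" by linarith
    qed (use s t in simp_all)
    moreover have "(\<Sum>i\<in>{1..n}. \<Sum>j\<in>{1..n}. s i * t j * (- D i j)) \<le> (1 / real n)\<^sup>2 * (B * (real n)\<^sup>2)"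
    proof (rule bilinear_le_extreme)
      fix S T assume "S \<subseteq> {1..n}" "T \<subseteq> {1..n}"
      from DB[OF this] show "(\<Sum>i\<in>S. \<Sum>j\<in>T. - D i j) \<le> B * (real n)\<^sup>2" by (simp add: sum_negf)
    qed (use s t in simp_all)
    ultimately show ?thesis using n by (simp add: sum_negf power_divide abs_le_iff)
  qed
  have "rect_integral (egraphon n d w) S T - rect_integral (egraphon n d' w') S T =
      (\<Sum>i\<in>{1..n}. \<Sum>j\<in>{1..n}. s i * t j * (edge_value d w i j - edge_value d' w' i j))"
    using rect_integral_egraphon[OF n d(1,2) w S T] rect_integral_egraphon[OF n d(3,4) w' S T]
    by (simp add: s_def t_def sum_subtractf right_diff_distrib)
  also have "\<dots> = (\<Sum>i\<in>{1..n}. \<Sum>j\<in>{1..n}. s i * t j * D i j + (if i = j then s i * t j * (d - d') else 0))"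
    by (intro sum.cong refl) (auto simp: edge_value_def D_def)
  also have "\<dots> = (\<Sum>i\<in>{1..n}. \<Sum>j\<in>{1..n}. s i * t j * D i j) + (\<Sum>i\<in>{1..n}. s i * t i * (d - d'))"
    by (simp add: sum.distrib)
  finally have eq: "rect_integral (egraphon n d w) S T - rect_integral (egraphon n d' w') S T = \<dots>" .
  have "\<bar>\<Sum>i\<in>{1..n}. s i * t i * (d - d')\<bar> \<le> (\<Sum>i\<in>{1..n}. \<bar>s i * t i * (d - d')\<bar>)" by (rule sum_abs)
  also have "\<dots> \<le> (\<Sum>i\<in>{1..n}. 1 / real n * (1 / real n) * 1)"
    unfolding abs_mult using s t d by (intro sum_mono mult_mono) auto
  also have "\<dots> = 1 / real n" using n by simp
  finally show "\<bar>rect_integral (egraphon n d w) S T - rect_integral (egraphon n d' w') S T\<bar> \<le> B + 1 / real n"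
    unfolding eq using main by linarith
qed (intro egraphon_graphon d w w')+

section \<open>Averaging over a grid\<close>

text \<open>A Lebesgue measurable function is an almost everywhere limit of continuous ones.
  Clipping them to the unit interval makes dominated convergence applicable.\<close>

lemma graphon_approx_continuous:
  assumes h: "h \<in> graphons" and e: "e > 0"
  obtains \<phi> :: "real \<times> real \<Rightarrow> real" where "continuous_on UNIV \<phi>" "\<And>z. 0 \<le> \<phi> z \<and> \<phi> z \<le> 1"
    "(\<integral>z. \<bar>h z - \<phi> z\<bar> \<partial>sqm) < e"
proof -
  \<comment> \<open>Off the square \<open>h\<close> is \<open>undefined\<close>, so it is first
    extended by 0 to the plane.\<close>
  define f where "f z = (if z \<in> unit_sq then h z else 0)" for z
  have "h \<in> borel_measurable (restrict_space borel unit_sq)" using h by (simp add: graphons_def)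
  then have "(\<lambda>z. indicator unit_sq z *\<^sub>R h z) \<in> borel_measurable borel"
    by (subst (asm) borel_measurable_restrict_space_iff) auto
  also have "(\<lambda>z. indicator unit_sq z *\<^sub>R h z) = f" by (auto simp: f_def fun_eq_iff indicator_def)
  finally have "f \<in> borel_measurable lebesgue" by (simp add: measurable_completion)
  then have "f measurable_on UNIV" by (rule lebesgue_measurable_imp_measurable_on) auto
  then obtain N g where N: "negligible N" and g: "\<And>n. continuous_on UNIV (g n)"
    "\<And>x. x \<notin> N \<Longrightarrow> (\<lambda>n. g n x) \<longlonglongrightarrow> f x"
    unfolding measurable_on_def by auto
  define g' where "g' n z = max 0 (min 1 (g n z))" for n z
  have g'c: "continuous_on UNIV (g' n)" for n
    unfolding g'_def[abs_def] by (intro continuous_intros g)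
  have g'm: "g' n \<in> borel_measurable sqm" for n
    unfolding sqm_eq using borel_measurable_continuous_onI[OF g'c]
    by (intro measurable_restrict_space1) simp
  have "AE z in lebesgue. z \<notin> N" using N unfolding negligible_iff_null_sets by (rule AE_not_in)
  then have "AE z in lborel. z \<notin> N" by (simp add: AE_completion_iff)
  then have "AE z in sqm. z \<notin> N"
    unfolding sqm_eq by (subst AE_restrict_space_iff) auto
  then have lim: "AE z in sqm. (\<lambda>n. \<bar>h z - g' n z\<bar>) \<longlonglongrightarrow> 0"
    using AE_space
  proof eventually_elim
    case (elim z)
    then have "(\<lambda>n. g n z) \<longlonglongrightarrow> h z" using g(2)[of z] by (simp add: f_def)
    then have "(\<lambda>n. \<bar>h z - g' n z\<bar>) \<longlonglongrightarrow> \<bar>h z - max 0 (min 1 (h z))\<bar>"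
      unfolding g'_def by (intro tendsto_intros)
    moreover have "0 \<le> h z" "h z \<le> 1" using elim graphon_ge_0[OF h] graphon_le_1[OF h] by auto
    ultimately show ?case by (simp add: max_def min_def)
  qed
  have "(\<lambda>n. \<integral>z. \<bar>h z - g' n z\<bar> \<partial>sqm) \<longlonglongrightarrow> (\<integral>z. 0 \<partial>sqm)"
  proof (rule integral_dominated_convergence[where w = "\<lambda>_. 1"])
    show "(\<lambda>z. \<bar>h z - g' n z\<bar>) \<in> borel_measurable sqm" for n
      using graphon_measurable[OF h] g'm by (intro borel_measurable_abs borel_measurable_diff)
    show "AE z in sqm. norm \<bar>h z - g' n z\<bar> \<le> 1" for n
    proof (rule AE_I2)
      fix z assume "z \<in> space sqm"
      then have "0 \<le> h z" "h z \<le> 1" using graphon_ge_0[OF h] graphon_le_1[OF h] by auto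
      moreover have "0 \<le> g' n z" "g' n z \<le> 1" by (auto simp: g'_def)
      ultimately show "norm \<bar>h z - g' n z\<bar> \<le> 1" by (simp add: abs_le_iff)
    qed
  qed (use lim in auto)
  then have "eventually (\<lambda>n. (\<integral>z. \<bar>h z - g' n z\<bar> \<partial>sqm) < e) sequentially"
    using e by (intro order_tendstoD(2)) auto
  then obtain n where "(\<integral>z. \<bar>h z - g' n z\<bar> \<partial>sqm) < e" by (auto simp: eventually_sequentially)
  then show ?thesis using g'c by (intro that[of "g' n"]) (auto simp: g'_def)
qed

text \<open>\<open>Min\<close> and \<open>Max\<close> merely order the two ends of the edge; by
  symmetry of \<open>h\<close> the choice does not matter. The value 0 elsewhere keeps the weights
  in the unit interval for all sets.\<close>

definition avg_weight :: "nat \<Rightarrow> (real \<times> real \<Rightarrow> real) \<Rightarrow> nat set \<Rightarrow> real" where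
  "avg_weight n h e = (if e \<in> possible_edges n
     then (real n)\<^sup>2 * rect_integral h (cell n (Min e)) (cell n (Max e)) else 0)"

lemma avg_weight_pair:
  assumes h: "h \<in> graphons" and ij: "i \<in> {1..n}" "j \<in> {1..n}" "i \<noteq> j"
  shows "avg_weight n h {i, j} = (real n)\<^sup>2 * rect_integral h (cell n i) (cell n j)"
proof (cases "i < j")
  case True
  then show ?thesis using pair_possible_edge[OF ij] by (simp add: avg_weight_def)
next
  case False
  then have "min i j = j" "max i j = i" using ij by auto
  then have "avg_weight n h {i, j} = (real n)\<^sup>2 * rect_integral h (cell n j) (cell n i)"
    using pair_possible_edge[OF ij] by (simp add: avg_weight_def)
  also have "rect_integral h (cell n j) (cell n i) = rect_integral h (cell n i) (cell n j)"
    using ij by (intro rect_integral_graphon_swap h cell_sets)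
  finally show ?thesis .
qed

lemma possible_edgeE:
  assumes "e \<in> possible_edges n"
  obtains i j where "i \<in> {1..n}" "j \<in> {1..n}" "i \<noteq> j" "e = {i, j}"
  using assms that by (auto simp: possible_edges_def card_2_iff)

lemma rect_integral_cell_bounds:
  assumes h: "h \<in> graphons" and ij: "i \<in> {1..n}" "j \<in> {1..n}"
  shows "0 \<le> rect_integral h (cell n i) (cell n j)" "(real n)\<^sup>2 * rect_integral h (cell n i) (cell n j) \<le> 1"
proof -
  note b = set_integral_sqm_bounds[OF h rect_sets[OF cell_sets[OF ij(1)] cell_sets[OF ij(2)]], folded rect_integral_def]
  then show "0 \<le> rect_integral h (cell n i) (cell n j)" by simp
  have "rect_integral h (cell n i) (cell n j) \<le> 1 / (real n)\<^sup>2"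
    using b(2) measure_cell_rect[OF ij] by simp
  moreover have "n > 0" using ij by auto
  ultimately show "(real n)\<^sup>2 * rect_integral h (cell n i) (cell n j) \<le> 1" by (simp add: field_simps)
qed

lemma avg_weight_01: "h \<in> graphons \<Longrightarrow> 0 \<le> avg_weight n h e \<and> avg_weight n h e \<le> 1"
  by (cases "e \<in> possible_edges n")
     (auto elim!: possible_edgeE simp: avg_weight_pair rect_integral_cell_bounds simp del: atLeastAtMost_iff,
      simp_all add: avg_weight_def)

lemma egraphon_avg [intro]:
  "0 < p \<Longrightarrow> p < 1 \<Longrightarrow> h \<in> graphons \<Longrightarrow> egraphon n p (avg_weight n h) \<in> graphons"
  by (intro egraphon_graphon avg_weight_01) auto

text \<open>Jensen's inequality on the cells off the diagonal. On the diagonal the average is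
  replaced by \<open>p\<close>, where the rate is 0, which can only lower the sum.\<close>

lemma graphon_rate_avg_le:
  assumes p: "0 < p" "p < 1" and n: "n > 0" and h: "h \<in> graphons"
  shows "graphon_rate p (egraphon n p (avg_weight n h)) \<le> graphon_rate p h"
proof -
  have G: "egraphon n p (avg_weight n h) \<in> graphons" using p h by auto
  have "graphon_rate p (egraphon n p (avg_weight n h)) =
     (\<Sum>i\<in>{1..n}. \<Sum>j\<in>{1..n}. rect_integral (\<lambda>z. rate p (egraphon n p (avg_weight n h) z)) (cell n i) (cell n j))"
    unfolding graphon_rate_eq[OF p G] by (intro integral_cells n rate_graphon_integrable p G)
  also have "\<dots> = (\<Sum>i\<in>{1..n}. \<Sum>j\<in>{1..n}. rate p (edge_value p (avg_weight n h) i j) / (real n)\<^sup>2)"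
    using n by (intro sum.cong refl rect_integral_egraphon_cell)
  also have "\<dots> \<le> (\<Sum>i\<in>{1..n}. \<Sum>j\<in>{1..n}. rect_integral (\<lambda>z. rate p (h z)) (cell n i) (cell n j))"
  proof (intro sum_mono)
    fix i j assume ij: "i \<in> {1..n}" "j \<in> {1..n}"
    show "rate p (edge_value p (avg_weight n h) i j) / (real n)\<^sup>2 \<le> rect_integral (\<lambda>z. rate p (h z)) (cell n i) (cell n j)"
    proof (cases "i = j")
      case True
      have "0 \<le> rect_integral (\<lambda>z. rate p (h z)) (cell n i) (cell n j)"
        unfolding rect_integral_def using graphon_ge_0[OF h] graphon_le_1[OF h] p
        by (intro Bochner_Integration.integral_nonneg) (auto intro!: mult_nonneg_nonneg rate_nonneg)
      then show ?thesis using True p by (simp add: edge_value_def)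
    next
      case False
      have "measure sqm (cell n i \<times> cell n j) > 0" using measure_cell_rect[OF ij] n by simp
      from rate_jensen[OF p h cell_sets[OF ij(1)] cell_sets[OF ij(2)] this]
      show ?thesis using False n measure_cell_rect[OF ij]
        by (simp add: edge_value_def avg_weight_pair[OF h ij False] mult.commute)
    qed
  qed
  also have "\<dots> = graphon_rate p h"
    unfolding graphon_rate_eq[OF p h] by (intro integral_cells[symmetric] n rate_graphon_integrable p h)
  finally show ?thesis .
qed

text \<open>In the L1 sense the mean over a cell is at most twice as far from \<open>h\<close> as
  any constant \<open>c\<close>, because the distance of the mean from \<open>c\<close> is bounded
  by the same integral.\<close>

lemma l1_dist_avg_cell:
  assumes h: "h \<in> graphons" and i: "i \<in> {1..n}" and j: "j \<in> {1..n}" and a: "a = (real n)\<^sup>2 * rect_integral h (cell n i) (cell n j)"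
    and \<phi>: "\<phi> \<in> borel_measurable sqm" "\<And>z. 0 \<le> \<phi> z \<and> \<phi> z \<le> 1" and c: "0 \<le> c" "c \<le> 1"
    and osc: "\<And>z. z \<in> cell n i \<times> cell n j \<Longrightarrow> \<bar>\<phi> z - c\<bar> \<le> \<eta>"
  shows "rect_integral (\<lambda>z. \<bar>h z - a\<bar>) (cell n i) (cell n j) \<le>
     2 * (rect_integral (\<lambda>z. \<bar>h z - \<phi> z\<bar>) (cell n i) (cell n j) + \<eta> / (real n)\<^sup>2)"
proof -
  let ?C = "cell n i \<times> cell n j"
  define m where "m = 1 / (real n)\<^sup>2"
  have n: "n > 0" using i by auto
  note C = rect_sets[OF cell_sets[OF i] cell_sets[OF j]]
  have im: "(\<integral>z. indicator ?C z \<partial>sqm) = m"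
    using measure_cell_rect[OF i j] sets.Int_space_eq2[OF C] by (simp add: m_def)
  have iI: "integrable sqm (indicator ?C :: _ \<Rightarrow> real)" using C by (simp add: sqm.emeasure_finite less_top[symmetric])
  have J: "integrable sqm (\<lambda>z. indicator ?C z * u z)" if "integrable sqm u" for u :: "_ \<Rightarrow> real"
    using that by (intro integrable_rect cell_sets i j)
  have \<phi>I: "integrable sqm \<phi>" using \<phi> by (intro integrable_sqm[where B=1]) auto
  note hI = graphon_integrable[OF h]
  have I1: "integrable sqm (\<lambda>z. \<bar>h z - b\<bar>)" for b
    using hI by (intro integrable_abs Bochner_Integration.integrable_diff sqm.integrable_const)
  have I2: "integrable sqm (\<lambda>z. \<bar>h z - \<phi> z\<bar>)"
    using hI \<phi>I by (intro integrable_abs Bochner_Integration.integrable_diff)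
  have 1: "rect_integral (\<lambda>z. \<bar>h z - c\<bar>) (cell n i) (cell n j) \<le> rect_integral (\<lambda>z. \<bar>h z - \<phi> z\<bar>) (cell n i) (cell n j) + \<eta> * m"
  proof -
    have "rect_integral (\<lambda>z. \<bar>h z - c\<bar>) (cell n i) (cell n j) \<le> (\<integral>z. indicator ?C z * \<bar>h z - \<phi> z\<bar> + indicator ?C z * \<eta> \<partial>sqm)"
      unfolding rect_integral_def
    proof (rule integral_mono)
      fix z assume "z \<in> space sqm"
      show "indicator ?C z * \<bar>h z - c\<bar> \<le> indicator ?C z * \<bar>h z - \<phi> z\<bar> + indicator ?C z * \<eta>"
        using osc[of z] by (auto simp: indicator_def)
    qed (use J[OF I1] J[OF I2] iI in auto)
    also have "\<dots> = rect_integral (\<lambda>z. \<bar>h z - \<phi> z\<bar>) (cell n i) (cell n j) + \<eta> * m"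
      unfolding rect_integral_def using J[OF I2] iI im by simp
    finally show ?thesis .
  qed
  have ram: "rect_integral h (cell n i) (cell n j) = a * m" using n a by (simp add: m_def)
  have 2: "\<bar>a - c\<bar> * m \<le> rect_integral (\<lambda>z. \<bar>h z - c\<bar>) (cell n i) (cell n j)"
  proof -
    have "(a - c) * m = (\<integral>z. indicator ?C z * h z \<partial>sqm) - (\<integral>z. indicator ?C z * c \<partial>sqm)"
      using ram[unfolded rect_integral_def] im by (simp add: algebra_simps)
    also have "\<dots> = (\<integral>z. indicator ?C z * (h z - c) \<partial>sqm)"
      using J[OF hI] iI by (simp add: right_diff_distrib)
    finally have "\<bar>a - c\<bar> * m = \<bar>\<integral>z. indicator ?C z * (h z - c) \<partial>sqm\<bar>"
      using n by (metis abs_mult abs_of_nonneg m_def zero_le_divide_1_iff zero_le_power2)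
    also have "\<dots> \<le> (\<integral>z. \<bar>indicator ?C z * (h z - c)\<bar> \<partial>sqm)" by (rule integral_abs_bound)
    also have "\<dots> = rect_integral (\<lambda>z. \<bar>h z - c\<bar>) (cell n i) (cell n j)"
      unfolding rect_integral_def by (simp add: abs_mult)
    finally show ?thesis .
  qed
  have 3: "rect_integral (\<lambda>z. \<bar>h z - a\<bar>) (cell n i) (cell n j) \<le> rect_integral (\<lambda>z. \<bar>h z - c\<bar>) (cell n i) (cell n j) + \<bar>a - c\<bar> * m"
  proof -
    have "rect_integral (\<lambda>z. \<bar>h z - a\<bar>) (cell n i) (cell n j) \<le> (\<integral>z. indicator ?C z * \<bar>h z - c\<bar> + indicator ?C z * \<bar>a - c\<bar> \<partial>sqm)"
      unfolding rect_integral_def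
    proof (rule integral_mono)
      fix z assume "z \<in> space sqm"
      show "indicator ?C z * \<bar>h z - a\<bar> \<le> indicator ?C z * \<bar>h z - c\<bar> + indicator ?C z * \<bar>a - c\<bar>"
        by (auto simp: indicator_def)
    qed (use J[OF I1] iI in auto)
    also have "\<dots> = rect_integral (\<lambda>z. \<bar>h z - c\<bar>) (cell n i) (cell n j) + \<bar>a - c\<bar> * m"
      unfolding rect_integral_def using J[OF I1] iI im by simp
    finally show ?thesis .
  qed
  show ?thesis using 1 2 3 by (simp add: m_def)
qed

lemma l1_dist_avg:
  assumes p: "0 < p" "p < 1" and h: "h \<in> graphons" and e: "e > 0"
  shows "eventually (\<lambda>n. l1_dist h (egraphon n p (avg_weight n h)) < e) sequentially"
proof -
  \<comment> \<open>The losses are \<open>2 * \<eta>\<close> from the approximation by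
    \<open>\<phi>\<close>, \<open>2 * \<eta>\<close> from its oscillation on cells and
    \<open>\<eta>\<close> from the diagonal; 8 leaves a margin.\<close>
  define \<eta> where "\<eta> = e / 8"
  have \<eta>: "\<eta> > 0" using e by (simp add: \<eta>_def)
  obtain \<phi> where \<phi>: "continuous_on UNIV \<phi>" "\<And>z. 0 \<le> \<phi> z \<and> \<phi> z \<le> 1" "(\<integral>z. \<bar>h z - \<phi> z\<bar> \<partial>sqm) < \<eta>"
    by (rule graphon_approx_continuous[OF h \<eta>], rule that)
  have \<phi>m: "\<phi> \<in> borel_measurable sqm"
    unfolding sqm_eq using borel_measurable_continuous_onI[OF \<phi>(1)] by (intro measurable_restrict_space1) simp
  have "uniformly_continuous_on unit_sq \<phi>"
    using \<phi>(1) by (intro compact_uniformly_continuous compact_Times) (auto intro: continuous_on_subset)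
  then obtain d where d: "d > 0" "\<And>z z'. z \<in> unit_sq \<Longrightarrow> z' \<in> unit_sq \<Longrightarrow> dist z' z < d \<Longrightarrow> \<bar>\<phi> z' - \<phi> z\<bar> < \<eta>"
    using \<eta> unfolding uniformly_continuous_on_def dist_real_def by metis
  have "eventually (\<lambda>n::nat. 2 / real n < d \<and> 1 / real n < \<eta> \<and> n > 0) sequentially"
    using d(1) \<eta> by (intro eventually_conj order_tendstoD(2)[OF lim_const_over_n] eventually_gt_at_top) auto
  then show ?thesis
  proof eventually_elim
    case (elim n)
    then have n: "n > 0" "2 / real n < d" "1 / real n < \<eta>" by auto
    let ?g = "egraphon n p (avg_weight n h)"
    have G: "?g \<in> graphons" using p h by auto
    note hI = graphon_integrable[OF h]
    have \<phi>I: "integrable sqm \<phi>" using \<phi>m \<phi>(2) by (intro integrable_sqm[where B=1]) auto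
    have I2: "integrable sqm (\<lambda>z. \<bar>h z - \<phi> z\<bar>)"
      using hI \<phi>I by (intro integrable_abs Bochner_Integration.integrable_diff)
    have "l1_dist h ?g = (\<Sum>i\<in>{1..n}. \<Sum>j\<in>{1..n}. rect_integral (\<lambda>z. \<bar>h z - ?g z\<bar>) (cell n i) (cell n j))"
      unfolding l1_dist_def
      by (intro integral_cells n graphon_diff_integrable h G)
    also have "\<dots> \<le> (\<Sum>i\<in>{1..n}. \<Sum>j\<in>{1..n}. 2 * (rect_integral (\<lambda>z. \<bar>h z - \<phi> z\<bar>) (cell n i) (cell n j) + \<eta> / (real n)\<^sup>2)
        + (if i = j then 1 / (real n)\<^sup>2 else 0))"
    proof (intro sum_mono)
      fix i j assume ij: "i \<in> {1..n}" "j \<in> {1..n}"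
      have eq: "rect_integral (\<lambda>z. \<bar>h z - ?g z\<bar>) (cell n i) (cell n j) =
        rect_integral (\<lambda>z. \<bar>h z - edge_value p (avg_weight n h) i j\<bar>) (cell n i) (cell n j)"
        unfolding rect_integral_def using egraphon_on_cell[OF n(1) ij]
        by (intro Bochner_Integration.integral_cong) (auto simp: indicator_def)
      have \<phi>nn: "0 \<le> rect_integral (\<lambda>z. \<bar>h z - \<phi> z\<bar>) (cell n i) (cell n j)"
        unfolding rect_integral_def by (intro Bochner_Integration.integral_nonneg) auto
      show "rect_integral (\<lambda>z. \<bar>h z - ?g z\<bar>) (cell n i) (cell n j) \<le>
         2 * (rect_integral (\<lambda>z. \<bar>h z - \<phi> z\<bar>) (cell n i) (cell n j) + \<eta> / (real n)\<^sup>2) + (if i = j then 1 / (real n)\<^sup>2 else 0)"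
      proof (cases "i = j")
        case True
        have C: "cell n i \<times> cell n j \<in> sets sqm" using ij by (intro rect_sets cell_sets)
        have "rect_integral (\<lambda>z. \<bar>h z - ?g z\<bar>) (cell n i) (cell n j) \<le> (\<integral>z. indicator (cell n i \<times> cell n j) z \<partial>sqm)"
          unfolding rect_integral_def
        proof (rule integral_mono)
          show "integrable sqm (\<lambda>z. indicator (cell n i \<times> cell n j) z * \<bar>h z - ?g z\<bar>)"
            using ij by (intro integrable_rect cell_sets graphon_diff_integrable h G)
          show "integrable sqm (indicator (cell n i \<times> cell n j) :: _ \<Rightarrow> real)"
            using C by (simp add: sqm.emeasure_finite less_top[symmetric])
          fix z assume "z \<in> space sqm"
          then show "indicator (cell n i \<times> cell n j) z * \<bar>h z - ?g z\<bar> \<le> indicator (cell n i \<times> cell n j) z"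
            using graphon_diff_le[OF h G, of z] by (auto simp: indicator_def)
        qed
        also have "\<dots> = 1 / (real n)\<^sup>2" using sets.Int_space_eq2[OF C] measure_cell_rect[OF ij] by simp
        moreover have "0 \<le> 2 * (rect_integral (\<lambda>z. \<bar>h z - \<phi> z\<bar>) (cell n i) (cell n j) + \<eta> / (real n)\<^sup>2)"
          using \<phi>nn \<eta> by simp
        ultimately show ?thesis using True by simp
      next
        case False
        \<comment> \<open>The upper right corner of the cell, at distance at most
          \<open>1 / n\<close> in each coordinate from its points.\<close>
        let ?c = "(real i / real n, real j / real n)"
        have "rect_integral (\<lambda>z. \<bar>h z - edge_value p (avg_weight n h) i j\<bar>) (cell n i) (cell n j) \<le>
           2 * (rect_integral (\<lambda>z. \<bar>h z - \<phi> z\<bar>) (cell n i) (cell n j) + \<eta> / (real n)\<^sup>2)"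
        proof (rule l1_dist_avg_cell[OF h ij _ \<phi>m \<phi>(2), where c = "\<phi> ?c"])
          show "edge_value p (avg_weight n h) i j = (real n)\<^sup>2 * rect_integral h (cell n i) (cell n j)"
            using False by (simp add: edge_value_def avg_weight_pair[OF h ij False])
          fix z assume z: "z \<in> cell n i \<times> cell n j"
          obtain x y where xy: "z = (x, y)" by (cases z)
          have x: "x \<in> cell n i" "y \<in> cell n j" using z xy by auto
          have "dist x (real i / real n) \<le> 1 / real n" "dist y (real j / real n) \<le> 1 / real n"
            using x n by (auto simp: cell_def dist_real_def diff_divide_distrib)
          then have "dist z ?c \<le> 2 / real n"
            using dist_triangle[of "(x, y)" ?c "(real i / real n, y)"] by (simp add: xy dist_Pair_Pair)
          moreover have "z \<in> unit_sq" using x cell_subset[OF ij(1)] cell_subset[OF ij(2)] xy by auto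
          moreover have "?c \<in> unit_sq" using ij n by (auto simp: field_simps)
          ultimately show "\<bar>\<phi> z - \<phi> ?c\<bar> \<le> \<eta>" using d(2)[of ?c z] n by simp
        qed (use \<phi>(2) in auto)
        then show ?thesis unfolding eq using False by simp
      qed
    qed
    also have "\<dots> = 2 * (\<Sum>i\<in>{1..n}. \<Sum>j\<in>{1..n}. rect_integral (\<lambda>z. \<bar>h z - \<phi> z\<bar>) (cell n i) (cell n j)) + 2 * \<eta> + 1 / real n"
      using n by (simp add: sum.distrib sum_distrib_left[symmetric] power2_eq_square)
    also have "(\<Sum>i\<in>{1..n}. \<Sum>j\<in>{1..n}. rect_integral (\<lambda>z. \<bar>h z - \<phi> z\<bar>) (cell n i) (cell n j)) = (\<integral>z. \<bar>h z - \<phi> z\<bar> \<partial>sqm)"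
      by (intro integral_cells[symmetric] n I2)
    also have "2 * (\<integral>z. \<bar>h z - \<phi> z\<bar> \<partial>sqm) + 2 * \<eta> + 1 / real n < e"
    proof -
      have "e = 8 * \<eta>" by (simp add: \<eta>_def)
      then show ?thesis using \<phi>(3) n(3) \<eta> by linarith
    qed
    finally show ?case .
  qed
qed

section \<open>Lower semicontinuity of the rate function\<close>

lemma graphon_rate_lsc_cut:
  assumes p: "0 < p" "p < 1" and h: "h \<in> graphons" and s: "s < graphon_rate p h"
  obtains d where "d > 0" "\<And>g. g \<in> graphons \<Longrightarrow> cut_dist h g < d \<Longrightarrow> s < graphon_rate p g"
proof -
  \<comment> \<open>Of the four parts, two are lost in passing from \<open>h\<close> to its average,
    one between the averages of \<open>h\<close> and \<open>g\<close>, and the last makes the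
    inequality strict.\<close>
  define r where "r = (graphon_rate p h - s) / 4"
  have r: "r > 0" using s by (simp add: r_def)
  obtain C where C: "C \<ge> 0" "\<And>f g. f \<in> graphons \<Longrightarrow> g \<in> graphons \<Longrightarrow> \<bar>graphon_rate p f - graphon_rate p g\<bar> \<le> r + C * l1_dist f g"
    by (rule graphon_rate_modulus[OF p r]) blast
  have "eventually (\<lambda>n. l1_dist h (egraphon n p (avg_weight n h)) < r / (C + 1) \<and> n > 0) sequentially"
    using r C by (intro eventually_conj l1_dist_avg[OF p h] eventually_gt_at_top) auto
  then obtain n where n: "n > 0" "l1_dist h (egraphon n p (avg_weight n h)) < r / (C + 1)"
    by (auto simp: eventually_sequentially)
  have "C * l1_dist h (egraphon n p (avg_weight n h)) \<le> (C + 1) * (r / (C + 1))"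
    using C n by (intro mult_mono) (auto simp: l1_dist_def)
  then have 1: "graphon_rate p h - 2 * r \<le> graphon_rate p (egraphon n p (avg_weight n h))"
    using C(2)[OF h egraphon_avg[OF p h, of n]] C(1) by auto
  obtain K where K: "K \<ge> 0" "\<And>u v. 0 \<le> u \<Longrightarrow> u \<le> 1 \<Longrightarrow> 0 \<le> v \<Longrightarrow> v \<le> 1 \<Longrightarrow> \<bar>rate p u - rate p v\<bar> \<le> r/2 + K * \<bar>u - v\<bar>"
    using rate_modulus[OF p, of "r/2"] r by (metis half_gt_zero)
  \<comment> \<open>Weights are \<open>n^2\<close> times rectangle integrals. A cut distance below
    \<open>d\<close> therefore moves each weight by at most \<open>r / (2 * (K + 1))\<close>, and
    each value of the rate by at most \<open>r\<close>.\<close>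
  define d where "d = r / (2 * (K + 1) * (real n)\<^sup>2)"
  show ?thesis
  proof (rule that[of d])
    show "d > 0" using r K n by (simp add: d_def)
    fix g assume g: "g \<in> graphons" and gd: "cut_dist h g < d"
    have e: "\<bar>rate p (avg_weight n h e) - rate p (avg_weight n g e)\<bar> \<le> r" if e_in: "e \<in> possible_edges n" for e
    proof -
      obtain i j where ij: "i \<in> {1..n}" "j \<in> {1..n}" "i \<noteq> j" "e = {i, j}" using e_in by (rule possible_edgeE)
      have "\<bar>avg_weight n h e - avg_weight n g e\<bar> = (real n)\<^sup>2 * \<bar>rect_integral h (cell n i) (cell n j) - rect_integral g (cell n i) (cell n j)\<bar>"
        using ij h g by (simp add: avg_weight_pair right_diff_distrib[symmetric] abs_mult del: atLeastAtMost_iff)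
      also have "\<dots> \<le> (real n)\<^sup>2 * d"
        using rect_integral_le_cut_dist[OF h g cell_sets[OF ij(1)] cell_sets[OF ij(2)]] gd
        by (intro mult_left_mono) auto
      also have "\<dots> = r / (2 * (K + 1))" using n by (simp add: d_def)
      finally have "K * \<bar>avg_weight n h e - avg_weight n g e\<bar> \<le> (K + 1) * (r / (2 * (K + 1)))"
        using K r by (intro mult_mono) auto
      also have "\<dots> = r / 2" using K by (simp add: field_simps)
      finally have "K * \<bar>avg_weight n h e - avg_weight n g e\<bar> \<le> r / 2" .
      moreover have "\<bar>rate p (avg_weight n h e) - rate p (avg_weight n g e)\<bar> \<le> r/2 + K * \<bar>avg_weight n h e - avg_weight n g e\<bar>"
        using avg_weight_01[OF h, of n e] avg_weight_01[OF g, of n e] by (intro K(2)) auto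
      ultimately show ?thesis by linarith
    qed
    have "graphon_rate p (egraphon n p (avg_weight n h)) * (real n)\<^sup>2 - graphon_rate p (egraphon n p (avg_weight n g)) * (real n)\<^sup>2
        = 2 * (\<Sum>e\<in>possible_edges n. rate p (avg_weight n h e) - rate p (avg_weight n g e))"
      using n p by (simp add: graphon_rate_egraphon avg_weight_01 h g sum_subtractf)
    also have "\<dots> \<le> 2 * (\<Sum>e\<in>possible_edges n. r)"
      using e by (intro mult_left_mono sum_mono) (force simp: abs_le_iff)+
    also have "\<dots> \<le> r * (real n)\<^sup>2"
      using card_possible_edges_le[of n] r mult_right_mono[of "2 * real (card (possible_edges n))" "(real n)\<^sup>2" r]
      by (simp add: mult.commute mult.left_commute)
    finally have "graphon_rate p (egraphon n p (avg_weight n h)) - graphon_rate p (egraphon n p (avg_weight n g)) \<le> r"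
      using n by (simp add: left_diff_distrib[symmetric])
    show "s < graphon_rate p g"
    proof -
      have "graphon_rate p h = s + 4 * r" by (simp add: r_def field_simps)
      then show ?thesis using 1 graphon_rate_avg_le[OF p n(1) g] r
        \<open>graphon_rate p (egraphon n p (avg_weight n h)) - graphon_rate p (egraphon n p (avg_weight n g)) \<le> r\<close>
        by linarith
    qed
  qed
qed

lemma graphon_rate_lsc:
  assumes p: "0 < p" "p < 1" and h: "h \<in> graphons" and s: "s < graphon_rate p h"
  obtains d where "d > 0" "\<And>g. g \<in> graphons \<Longrightarrow> orbit_dist h g < d \<Longrightarrow> s < graphon_rate p g"
proof -
  obtain d where d: "d > 0" "\<And>g. g \<in> graphons \<Longrightarrow> cut_dist h g < d \<Longrightarrow> s < graphon_rate p g"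
    by (rule graphon_rate_lsc_cut[OF assms]) blast
  show ?thesis
  proof (rule that[OF d(1)])
    fix g assume g: "g \<in> graphons" "orbit_dist h g < d"
    then obtain \<sigma> where \<sigma>: "\<sigma> \<in> mp_bijections" "cut_dist h (relabel g \<sigma>) < d"
      using orbit_dist_lessD[OF h] by blast
    then show "s < graphon_rate p g"
      using d(2)[OF relabel_graphon[OF \<sigma>(1) g(1)]] graphon_rate_relabel[OF p g(1) \<sigma>(1)] by simp
  qed
qed

text \<open>Each of two functions at distance zero lies in every neighbourhood of the other, so
  semicontinuity gives both inequalities. This extends invariance from the orbit to its
  closure.\<close>

lemma graphon_rate_class:
  assumes p: "0 < p" "p < 1" and f: "f \<in> graphons" and g: "g \<in> graphons" and z: "orbit_dist f g = 0"
  shows "graphon_rate p f = graphon_rate p g"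
proof -
  have *: "graphon_rate p f \<le> graphon_rate p g"
    if f: "f \<in> graphons" and g: "g \<in> graphons" and z: "orbit_dist f g = 0" for f g
  proof (rule ccontr)
    assume "\<not> graphon_rate p f \<le> graphon_rate p g"
    then obtain d where "d > 0" "\<And>k. k \<in> graphons \<Longrightarrow> orbit_dist f k < d \<Longrightarrow> graphon_rate p g < graphon_rate p k"
      using graphon_rate_lsc[OF p f, of "graphon_rate p g"] by (metis not_le)
    then show False using g z by fastforce
  qed
  show ?thesis using *[OF f g z] *[OF g f] z orbit_dist_commute[OF f g] by simp
qed

lemma class_rate_class:
  assumes p: "0 < p" "p < 1" and f: "f \<in> graphons"
  shows "class_rate p (graphon_class f) = graphon_rate p f"
  unfolding class_rate_def
  by (rule graphon_rate_class[OF p _ f orbit_dist_class_rep[OF f]]) (use f in \<open>auto intro: class_rep\<close>)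

lemma class_rate_lsc:
  assumes p: "0 < p" "p < 1" and A: "A \<in> graphon_space" and s: "s < class_rate p A"
  obtains d where "d > 0" "\<And>B. B \<in> graphon_space \<Longrightarrow> delta_cut A B < d \<Longrightarrow> s < class_rate p B"
proof -
  obtain d where d: "d > 0" "\<And>g. g \<in> graphons \<Longrightarrow> orbit_dist (class_rep A) g < d \<Longrightarrow> s < graphon_rate p g"
    using graphon_rate_lsc[OF p class_rep(1)[OF A] s[unfolded class_rate_def]] by blast
  show ?thesis
    by (rule that[OF d(1)]) (use d(2) A in \<open>auto simp: class_rate_def delta_cut_eq class_rep\<close>)
qed

section \<open>Weak regularity\<close>

text \<open>The conditional expectation of \<open>w\<close> given \<open>\<kappa>\<close> under the
  uniform law on \<open>X\<close>, as a function of the label. A label that does not occur gets 0,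
  by division by zero.\<close>

definition block_mean :: "'a set \<Rightarrow> ('a \<Rightarrow> 'k) \<Rightarrow> ('a \<Rightarrow> real) \<Rightarrow> 'k \<Rightarrow> real" where
  "block_mean X \<kappa> w k = (\<Sum>e\<in>{e \<in> X. \<kappa> e = k}. w e) / real (card {e \<in> X. \<kappa> e = k})"

lemma block_mean_01:
  assumes "finite X" "\<And>e. e \<in> X \<Longrightarrow> 0 \<le> w e \<and> w e \<le> 1"
  shows "0 \<le> block_mean X \<kappa> w k \<and> block_mean X \<kappa> w k \<le> 1"
proof -
  have "(\<Sum>e\<in>{e \<in> X. \<kappa> e = k}. w e) \<le> (\<Sum>e\<in>{e \<in> X. \<kappa> e = k}. 1)"
    using assms by (intro sum_mono) auto
  then have "(\<Sum>e\<in>{e \<in> X. \<kappa> e = k}. w e) \<le> real (card {e \<in> X. \<kappa> e = k})" by simp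
  moreover have "0 \<le> (\<Sum>e\<in>{e \<in> X. \<kappa> e = k}. w e)" using assms by (intro sum_nonneg) auto
  ultimately show ?thesis unfolding block_mean_def
    by (auto simp: divide_le_eq_1)
qed

text \<open>The residual of a conditional expectation is orthogonal to every function of the label,
  since it sums to zero on each block.\<close>

lemma block_mean_orthogonal:
  assumes fin: "finite X" and t: "\<And>e e'. e \<in> X \<Longrightarrow> e' \<in> X \<Longrightarrow> \<kappa> e = \<kappa> e' \<Longrightarrow> t e = t e'"
  shows "(\<Sum>e\<in>X. t e * (w e - block_mean X \<kappa> w (\<kappa> e))) = 0"
proof -
  have "(\<Sum>e\<in>X. t e * (w e - block_mean X \<kappa> w (\<kappa> e))) =
    (\<Sum>k\<in>\<kappa> ` X. \<Sum>e\<in>{e \<in> X. \<kappa> e = k}. t e * (w e - block_mean X \<kappa> w (\<kappa> e)))"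
    using fin by (intro sum.group[symmetric]) auto
  also have "\<dots> = 0"
  proof (rule sum.neutral, rule ballI)
    fix k assume "k \<in> \<kappa> ` X"
    then obtain e0 where e0: "e0 \<in> X" "\<kappa> e0 = k" by auto
    let ?F = "{e \<in> X. \<kappa> e = k}"
    have c: "card ?F \<noteq> 0" using fin e0 by auto
    have "(\<Sum>e\<in>?F. t e * (w e - block_mean X \<kappa> w (\<kappa> e))) = (\<Sum>e\<in>?F. t e0 * (w e - block_mean X \<kappa> w k))"
    proof (intro sum.cong refl)
      fix e assume "e \<in> ?F"
      then have "e \<in> X" "\<kappa> e = k" by auto
      moreover from this have "t e = t e0" using e0 by (intro t) simp_all
      ultimately show "t e * (w e - block_mean X \<kappa> w (\<kappa> e)) = t e0 * (w e - block_mean X \<kappa> w k)" by simp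
    qed
    also have "\<dots> = t e0 * ((\<Sum>e\<in>?F. w e) - real (card ?F) * block_mean X \<kappa> w k)"
      by (simp add: sum_distrib_left[symmetric] sum_subtractf)
    also have "\<dots> = 0" using c by (simp add: block_mean_def)
    finally show "(\<Sum>e\<in>?F. t e * (w e - block_mean X \<kappa> w (\<kappa> e))) = 0" .
  qed
  finally show ?thesis .
qed

text \<open>The test function \<open>t\<close> depends only on the finer label, so against it
  \<open>w\<close> may be replaced by its finer block means. Cauchy-Schwarz then brings in the
  squared distance of the two block means, which by Pythagoras is the gain in energy.\<close>

lemma block_mean_energy_increment:
  assumes fin: "finite X"
    and ref: "\<And>e e'. e \<in> X \<Longrightarrow> e' \<in> X \<Longrightarrow> \<kappa>' e = \<kappa>' e' \<Longrightarrow> \<kappa> e = \<kappa> e'"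
    and t: "\<And>e e'. e \<in> X \<Longrightarrow> e' \<in> X \<Longrightarrow> \<kappa>' e = \<kappa>' e' \<Longrightarrow> t e = t e'"
  shows "(\<Sum>e\<in>X. t e * (w e - block_mean X \<kappa> w (\<kappa> e)))\<^sup>2 \<le> (\<Sum>e\<in>X. (t e)\<^sup>2) *
    ((\<Sum>e\<in>X. (block_mean X \<kappa>' w (\<kappa>' e))\<^sup>2) - (\<Sum>e\<in>X. (block_mean X \<kappa> w (\<kappa> e))\<^sup>2))"
proof -
  define a where "a e = block_mean X \<kappa> w (\<kappa> e)" for e
  define a' where "a' e = block_mean X \<kappa>' w (\<kappa>' e)" for e
  have 1: "(\<Sum>e\<in>X. t e * (w e - a' e)) = 0" unfolding a'_def by (rule block_mean_orthogonal[OF fin t])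
  have "a e = a e'" if "e \<in> X" "e' \<in> X" "\<kappa>' e = \<kappa>' e'" for e e'
    using ref[OF that] by (simp add: a_def)
  then have 2: "(\<Sum>e\<in>X. a e * (w e - a' e)) = 0"
    unfolding a'_def by (rule block_mean_orthogonal[OF fin])
  have 3: "(\<Sum>e\<in>X. a e * (w e - a e)) = 0"
    unfolding a_def by (rule block_mean_orthogonal[OF fin]) simp
  have "(\<Sum>e\<in>X. t e * (w e - a e)) = (\<Sum>e\<in>X. t e * (w e - a' e)) + (\<Sum>e\<in>X. t e * (a' e - a e))"
    by (simp add: sum.distrib[symmetric] algebra_simps)
  then have "(\<Sum>e\<in>X. t e * (w e - a e))\<^sup>2 \<le> (\<Sum>e\<in>X. (t e)\<^sup>2) * (\<Sum>e\<in>X. (a' e - a e)\<^sup>2)"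
    using Cauchy_Schwarz_ineq_sum[of t "\<lambda>e. a' e - a e" X] by (simp add: 1)
  \<comment> \<open>The two orthogonality sums are written out, so that they can be replaced by
    0.\<close>
  also have "(\<Sum>e\<in>X. (a' e - a e)\<^sup>2) = (\<Sum>e\<in>X. (a' e)\<^sup>2) - (\<Sum>e\<in>X. (a e)\<^sup>2) - 2 * (\<Sum>e\<in>X. a e * (w e - a e)) + 2 * (\<Sum>e\<in>X. a e * (w e - a' e))"
    unfolding sum_distrib_left sum_subtractf[symmetric] sum.distrib[symmetric]
    by (intro sum.cong refl) (simp add: power2_eq_square algebra_simps)
  finally show ?thesis unfolding 2 3 by (simp add: a_def a'_def)
qed

section \<open>Refining a colouring by two vertex sets\<close>

lemma incidence_pair:
  assumes "a \<noteq> b"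
  shows "incidence S T {a, b} = of_bool (a \<in> S \<and> b \<in> T) + of_bool (b \<in> S \<and> a \<in> T)"
proof -
  have "{(i, j) \<in> S \<times> T. i \<noteq> j \<and> {i, j} = {a, b}} =
      (if a \<in> S \<and> b \<in> T then {(a, b)} else {}) \<union> (if b \<in> S \<and> a \<in> T then {(b, a)} else {})"
    using assms by (auto simp: doubleton_eq_iff)
  then show ?thesis unfolding incidence_def using assms by (auto simp: card_insert_if)
qed

text \<open>The old colour becomes the leading part in base 4 and the two memberships form the last
  digit, so each refinement multiplies the number of colours by 4.\<close>

definition refine_colouring :: "(nat \<Rightarrow> nat) \<Rightarrow> nat set \<Rightarrow> nat set \<Rightarrow> nat \<Rightarrow> nat" where
  "refine_colouring c S T i = 4 * c i + (if i \<in> S then 2 else 0) + (if i \<in> T then 1 else 0)"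

lemma refine_colouring_div: "refine_colouring c S T i div 4 = c i"
proof -
  have "(4 * a + r) div 4 = a" if "r < 4" for a r :: nat using that by presburger
  then show ?thesis by (simp add: refine_colouring_def add.assoc)
qed

lemma refine_colouring_eq:
  assumes "refine_colouring c S T i = refine_colouring c S T j"
  shows "i \<in> S \<longleftrightarrow> j \<in> S" "i \<in> T \<longleftrightarrow> j \<in> T"
proof -
  have "c i = c j" using assms refine_colouring_div by metis
  then show "i \<in> S \<longleftrightarrow> j \<in> S" "i \<in> T \<longleftrightarrow> j \<in> T"
    using assms by (auto simp: refine_colouring_def split: if_splits)
qed

text \<open>Equal colour sets match the ends of the two edges up to a swap, and the incidence
  coefficient is symmetric in the two ends. Old colours are recovered by division by 4.\<close>

lemma refine_colouring_incidence:
  assumes e: "e \<in> possible_edges n" "e' \<in> possible_edges n"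
    and eq: "refine_colouring c S T ` e = refine_colouring c S T ` e'"
  shows "incidence S T e = incidence S T e'" "c ` e = c ` e'"
proof -
  obtain a b where ab: "a \<noteq> b" "e = {a, b}" using e(1) by (rule possible_edgeE) auto
  obtain a' b' where ab': "a' \<noteq> b'" "e' = {a', b'}" using e(2) by (rule possible_edgeE) auto
  let ?r = "refine_colouring c S T"
  have "?r a = ?r a' \<and> ?r b = ?r b' \<or> ?r a = ?r b' \<and> ?r b = ?r a'"
    using eq by (auto simp: ab ab' doubleton_eq_iff)
  then show "incidence S T e = incidence S T e'"
  proof
    assume "?r a = ?r a' \<and> ?r b = ?r b'"
    then have r: "?r a = ?r a'" "?r b = ?r b'" by auto
    have "a \<in> S \<longleftrightarrow> a' \<in> S" "a \<in> T \<longleftrightarrow> a' \<in> T" "b \<in> S \<longleftrightarrow> b' \<in> S" "b \<in> T \<longleftrightarrow> b' \<in> T"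
      by (rule refine_colouring_eq[OF r(1)] refine_colouring_eq[OF r(2)])+
    then show ?thesis by (simp add: ab(2) ab'(2) incidence_pair[OF ab(1)] incidence_pair[OF ab'(1)])
  next
    assume "?r a = ?r b' \<and> ?r b = ?r a'"
    then have r: "?r a = ?r b'" "?r b = ?r a'" by auto
    have "a \<in> S \<longleftrightarrow> b' \<in> S" "a \<in> T \<longleftrightarrow> b' \<in> T" "b \<in> S \<longleftrightarrow> a' \<in> S" "b \<in> T \<longleftrightarrow> a' \<in> T"
      by (rule refine_colouring_eq[OF r(1)] refine_colouring_eq[OF r(2)])+
    then show ?thesis by (simp add: ab(2) ab'(2) incidence_pair[OF ab(1)] incidence_pair[OF ab'(1)])
  qed
  have "c ` e = (\<lambda>x. x div 4) ` ?r ` e" "c ` e' = (\<lambda>x. x div 4) ` ?r ` e'"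
    by (simp_all add: image_image refine_colouring_div)
  then show "c ` e = c ` e'" using eq by simp
qed

text \<open>Edges are unordered, so the label is the set of end colours. With \<open>k\<close>
  colours there are at most \<open>2 ^ k\<close> labels, a number that reappears in the upper
  bound.\<close>

abbreviation colour_mean :: "nat \<Rightarrow> (nat \<Rightarrow> nat) \<Rightarrow> (nat set \<Rightarrow> real) \<Rightarrow> nat set \<Rightarrow> real" where
  "colour_mean n c w \<equiv> block_mean (possible_edges n) (\<lambda>e. c ` e) w"

text \<open>The energy increment argument of Frieze and Kannan. A pair \<open>S\<close>,
  \<open>T\<close> violating the bound refines the colouring and raises the energy by at least
  \<open>\<epsilon>^2 * n^2 / 2\<close>, while the energy never exceeds \<open>n^2 / 2\<close>. The
  number of steps, and with it \<open>k\<close>, depends on \<open>\<epsilon>\<close> alone.\<close>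

lemma weak_regularity:
  assumes \<epsilon>: "\<epsilon> > 0"
  obtains k :: nat where "k > 0" "\<And>n w. \<forall>e. 0 \<le> w e \<and> w e \<le> 1 \<Longrightarrow>
    \<exists>c. (\<forall>i. c i < k) \<and> (\<forall>S\<subseteq>{1..n}. \<forall>T\<subseteq>{1..n}.
      \<bar>\<Sum>e\<in>possible_edges n. incidence S T e * (w e - colour_mean n c w (c ` e))\<bar> \<le> \<epsilon> * (real n)\<^sup>2)"
proof -
  \<comment> \<open>After \<open>m\<close> refinements the energy would exceed
    \<open>n^2 / 2\<close>.\<close>
  obtain m :: nat where m: "1 / \<epsilon>\<^sup>2 < real m" using reals_Archimedean2 by blast
  show ?thesis
  proof (rule that[of "4 ^ m"])
    fix n and w :: "nat set \<Rightarrow> real" assume w: "\<forall>e. 0 \<le> w e \<and> w e \<le> 1"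
    define reg where "reg c \<longleftrightarrow> (\<forall>S\<subseteq>{1..n}. \<forall>T\<subseteq>{1..n}.
      \<bar>\<Sum>e\<in>possible_edges n. incidence S T e * (w e - colour_mean n c w (c ` e))\<bar> \<le> \<epsilon> * (real n)\<^sup>2)" for c
    define E where "E c = (\<Sum>e\<in>possible_edges n. (colour_mean n c w (c ` e))\<^sup>2)" for c
    have E0: "0 \<le> E c" for c by (simp add: E_def sum_nonneg)
    have step: "E (refine_colouring c S T) \<ge> E c + \<epsilon>\<^sup>2 * (real n)\<^sup>2 / 2"
      if ST: "S \<subseteq> {1..n}" "T \<subseteq> {1..n}"
        "\<bar>\<Sum>e\<in>possible_edges n. incidence S T e * (w e - colour_mean n c w (c ` e))\<bar> > \<epsilon> * (real n)\<^sup>2" for c S T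
    proof -
      have n: "n > 0"
      proof (rule ccontr)
        assume "\<not> n > 0"
        then have "possible_edges n = {}" by (auto simp: possible_edges_def)
        with ST(3) \<open>\<not> n > 0\<close> show False by simp
      qed
      let ?D = "E (refine_colouring c S T) - E c"
      have le: "(\<Sum>e\<in>possible_edges n. incidence S T e * (w e - colour_mean n c w (c ` e)))\<^sup>2
         \<le> (\<Sum>e\<in>possible_edges n. (incidence S T e)\<^sup>2) * ?D"
        unfolding E_def by (rule block_mean_energy_increment[OF finite_possible_edges
            refine_colouring_incidence(2) refine_colouring_incidence(1)])
      have sq: "(\<epsilon> * (real n)\<^sup>2)\<^sup>2 < (\<Sum>e\<in>possible_edges n. incidence S T e * (w e - colour_mean n c w (c ` e)))\<^sup>2"
        using ST(3) \<epsilon> by (intro abs_square_less_1[THEN iffD1] power2_strict_mono) (auto simp: abs_mult)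
      \<comment> \<open>Coefficients are at most 2 and there are at most \<open>n^2 / 2\<close>
        edges. Dividing \<open>(\<epsilon> * n^2)^2\<close> by the resulting \<open>2 * n^2\<close>
        gives the energy increment.\<close>
      have "(\<Sum>e\<in>possible_edges n. (incidence S T e)\<^sup>2) \<le> (\<Sum>e\<in>possible_edges n. 2\<^sup>2)"
        by (intro sum_mono power_mono incidence_le_2)
      also have "\<dots> \<le> 2 * (real n)\<^sup>2" using card_possible_edges_le[of n] by simp
      finally have i2: "(\<Sum>e\<in>possible_edges n. (incidence S T e)\<^sup>2) \<le> 2 * (real n)\<^sup>2" .
      have i0: "0 \<le> (\<Sum>e\<in>possible_edges n. (incidence S T e)\<^sup>2)" by (simp add: sum_nonneg)
      have "0 < (\<Sum>e\<in>possible_edges n. (incidence S T e)\<^sup>2) * ?D" using le sq by (smt (verit) zero_le_power2)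
      then have "?D > 0" using i0 by (auto simp: zero_less_mult_iff)
      then have "(\<Sum>e\<in>possible_edges n. (incidence S T e)\<^sup>2) * ?D \<le> 2 * (real n)\<^sup>2 * ?D"
        using i2 by (intro mult_right_mono) auto
      with le sq have "(\<epsilon> * (real n)\<^sup>2)\<^sup>2 \<le> 2 * (real n)\<^sup>2 * ?D" by linarith
      then have "(real n)\<^sup>2 * (\<epsilon>\<^sup>2 * (real n)\<^sup>2) \<le> (real n)\<^sup>2 * (2 * ?D)"
        by (simp add: power_mult_distrib power2_eq_square mult.assoc mult.left_commute)
      then have "\<epsilon>\<^sup>2 * (real n)\<^sup>2 \<le> 2 * ?D" using n by simp
      then show ?thesis by simp
    qed
    have "\<exists>c. (\<forall>i. c i < 4 ^ l) \<and> (reg c \<or> real l * (\<epsilon>\<^sup>2 * (real n)\<^sup>2 / 2) \<le> E c)" for l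
    proof (induction l)
      case 0
      then show ?case using E0 by (intro exI[of _ "\<lambda>_. 0"]) auto
    next
      case (Suc l)
      then obtain c where c: "\<And>i. c i < 4 ^ l" "reg c \<or> real l * (\<epsilon>\<^sup>2 * (real n)\<^sup>2 / 2) \<le> E c" by blast
      show ?case
      proof (cases "reg c")
        case True
        have "c i < 4 ^ Suc l" for i using c(1)[of i] by simp
        with True show ?thesis by blast
      next
        case False
        then obtain S T where ST: "S \<subseteq> {1..n}" "T \<subseteq> {1..n}"
          "\<bar>\<Sum>e\<in>possible_edges n. incidence S T e * (w e - colour_mean n c w (c ` e))\<bar> > \<epsilon> * (real n)\<^sup>2"
          unfolding reg_def by (auto simp: not_le)
        have "refine_colouring c S T i < 4 ^ Suc l" for i
          using c(1)[of i] by (simp add: refine_colouring_def)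
        moreover have "real (Suc l) * (\<epsilon>\<^sup>2 * (real n)\<^sup>2 / 2) \<le> E (refine_colouring c S T)"
          using step[OF ST] c(2) False by (simp add: algebra_simps)
        ultimately show ?thesis by blast
      qed
    qed
    then obtain c where c: "\<And>i. c i < 4 ^ m" "reg c \<or> real m * (\<epsilon>\<^sup>2 * (real n)\<^sup>2 / 2) \<le> E c" by blast
    have "reg c"
    proof (rule ccontr)
      assume nr: "\<not> reg c"
      have "n > 0"
      proof (rule ccontr)
        assume "\<not> n > 0"
        then have "possible_edges n = {}" by (auto simp: possible_edges_def)
        with nr \<epsilon> show False by (simp add: reg_def)
      qed
      have "0 \<le> colour_mean n c w (c ` e) \<and> colour_mean n c w (c ` e) \<le> 1" for e
        by (rule block_mean_01) (use w in auto)
      then have "E c \<le> (\<Sum>e\<in>possible_edges n. 1)"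
        unfolding E_def by (intro sum_mono power_le_one) blast+
      also have "\<dots> \<le> (real n)\<^sup>2 / 2" using card_possible_edges_le[of n] by simp
      finally have "real m * (\<epsilon>\<^sup>2 * (real n)\<^sup>2 / 2) \<le> (real n)\<^sup>2 / 2" using c(2) nr by simp
      then have "(real m * \<epsilon>\<^sup>2) * (real n)\<^sup>2 \<le> 1 * (real n)\<^sup>2" by (simp add: mult.assoc)
      then have "real m * \<epsilon>\<^sup>2 \<le> 1" using \<open>n > 0\<close> by (subst (asm) mult_le_cancel_right) auto
      then show False using m \<epsilon> by (simp add: field_simps)
    qed
    then show "\<exists>c. (\<forall>i. c i < 4 ^ m) \<and> (\<forall>S\<subseteq>{1..n}. \<forall>T\<subseteq>{1..n}.
      \<bar>\<Sum>e\<in>possible_edges n. incidence S T e * (w e - colour_mean n c w (c ` e))\<bar> \<le> \<epsilon> * (real n)\<^sup>2)"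
      using c(1) unfolding reg_def by blast
  qed simp
qed

section \<open>Interval exchanges\<close>

text \<open>Translates cell \<open>i\<close> onto cell number \<open>\<pi> i\<close>. The point 0
  lies in no cell and is fixed.\<close>

definition interval_exchange :: "nat \<Rightarrow> (nat \<Rightarrow> nat) \<Rightarrow> real \<Rightarrow> real" where
  "interval_exchange n \<pi> x = (if x = 0 then 0 else x + (real (\<pi> (cell_index n x)) - real (cell_index n x)) / real n)"

lemma cell_zero: "i \<in> {1..n} \<Longrightarrow> 0 \<notin> cell n i"
  by (auto simp: cell_def field_simps)

lemma interval_exchange_cell:
  assumes "n > 0" "i \<in> {1..n}" "x \<in> cell n i"
  shows "interval_exchange n \<pi> x = x + (real (\<pi> i) - real i) / real n"
    "interval_exchange n \<pi> x \<in> cell n (\<pi> i)"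
proof -
  have "cell_index n x = i" using assms cell_index_iff[of n i x] by auto
  moreover have "x \<noteq> 0" using assms cell_zero by auto
  ultimately show "interval_exchange n \<pi> x = x + (real (\<pi> i) - real i) / real n" by (simp add: interval_exchange_def)
  then show "interval_exchange n \<pi> x \<in> cell n (\<pi> i)" using assms by (auto simp: cell_def field_simps)
qed

lemma unit_interval_cells:
  assumes "n > 0" "x \<in> {0..1}"
  shows "x = 0 \<or> (\<exists>i\<in>{1..n}. x \<in> cell n i)"
proof (cases "x = 0")
  case False
  then have "cell_index n x \<in> {1..n}" using assms by (intro cell_index_in) auto
  then show ?thesis using cell_index_iff[of n "cell_index n x" x] assms by auto
qed simp

lemma measure_unit_leb_cells:
  assumes n: "n > 0" and B: "B \<in> sets unit_leb"
  shows "measure unit_leb B = (\<Sum>i\<in>{1..n}. measure unit_leb (B \<inter> cell n i))"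
proof -
  have "cell n i \<inter> cell n j = {}" if "i \<in> {1..n}" "j \<in> {1..n}" "i \<noteq> j" for i j
  proof -
    have False if "x \<in> cell n i" "x \<in> cell n j" for x
      using that \<open>i \<in> {1..n}\<close> \<open>j \<in> {1..n}\<close> \<open>i \<noteq> j\<close> cell_index_iff[OF n, of i x] cell_index_iff[OF n, of j x] by simp
    then show ?thesis by blast
  qed
  then have "disjoint_family_on (\<lambda>i. B \<inter> cell n i) {1..n}"
    unfolding disjoint_family_on_def by blast
  moreover have "B \<inter> cell n i \<in> sets unit_leb" if "i \<in> {1..n}" for i using B cell_sets[OF that] by blast
  ultimately have "(\<Sum>i\<in>{1..n}. measure unit_leb (B \<inter> cell n i)) = measure unit_leb (\<Union>i\<in>{1..n}. B \<inter> cell n i)"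
    by (intro unit_leb.finite_measure_finite_Union[symmetric]) auto
  also have "\<dots> = measure unit_leb B"
  proof (rule unit_leb.finite_measure_eq_AE)
    have "{0} \<in> null_sets unit_leb"
      by (auto simp: null_sets_def sets_unit_leb_iff emeasure_unit_leb)
    then have "AE x in unit_leb. x \<notin> {0}" by (rule AE_not_in)
    then show "AE x in unit_leb. (x \<in> (\<Union>i\<in>{1..n}. B \<inter> cell n i)) = (x \<in> B)"
      using AE_space
    proof eventually_elim
      case (elim x)
      then show ?case using unit_interval_cells[OF n, of x] by auto
    qed
    show "(\<Union>i\<in>{1..n}. B \<inter> cell n i) \<in> sets unit_leb" using B cell_sets by blast
  qed (rule B)
  finally show ?thesis by simp
qed

lemma interval_exchange_in:
  assumes n: "n > 0" and \<pi>: "bij_betw \<pi> {1..n} {1..n}" and x: "x \<in> {0..1}"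
  shows "interval_exchange n \<pi> x \<in> {0..1}"
  using unit_interval_cells[OF n x]
proof (elim disjE bexE)
  fix i assume i: "i \<in> {1..n}" "x \<in> cell n i"
  then show ?thesis using interval_exchange_cell(2)[OF n i, of \<pi>] cell_subset[of "\<pi> i" n] bij_betwE[OF \<pi>] by blast
qed (simp add: interval_exchange_def)

lemma interval_exchange_measurable:
  assumes n: "n > 0" and \<pi>: "bij_betw \<pi> {1..n} {1..n}"
  shows "interval_exchange n \<pi> \<in> measurable unit_leb unit_leb"
proof (rule measurable_restrict_space3)
  show "interval_exchange n \<pi> \<in> {0..1} \<rightarrow> {0..1}" using interval_exchange_in[OF assms] by auto
  have "(\<lambda>k::int. real (\<pi> (nat k)) - real (nat k)) \<in> borel_measurable (count_space UNIV)" by simp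
  then have "(\<lambda>x. real (\<pi> (cell_index n x)) - real (cell_index n x)) \<in> borel_measurable borel"
    by (rule measurable_compose[rotated]) measurable
  then have "interval_exchange n \<pi> \<in> borel_measurable borel"
    unfolding interval_exchange_def[abs_def] by measurable
  then show "interval_exchange n \<pi> \<in> measurable lborel lborel" by simp
qed

lemma interval_exchange_mp:
  assumes n: "n > 0" and \<pi>: "bij_betw \<pi> {1..n} {1..n}"
  shows "interval_exchange n \<pi> \<in> mp_bijections"
proof -
  define \<rho> where "\<rho> = the_inv_into {1..n} \<pi>"
  have \<rho>: "bij_betw \<rho> {1..n} {1..n}" unfolding \<rho>_def using \<pi> by (rule bij_betw_the_inv_into)
  have inv1: "\<rho> (\<pi> i) = i" if "i \<in> {1..n}" for i
    unfolding \<rho>_def using \<pi> that by (intro the_inv_into_f_f) (auto simp: bij_betw_def)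
  have inv2: "\<pi> (\<rho> i) = i" if "i \<in> {1..n}" for i
    unfolding \<rho>_def using \<pi> that by (intro f_the_inv_into_f_bij_betw) auto
  have comp: "interval_exchange n \<sigma> (interval_exchange n \<tau> x) = x"
    if \<tau>: "bij_betw \<tau> {1..n} {1..n}" and inv: "\<And>i. i \<in> {1..n} \<Longrightarrow> \<sigma> (\<tau> i) = i" and x: "x \<in> {0..1}" for \<sigma> \<tau> x
    using unit_interval_cells[OF n x]
  proof (elim disjE bexE)
    fix i assume i: "i \<in> {1..n}" "x \<in> cell n i"
    have ti: "\<tau> i \<in> {1..n}" using \<tau> i(1) bij_betwE by blast
    show ?thesis
      using interval_exchange_cell(1)[OF n i, of \<tau>] interval_exchange_cell(1)[OF n ti interval_exchange_cell(2)[OF n i, of \<tau>], of \<sigma>]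
        inv[OF i(1)] by (simp add: diff_divide_distrib)
  qed (simp add: interval_exchange_def)
  note m1 = interval_exchange_measurable[OF n \<pi>] and m2 = interval_exchange_measurable[OF n \<rho>]
  show ?thesis
  proof (rule mp_bijectionsI[where \<tau> = "interval_exchange n \<rho>"])
    show "x \<in> {0..1} \<Longrightarrow> interval_exchange n \<pi> (interval_exchange n \<rho> x) = x" for x
      by (rule comp[OF \<rho> inv2])
    show "bij_betw (interval_exchange n \<pi>) {0..1} {0..1}"
      by (rule bij_betwI[where g = "interval_exchange n \<rho>"])
         (use interval_exchange_in[OF n \<pi>] interval_exchange_in[OF n \<rho>] comp[OF \<pi> inv1] comp[OF \<rho> inv2] in auto)
    show "distr unit_leb unit_leb (interval_exchange n \<pi>) = unit_leb"
    proof (rule measure_eqI)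
      fix A assume "A \<in> sets (distr unit_leb unit_leb (interval_exchange n \<pi>))"
      then have A: "A \<in> sets unit_leb" by simp
      let ?A = "interval_exchange n \<pi> -` A \<inter> {0..1}"
      have iA: "?A \<in> sets unit_leb" using measurable_sets[OF m1 A] by simp
      \<comment> \<open>On each cell the map is a translation, which preserves Lebesgue measure; the
        permutation then only reorders the sum over cells.\<close>
      have piece: "measure unit_leb (?A \<inter> cell n i) = measure unit_leb (A \<inter> cell n (\<pi> i))" if i: "i \<in> {1..n}" for i
      proof -
        have pi: "\<pi> i \<in> {1..n}" using \<pi> i bij_betwE by blast
        define t where "t = (real (\<pi> i) - real i) / real n"
        have eq: "?A \<inter> cell n i = (\<lambda>x. t + x) -` (A \<inter> cell n (\<pi> i)) \<inter> space lborel"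
        proof (intro set_eqI iffI)
          fix x assume x: "x \<in> ?A \<inter> cell n i"
          then show "x \<in> (\<lambda>x. t + x) -` (A \<inter> cell n (\<pi> i)) \<inter> space lborel"
            using interval_exchange_cell[OF n i, of x \<pi>] by (auto simp: t_def add.commute)
        next
          fix x assume x: "x \<in> (\<lambda>x. t + x) -` (A \<inter> cell n (\<pi> i)) \<inter> space lborel"
          then have "x \<in> cell n i" by (auto simp: cell_def t_def diff_divide_distrib)
          moreover from this have "x \<in> {0..1}" using cell_subset[OF i] by auto
          ultimately show "x \<in> ?A \<inter> cell n i"
            using x interval_exchange_cell(1)[OF n i, of x \<pi>] by (auto simp: t_def add.commute)
        qed
        have A': "A \<inter> cell n (\<pi> i) \<in> sets unit_leb" using A cell_sets[OF pi] by blast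
        have "emeasure unit_leb (?A \<inter> cell n i) = emeasure lborel (?A \<inter> cell n i)"
          using iA cell_sets[OF i] by (intro emeasure_unit_leb) blast
        also have "\<dots> = emeasure (distr lborel borel ((+) t)) (A \<inter> cell n (\<pi> i))"
          unfolding eq using A' by (subst emeasure_distr) (auto simp: sets_unit_leb_iff)
        also have "\<dots> = emeasure unit_leb (A \<inter> cell n (\<pi> i))"
          using A' by (simp add: lborel_distr_plus emeasure_unit_leb)
        finally show ?thesis by (simp add: measure_def)
      qed
      have "measure unit_leb ?A = (\<Sum>i\<in>{1..n}. measure unit_leb (A \<inter> cell n (\<pi> i)))"
        using measure_unit_leb_cells[OF n iA] piece by simp
      also have "\<dots> = (\<Sum>i\<in>{1..n}. measure unit_leb (A \<inter> cell n i))"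
        by (rule sum.reindex_bij_betw[OF \<pi>])
      also have "\<dots> = measure unit_leb A" using measure_unit_leb_cells[OF n A] by simp
      finally show "emeasure (distr unit_leb unit_leb (interval_exchange n \<pi>)) A = emeasure unit_leb A"
        using m1 A by (simp add: emeasure_distr unit_leb.emeasure_eq_measure)
    qed simp
  qed (fact m1 m2)+
qed

text \<open>The equality is pointwise, axes included. There the index is 0, hence the condition on
  \<open>\<pi> 0\<close> and the injectivity on \<open>{0..n}\<close> in the proof.\<close>

lemma relabel_egraphon:
  assumes n: "n > 0" and \<pi>: "bij_betw \<pi> {1..n} {1..n}" and \<pi>0: "\<pi> 0 = 0"
  shows "relabel (egraphon n d w) (interval_exchange n \<pi>) = egraphon n d (\<lambda>e. w (\<pi> ` e))"
proof -
  have ci: "cell_index n (interval_exchange n \<pi> x) = \<pi> (cell_index n x)"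
    and ci0: "cell_index n x \<in> {0..n}" if x: "x \<in> {0..1}" for x
  proof -
    show "cell_index n (interval_exchange n \<pi> x) = \<pi> (cell_index n x)"
      using unit_interval_cells[OF n x]
    proof (elim disjE bexE)
      fix i assume i: "i \<in> {1..n}" "x \<in> cell n i"
      have pi: "\<pi> i \<in> {1..n}" using \<pi> i(1) bij_betwE by blast
      have "cell_index n (interval_exchange n \<pi> x) = \<pi> i"
        using interval_exchange_cell(2)[OF n i, of \<pi>] pi cell_index_iff[OF n, of "\<pi> i"] by simp
      moreover have "cell_index n x = i" using i cell_index_iff[OF n, of i] by simp
      ultimately show ?thesis by simp
    qed (simp add: interval_exchange_def \<pi>0)
    show "cell_index n x \<in> {0..n}"
      using x n by (auto simp: nat_le_iff ceiling_le_iff mult_le_cancel_left1)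
  qed
  have inj: "\<pi> i = \<pi> j \<longleftrightarrow> i = j" if "i \<in> {0..n}" "j \<in> {0..n}" for i j
  proof -
    have "\<pi> k \<noteq> 0" if "k \<in> {1..n}" for k using bij_betwE[OF \<pi>] that by force
    moreover have "inj_on \<pi> {1..n}" using \<pi> by (simp add: bij_betw_def)
    ultimately have nz: "\<And>k. k \<in> {1..n} \<Longrightarrow> \<pi> k \<noteq> 0" and inj: "inj_on \<pi> {1..n}" by auto
    note inj = inj_on_eq_iff[OF inj]
    show ?thesis
    proof (cases "i = 0 \<or> j = 0")
      case True
      then show ?thesis using nz[of i] nz[of j] that \<pi>0 by (cases "i = 0"; cases "j = 0") simp_all
    next
      case False
      then show ?thesis using inj[of i j] that by simp
    qed
  qed
  show ?thesis
  proof
    fix z :: "real \<times> real"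
    show "relabel (egraphon n d w) (interval_exchange n \<pi>) z = egraphon n d (\<lambda>e. w (\<pi> ` e)) z"
    proof (cases "z \<in> unit_sq")
      case True
      then obtain x y where z: "z = (x, y)" "x \<in> {0..1}" "y \<in> {0..1}" by auto
      show ?thesis using interval_exchange_in[OF n \<pi> z(2)] interval_exchange_in[OF n \<pi> z(3)] z
        by (simp add: relabel_def egraphon_def ci inj[OF ci0 ci0] del: atLeastAtMost_iff)
    qed (auto simp: relabel_def egraphon_def)
  qed
qed

text \<open>After sorting, each colour class is an interval of vertices, so that a coarse grid can
  follow the colouring.\<close>

lemma sorting_permutation:
  fixes c :: "nat \<Rightarrow> nat"
  obtains \<pi> where "bij_betw \<pi> {1..n} {1..n}" "\<pi> 0 = 0"
    "\<And>i j. 1 \<le> i \<Longrightarrow> i \<le> j \<Longrightarrow> j \<le> n \<Longrightarrow> c (\<pi> i) \<le> c (\<pi> j)"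
proof -
  define xs where "xs = sort_key c [1..<Suc n]"
  have len: "length xs = n" by (simp add: xs_def)
  have set: "set xs = {1..n}" by (auto simp: xs_def)
  have dist: "distinct xs" by (simp add: xs_def)
  have sorted: "sorted (map c xs)" by (simp add: xs_def)
  define \<pi> where "\<pi> i = (if i = 0 then 0 else xs ! (i - 1))" for i
  have "bij_betw (\<lambda>i. xs ! i) {..<n} {1..n}" using bij_betw_nth[OF dist, of "{..<n}" "{1..n}"] len set by simp
  moreover have "bij_betw (\<lambda>i. i - 1) {1..n} {..<n}"
    by (rule bij_betwI[where g = Suc]) auto
  ultimately have "bij_betw ((\<lambda>i. xs ! i) \<circ> (\<lambda>i. i - 1)) {1..n} {1..n}" by (rule bij_betw_trans[rotated])
  then have "bij_betw \<pi> {1..n} {1..n}"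
    by (rule bij_betw_cong[THEN iffD1, rotated]) (auto simp: \<pi>_def)
  moreover have "c (\<pi> i) \<le> c (\<pi> j)" if "1 \<le> i" "i \<le> j" "j \<le> n" for i j
    using sorted_nth_mono[OF sorted, of "i - 1" "j - 1"] that len by (simp add: \<pi>_def)
  ultimately show ?thesis using that[of \<pi>] by (simp add: \<pi>_def)
qed

section \<open>Compactness\<close>

lemma sum_indicator_ge_1:
  "finite A \<Longrightarrow> a \<in> A \<Longrightarrow> z \<in> X a \<Longrightarrow> 1 \<le> (\<Sum>a\<in>A. indicator (X a) z :: real)"
  using member_le_sum[of a A "\<lambda>a. indicator (X a) z :: real"] by simp

text \<open>A monotone sequence of natural numbers climbs by at least 1 at each jump.\<close>

lemma card_jumps_le:
  fixes \<Gamma> :: "nat \<Rightarrow> nat"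
  assumes "\<And>I. I \<in> {1..N} \<Longrightarrow> \<Gamma> (I - 1) \<le> \<Gamma> I"
  shows "card {I \<in> {1..N}. \<Gamma> (I - 1) \<noteq> \<Gamma> I} \<le> \<Gamma> N"
  using assms
proof (induction N)
  case (Suc N)
  have IH: "card {I \<in> {1..N}. \<Gamma> (I - 1) \<noteq> \<Gamma> I} \<le> \<Gamma> N" using Suc by simp
  have le: "\<Gamma> N \<le> \<Gamma> (Suc N)" using Suc.prems[of "Suc N"] by simp
  have eq: "{I \<in> {1..Suc N}. \<Gamma> (I - 1) \<noteq> \<Gamma> I} = {I \<in> {1..N}. \<Gamma> (I - 1) \<noteq> \<Gamma> I} \<union> (if \<Gamma> N \<noteq> \<Gamma> (Suc N) then {Suc N} else {})"
    by (auto simp: le_Suc_eq)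
  have "card {I \<in> {1..Suc N}. \<Gamma> (I - 1) \<noteq> \<Gamma> I} \<le> card {I \<in> {1..N}. \<Gamma> (I - 1) \<noteq> \<Gamma> I} + card (if \<Gamma> N \<noteq> \<Gamma> (Suc N) then {Suc N} else {})"
    unfolding eq by (rule card_Un_le)
  then show ?case using IH le by (auto split: if_splits)
qed simp

lemma in_cell_index:
  assumes n: "n > 0" and "cell_index n x \<in> {1..n}"
  shows "x \<in> cell n (cell_index n x)"
proof -
  have "0 < cell_index n x" using assms(2) unfolding atLeastAtMost_iff by linarith
  from cell_index_iff[OF n this, of x] show ?thesis by (rule iffD1) (rule refl)
qed

text \<open>A sorted colouring of a fine grid is constant on all but \<open>k\<close> cells of the coarse grid, so that
  its step graphon can be rounded to one from a finite family.\<close>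

lemma sorted_step_approx:
  assumes n: "n > 0" and N: "N > 0" and L: "L > 0" and d: "0 \<le> d" "d \<le> 1"
    and \<beta>: "\<And>K. 0 \<le> \<beta> K \<and> \<beta> K \<le> 1" and \<gamma>k: "\<And>i. \<gamma> i < k"
    and mono: "\<And>i j. 1 \<le> i \<Longrightarrow> i \<le> j \<Longrightarrow> j \<le> n \<Longrightarrow> \<gamma> i \<le> (\<gamma> j :: nat)"
  obtains v where "v \<in> possible_edges N \<rightarrow>\<^sub>E (\<lambda>l. real l / real L) ` {0..L}"
    "l1_dist (egraphon n d (\<lambda>e. \<beta> (\<gamma> ` e))) (egraphon N d (\<lambda>e. if e \<in> possible_edges N then v e else 0))
       \<le> 1 / real L + 2 * real k / real N + 1 / real N + 1 / real n"
proof -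
  \<comment> \<open>The colour at the right end of the coarse cell \<open>I\<close>, with 0 as a
    lower bound at the left end of the grid. By monotonicity the colours over cell \<open>I\<close>
    lie between \<open>\<Gamma> (I - 1)\<close> and \<open>\<Gamma> I\<close>.\<close>
  define \<Gamma> where "\<Gamma> I = (if I = 0 then 0 else \<gamma> (cell_index n (real I / real N)))" for I
  define rnd where "rnd b = real (nat \<lfloor>real L * b\<rfloor>) / real L" for b
  have rnd: "\<bar>rnd b - b\<bar> \<le> 1 / real L" "nat \<lfloor>real L * b\<rfloor> \<le> L" if b: "0 \<le> b" "b \<le> 1" for b
  proof -
    have Lb: "0 \<le> real L * b" "real L * b \<le> real L" using b mult_left_mono[of b 1 "real L"] by auto
    have r: "real (nat \<lfloor>real L * b\<rfloor>) = real_of_int \<lfloor>real L * b\<rfloor>" using Lb by simp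
    have "\<bar>real_of_int \<lfloor>real L * b\<rfloor> - real L * b\<bar> \<le> 1" by linarith
    then have "\<bar>real_of_int \<lfloor>real L * b\<rfloor> - real L * b\<bar> / real L \<le> 1 / real L" by (intro divide_right_mono) auto
    moreover have "\<bar>real_of_int \<lfloor>real L * b\<rfloor> - real L * b\<bar> / real L = \<bar>real_of_int \<lfloor>real L * b\<rfloor> / real L - b\<bar>"
    proof -
      have "real_of_int \<lfloor>real L * b\<rfloor> / real L - b = (real_of_int \<lfloor>real L * b\<rfloor> - real L * b) / real L"
        using L by (simp add: field_simps)
      then show ?thesis by simp
    qed
    ultimately show "\<bar>rnd b - b\<bar> \<le> 1 / real L" unfolding rnd_def r by simp
    show "nat \<lfloor>real L * b\<rfloor> \<le> L" using Lb(2) by (simp add: nat_le_iff floor_le_iff)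
  qed
  define v where "v = (\<lambda>e\<in>possible_edges N. rnd (\<beta> (\<Gamma> ` e)))"
  have v: "v \<in> possible_edges N \<rightarrow>\<^sub>E (\<lambda>l. real l / real L) ` {0..L}"
    unfolding v_def
  proof (rule restrict_PiE_iff[THEN iffD2], rule ballI)
    fix e assume "e \<in> possible_edges N"
    show "rnd (\<beta> (\<Gamma> ` e)) \<in> (\<lambda>l. real l / real L) ` {0..L}"
      unfolding rnd_def using rnd(2)[of "\<beta> (\<Gamma> ` e)"] \<beta> by (intro imageI) auto
  qed
  have v01: "0 \<le> (if e \<in> possible_edges N then v e else 0) \<and> (if e \<in> possible_edges N then v e else 0) \<le> 1" for e
    using rnd(2)[of "\<beta> (\<Gamma> ` e)"] \<beta>[of "\<Gamma> ` e"] L by (auto simp: v_def rnd_def)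
  \<comment> \<open>The coarse cells over which the colour may change; over every other cell it is
    constantly \<open>\<Gamma> I\<close>.\<close>
  define Bd where "Bd = {I \<in> {1..N}. \<Gamma> (I - 1) \<noteq> \<Gamma> I}"
  have ci: "cell_index n (real I / real N) \<in> {1..n}" if "I \<in> {1..N}" for I
    using that n by (intro cell_index_in) auto
  have sand: "\<Gamma> (I - 1) \<le> \<gamma> (cell_index n x) \<and> \<gamma> (cell_index n x) \<le> \<Gamma> I"
    if I: "I \<in> {1..N}" and x: "x \<in> cell N I" for I x
  proof -
    have x01: "(real I - 1) / real N < x" "x \<le> real I / real N" using x by (auto simp: cell_def)
    have "x \<in> {0..1}" using x cell_subset[OF I] by blast
    moreover have "x \<noteq> 0" using x cell_zero[OF I] by blast
    ultimately have "0 < x" "x \<le> 1" by simp_all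
    then have cx: "cell_index n x \<in> {1..n}" by (intro cell_index_in n)
    have "cell_index n x \<le> cell_index n (real I / real N)"
      using x01 by (intro nat_mono ceiling_mono mult_left_mono) auto
    then have "\<gamma> (cell_index n x) \<le> \<Gamma> I"
      using mono[of "cell_index n x" "cell_index n (real I / real N)"] cx ci[OF I] I by (auto simp: \<Gamma>_def)
    moreover have "\<Gamma> (I - 1) \<le> \<gamma> (cell_index n x)"
    proof (cases "I = 1")
      case False
      then have I1: "I - 1 \<in> {1..N}" using I by auto
      have "real (I - 1) = real I - 1" using I by auto
      then have "cell_index n (real (I - 1) / real N) \<le> cell_index n x"
        using x01 by (intro nat_mono ceiling_mono mult_left_mono) auto
      then show ?thesis
        using mono[of "cell_index n (real (I - 1) / real N)" "cell_index n x"] cx ci[OF I1] I1 False by (auto simp: \<Gamma>_def)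
    qed (simp add: \<Gamma>_def)
    ultimately show ?thesis by simp
  qed
  have \<Gamma>mono: "\<Gamma> (I - 1) \<le> \<Gamma> I" if I: "I \<in> {1..N}" for I
  proof -
    have "real I / real N \<in> cell N I" using N by (simp add: cell_def field_simps)
    from sand[OF I this] show ?thesis by simp
  qed
  have "card Bd \<le> \<Gamma> N" unfolding Bd_def using \<Gamma>mono by (rule card_jumps_le)
  also have "\<Gamma> N \<le> k" using \<gamma>k N by (simp add: \<Gamma>_def less_imp_le)
  finally have Bdk: "card Bd \<le> k" .
  have Bd: "finite Bd" "Bd \<subseteq> {1..N}" by (auto simp: Bd_def)
  let ?f = "egraphon n d (\<lambda>e. \<beta> (\<gamma> ` e))" and ?g = "egraphon N d (\<lambda>e. if e \<in> possible_edges N then v e else 0)"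
  have G: "?f \<in> graphons" "?g \<in> graphons" using d \<beta> v01 by (auto intro!: egraphon_graphon)
  \<comment> \<open>A pointwise bound for the difference: the rounding error, then rows and columns
    of bad cells, then the two diagonals, where the step graphons do not follow the block
    values.\<close>
  define b where "b z = 1 / real L + (\<Sum>I\<in>Bd. indicator (cell N I \<times> {0..1}) z) + (\<Sum>I\<in>Bd. indicator ({0..1} \<times> cell N I) z)
     + (\<Sum>I\<in>{1..N}. indicator (cell N I \<times> cell N I) z) + (\<Sum>i\<in>{1..n}. indicator (cell n i \<times> cell n i) z)" for z :: "real \<times> real"
  have u: "{0..1} \<in> sets unit_leb" by (simp add: sets_unit_leb_iff)
  have ind: "integrable sqm (indicator (A \<times> B) :: _ \<Rightarrow> real)" "(\<integral>z. indicator (A \<times> B) z \<partial>sqm) = measure unit_leb A * measure unit_leb B"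
    if "A \<in> sets unit_leb" "B \<in> sets unit_leb" for A B
    using rect_sets[OF that] measure_rect[OF that] sets.Int_space_eq2[OF rect_sets[OF that]]
    by (simp_all add: sqm.emeasure_finite less_top[symmetric])
  have u1: "measure unit_leb {0..1} = 1" using unit_leb.prob_space by simp
  have cellI: "I \<in> Bd \<Longrightarrow> I \<in> {1..N}" for I using Bd by auto
  have s1: "integrable sqm (\<lambda>z. \<Sum>I\<in>Bd. indicator (cell N I \<times> {0..1}) z :: real)"
     "(\<integral>z. (\<Sum>I\<in>Bd. indicator (cell N I \<times> {0..1}) z) \<partial>sqm) = card Bd / real N"
    using ind[OF cell_sets[OF cellI] u] u1 measure_cell[OF cellI] by (simp_all add: Bochner_Integration.integral_sum)
  have s2: "integrable sqm (\<lambda>z. \<Sum>I\<in>Bd. indicator ({0..1} \<times> cell N I) z :: real)"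
     "(\<integral>z. (\<Sum>I\<in>Bd. indicator ({0..1} \<times> cell N I) z) \<partial>sqm) = card Bd / real N"
    using ind[OF u cell_sets[OF cellI]] u1 measure_cell[OF cellI] by (simp_all add: Bochner_Integration.integral_sum)
  have s3: "integrable sqm (\<lambda>z. \<Sum>I\<in>{1..M}. indicator (cell M I \<times> cell M I) z :: real)"
     "(\<integral>z. (\<Sum>I\<in>{1..M}. indicator (cell M I \<times> cell M I) z) \<partial>sqm) = 1 / real M" if "M > 0" for M
  proof -
    have i: "integrable sqm (\<lambda>z. indicator (cell M I \<times> cell M I) z :: real)"
      "(\<integral>z. indicator (cell M I \<times> cell M I) z \<partial>sqm) = 1 / real M * (1 / real M)" if "I \<in> {1..M}" for I
      using ind[OF cell_sets[OF that] cell_sets[OF that]] measure_cell[OF that] by simp_all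
    show "integrable sqm (\<lambda>z. \<Sum>I\<in>{1..M}. indicator (cell M I \<times> cell M I) z :: real)"
      using i by (intro Bochner_Integration.integrable_sum) auto
    have "(\<integral>z. (\<Sum>I\<in>{1..M}. indicator (cell M I \<times> cell M I) z) \<partial>sqm) = (\<Sum>I\<in>{1..M}. 1 / real M * (1 / real M))"
      using i by (subst Bochner_Integration.integral_sum) auto
    then show "(\<integral>z. (\<Sum>I\<in>{1..M}. indicator (cell M I \<times> cell M I) z) \<partial>sqm) = 1 / real M"
      using that by simp
  qed
  have bI: "integrable sqm b" "integral\<^sup>L sqm b = 1 / real L + card Bd / real N + card Bd / real N + 1 / real N + 1 / real n"
    unfolding b_def[abs_def] using s1 s2 s3[OF N] s3[OF n] sqm.prob_space by simp_all
  have "l1_dist ?f ?g \<le> integral\<^sup>L sqm b"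
    unfolding l1_dist_def
  proof (rule integral_mono_AE)
    show "integrable sqm (\<lambda>z. \<bar>?f z - ?g z\<bar>)"
      by (rule graphon_diff_integrable[OF G])
    show "AE z in sqm. \<bar>?f z - ?g z\<bar> \<le> b z"
      using AE_sqm_pos AE_space
    proof eventually_elim
      case (elim z)
      obtain x y where z: "z = (x, y)" by (cases z)
      have x: "0 < x" "x \<le> 1" and y: "0 < y" "y \<le> 1" using elim z by auto
      define I J i j where "I = cell_index N x" and "J = cell_index N y" and "i = cell_index n x" and "j = cell_index n y"
      have IJ: "I \<in> {1..N}" "J \<in> {1..N}" and ij: "i \<in> {1..n}" "j \<in> {1..n}"
        unfolding I_def J_def i_def j_def by (rule cell_index_in[OF N x] cell_index_in[OF N y] cell_index_in[OF n x] cell_index_in[OF n y])+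
      have xc: "x \<in> cell N I" "y \<in> cell N J" "x \<in> cell n i" "y \<in> cell n j"
        using IJ ij in_cell_index[OF N, of x] in_cell_index[OF N, of y] in_cell_index[OF n, of x] in_cell_index[OF n, of y]
        unfolding I_def J_def i_def j_def by blast+
      have d1: "\<bar>?f z - ?g z\<bar> \<le> 1" using graphon_diff_le[OF G, of z] elim by simp
      have nn: "0 \<le> (\<Sum>I\<in>Bd. indicator (cell N I \<times> {0..1}) z :: real)" "0 \<le> (\<Sum>I\<in>Bd. indicator ({0..1} \<times> cell N I) z :: real)"
        "0 \<le> (\<Sum>I\<in>{1..N}. indicator (cell N I \<times> cell N I) z :: real)" "0 \<le> (\<Sum>i\<in>{1..n}. indicator (cell n i \<times> cell n i) z :: real)"
        "0 \<le> 1 / real L"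
        by (simp_all add: sum_nonneg)
      consider "I \<in> Bd" | "J \<in> Bd" | "I = J" | "i = j" | "I \<notin> Bd" "J \<notin> Bd" "I \<noteq> J" "i \<noteq> j" by blast
      then show ?case
      proof cases
        case 1
        have "1 \<le> (\<Sum>I\<in>Bd. indicator (cell N I \<times> {0..1}) z :: real)"
          by (rule sum_indicator_ge_1[OF Bd(1) 1]) (use xc y z in auto)
        then show ?thesis unfolding b_def using d1 nn by linarith
      next
        case 2
        have "1 \<le> (\<Sum>I\<in>Bd. indicator ({0..1} \<times> cell N I) z :: real)"
          by (rule sum_indicator_ge_1[OF Bd(1) 2]) (use xc x z in auto)
        then show ?thesis unfolding b_def using d1 nn by linarith
      next
        case 3
        have "1 \<le> (\<Sum>I\<in>{1..N}. indicator (cell N I \<times> cell N I) z :: real)"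
          by (rule sum_indicator_ge_1[OF _ IJ(1)]) (use xc 3 z in auto)
        then show ?thesis unfolding b_def using d1 nn by linarith
      next
        case 4
        have "1 \<le> (\<Sum>i\<in>{1..n}. indicator (cell n i \<times> cell n i) z :: real)"
          by (rule sum_indicator_ge_1[OF _ ij(1)]) (use xc 4 z in auto)
        then show ?thesis unfolding b_def using d1 nn by linarith
      next
        case 5
        have "\<Gamma> (I - 1) = \<Gamma> I" "\<Gamma> (J - 1) = \<Gamma> J" using 5 IJ by (auto simp: Bd_def)
        then have \<gamma>\<Gamma>: "\<gamma> i = \<Gamma> I" "\<gamma> j = \<Gamma> J"
          using sand[OF IJ(1) xc(1)] sand[OF IJ(2) xc(2)] by (auto simp: i_def j_def)
        have "?f z = \<beta> {\<gamma> i, \<gamma> j}"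
          using egraphon_on_cell[OF n ij, of z] xc z 5 by (simp add: edge_value_def)
        moreover have "?g z = rnd (\<beta> {\<Gamma> I, \<Gamma> J})"
          using egraphon_on_cell[OF N IJ, of z] xc z 5 pair_possible_edge[OF IJ 5(3)] by (simp add: edge_value_def v_def)
        ultimately have "\<bar>?f z - ?g z\<bar> \<le> 1 / real L"
          using rnd(1)[of "\<beta> {\<Gamma> I, \<Gamma> J}"] \<beta> \<gamma>\<Gamma> by (simp add: abs_minus_commute)
        then show ?thesis unfolding b_def using nn by linarith
      qed
    qed
  qed (rule bI)
  also have "\<dots> \<le> 1 / real L + 2 * real k / real N + 1 / real N + 1 / real n"
  proof -
    have "real (card Bd) / real N \<le> real k / real N" using Bdk by (intro divide_right_mono) auto
    then show ?thesis unfolding bI(2) by simp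
  qed
  finally show ?thesis using that v by blast
qed

text \<open>The grid size \<open>n\<close> and the colouring depend on \<open>f\<close>, but
  \<open>k\<close>, \<open>L\<close> and \<open>N\<close> do not, so rounding after sorting lands in
  one finite family. Sorting is a relabelling and costs nothing in the quotient.\<close>

lemma graphons_totally_bounded:
  assumes \<epsilon>: "\<epsilon> > 0"
  obtains K where "finite K" "K \<subseteq> graphons" "\<And>f. f \<in> graphons \<Longrightarrow> \<exists>g\<in>K. orbit_dist f g < \<epsilon>"
proof -
  \<comment> \<open>The diagonal value is free here; 1/2 takes the place of
    \<open>p\<close>.\<close>
  define d :: real where "d = 1/2"
  have d: "0 < d" "d < 1" by (simp_all add: d_def)
  \<comment> \<open>The losses are \<open>\<eta>\<close> for averaging, \<open>2 * \<eta>\<close>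
    for block means and the diagonal, and \<open>3 * \<eta>\<close> for the finite family, where
    \<open>L\<close>, \<open>N\<close> and \<open>n\<close> each account for one
    \<open>\<eta>\<close>.\<close>
  define \<eta> where "\<eta> = \<epsilon> / 8"
  have \<eta>: "\<eta> > 0" using \<epsilon> by (simp add: \<eta>_def)
  obtain k where k: "k > 0" "\<And>n w. \<forall>e. 0 \<le> w e \<and> w e \<le> 1 \<Longrightarrow>
    \<exists>c. (\<forall>i. c i < k) \<and> (\<forall>S\<subseteq>{1..n}. \<forall>T\<subseteq>{1..n}.
      \<bar>\<Sum>e\<in>possible_edges n. incidence S T e * (w e - colour_mean n c w (c ` e))\<bar> \<le> \<eta> * (real n)\<^sup>2)"
    by (rule weak_regularity[OF \<eta>]) blast
  obtain L :: nat where L: "L > 0" "1 / real L < \<eta>" using \<eta> nat_approx_posE[OF \<eta>] by (metis zero_less_Suc)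
  obtain N :: nat where N: "N > 0" "(2 * real k + 1) / real N < \<eta>"
  proof -
    obtain N :: nat where N: "(2 * real k + 1) / \<eta> < real N" using reals_Archimedean2 by blast
    moreover have "0 < (2 * real k + 1) / \<eta>" using \<eta> by simp
    ultimately have "N > 0" by (metis less_trans of_nat_0_less_iff)
    with N \<eta> show ?thesis using that[of N] by (simp add: field_simps)
  qed
  define ext where "ext v e = (if e \<in> possible_edges N then v e else 0 :: real)" for v :: "nat set \<Rightarrow> real" and e
  define V where "V = (possible_edges N \<rightarrow>\<^sub>E (\<lambda>l. real l / real L) ` {0..L})"
  have ext01: "0 \<le> ext v e \<and> ext v e \<le> 1" if "v \<in> V" for v e
  proof (cases "e \<in> possible_edges N")
    case True
    then have "v e \<in> (\<lambda>l. real l / real L) ` {0..L}"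
      using that unfolding V_def by (rule PiE_mem[rotated])
    then obtain l where "l \<le> L" "v e = real l / real L" by auto
    then show ?thesis using True L by (simp add: ext_def)
  qed (simp add: ext_def)
  show ?thesis
  proof (rule that[of "(\<lambda>v. egraphon N d (ext v)) ` V"])
    show "finite ((\<lambda>v. egraphon N d (ext v)) ` V)" unfolding V_def by (intro finite_imageI finite_PiE) auto
    show "(\<lambda>v. egraphon N d (ext v)) ` V \<subseteq> graphons" using ext01 d by (auto intro!: egraphon_graphon)
    fix f assume f: "f \<in> graphons"
    have "eventually (\<lambda>n::nat. l1_dist f (egraphon n d (avg_weight n f)) < \<eta> \<and> 1 / real n < \<eta> \<and> n > 0) sequentially"
      using \<eta> by (intro eventually_conj l1_dist_avg d f order_tendstoD(2)[OF lim_const_over_n] eventually_gt_at_top) auto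
    then obtain n where n: "l1_dist f (egraphon n d (avg_weight n f)) < \<eta>" "1 / real n < \<eta>" "n > 0"
      by (auto simp: eventually_sequentially)
    define w where "w = avg_weight n f"
    have w: "0 \<le> w e \<and> w e \<le> 1" for e unfolding w_def by (rule avg_weight_01[OF f])
    from k(2)[OF allI[OF w], of n] obtain c where c0: "(\<forall>i. c i < k) \<and> (\<forall>S\<subseteq>{1..n}. \<forall>T\<subseteq>{1..n}.
      \<bar>\<Sum>e\<in>possible_edges n. incidence S T e * (w e - colour_mean n c w (c ` e))\<bar> \<le> \<eta> * (real n)\<^sup>2)"
      by (rule exE)
    have c: "\<And>i. c i < k" "\<And>S T. S \<subseteq> {1..n} \<Longrightarrow> T \<subseteq> {1..n} \<Longrightarrow>
      \<bar>\<Sum>e\<in>possible_edges n. incidence S T e * (w e - colour_mean n c w (c ` e))\<bar> \<le> \<eta> * (real n)\<^sup>2"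
      using c0 by simp_all
    define \<beta> where "\<beta> = colour_mean n c w"
    have \<beta>: "0 \<le> \<beta> K \<and> \<beta> K \<le> 1" for K unfolding \<beta>_def by (rule block_mean_01) (use w in auto)
    obtain \<pi> where \<pi>: "bij_betw \<pi> {1..n} {1..n}" "\<pi> 0 = 0"
      "\<And>i j. 1 \<le> i \<Longrightarrow> i \<le> j \<Longrightarrow> j \<le> n \<Longrightarrow> c (\<pi> i) \<le> c (\<pi> j)"
      using sorting_permutation[of n c] by metis
    define \<sigma> where "\<sigma> = interval_exchange n \<pi>"
    have \<sigma>: "\<sigma> \<in> mp_bijections" unfolding \<sigma>_def by (rule interval_exchange_mp[OF n(3) \<pi>(1)])
    let ?A = "egraphon n d w" and ?B = "egraphon n d (\<lambda>e. \<beta> (c ` e))"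
    have G: "?A \<in> graphons" "?B \<in> graphons" using w \<beta> d by (auto intro!: egraphon_graphon)
    have rB: "relabel ?B \<sigma> = egraphon n d (\<lambda>e. \<beta> ((c \<circ> \<pi>) ` e))"
      unfolding \<sigma>_def relabel_egraphon[OF n(3) \<pi>(1,2)] by (simp add: image_image o_def)
    obtain v where v: "v \<in> V" "l1_dist (relabel ?B \<sigma>) (egraphon N d (ext v)) \<le> 1 / real L + 2 * real k / real N + 1 / real N + 1 / real n"
      using sorted_step_approx[OF n(3) N(1) L(1), of d \<beta> "c \<circ> \<pi>" k] d \<beta> c(1) \<pi>(3) unfolding rB V_def ext_def by auto
    let ?g = "egraphon N d (ext v)"
    have g: "?g \<in> graphons" using ext01[OF v(1)] d by (auto intro!: egraphon_graphon)
    have rG: "relabel ?B \<sigma> \<in> graphons" using \<sigma> G by auto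
    have 1: "orbit_dist f ?A < \<eta>"
      using orbit_dist_le_cut_dist[OF f G(1)] cut_dist_le_l1_dist[OF f G(1)] n(1) by (simp add: w_def)
    have "cut_dist ?A ?B \<le> \<eta> + 1 / real n"
      by (rule cut_dist_egraphon_le) (use n d w \<beta> c in \<open>auto simp: \<beta>_def\<close>)
    then have 2: "orbit_dist ?A ?B < 2 * \<eta>" using orbit_dist_le_cut_dist[OF G] n(2) by simp
    have 3: "orbit_dist ?B (relabel ?B \<sigma>) = 0" by (rule orbit_dist_relabel_self[OF G(2) \<sigma>])
    have "(2 * real k + 1) / real N = 2 * real k / real N + 1 / real N" by (simp add: add_divide_distrib)
    then have 4: "orbit_dist (relabel ?B \<sigma>) ?g < 3 * \<eta>"
      using orbit_dist_le_cut_dist[OF rG g] cut_dist_le_l1_dist[OF rG g] v(2) L(2) N(2) n(2) by linarith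
    have "orbit_dist f ?g \<le> orbit_dist f ?A + (orbit_dist ?A ?B + (orbit_dist ?B (relabel ?B \<sigma>) + orbit_dist (relabel ?B \<sigma>) ?g))"
      using orbit_dist_triangle[OF f G(1) g] orbit_dist_triangle[OF G g] orbit_dist_triangle[OF G(2) rG g] by linarith
    also have "\<dots> < \<epsilon>" using 1 2 3 4 \<eta> by (simp add: \<eta>_def)
    finally show "\<exists>g\<in>(\<lambda>v. egraphon N d (ext v)) ` V. orbit_dist f g < \<epsilon>" using v(1) by blast
  qed
qed

lemma compact_space_graphon: "compact_space graphon.mtopology"
  unfolding graphon.compact_space_eq_mcomplete_mtotally_bounded
proof
  show "graphon.mcomplete" by (rule mcomplete_graphon_space)
  show "graphon.mtotally_bounded graphon_space"
    unfolding graphon.mtotally_bounded_def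
  proof (intro allI impI)
    fix e :: real assume "e > 0"
    then obtain K where K: "finite K" "K \<subseteq> graphons" "\<And>f. f \<in> graphons \<Longrightarrow> \<exists>g\<in>K. orbit_dist f g < e"
      using graphons_totally_bounded by blast
    show "\<exists>K. finite K \<and> K \<subseteq> graphon_space \<and> graphon_space \<subseteq> (\<Union>x\<in>K. graphon.mball x e)"
    proof (intro exI conjI subsetI)
      show "finite (graphon_class ` K)" using K by simp
      show "A \<in> graphon_class ` K \<Longrightarrow> A \<in> graphon_space" for A using K by auto
      fix A assume "A \<in> graphon_space"
      then obtain f where f: "f \<in> graphons" "A = graphon_class f" by (auto simp: graphon_space_def)
      then obtain g where g: "g \<in> K" "orbit_dist f g < e" using K by blast
      then have "g \<in> graphons" using K by auto
      then have "delta_cut (graphon_class g) A < e"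
        using g f by (simp add: delta_cut_class orbit_dist_commute)
      then have "A \<in> graphon.mball (graphon_class g) e"
        using f \<open>g \<in> graphons\<close> by (auto simp: graphon.in_mball)
      then show "A \<in> (\<Union>x\<in>graphon_class ` K. graphon.mball x e)" using g by blast
    qed
  qed
qed

section \<open>Inhomogeneous random graphs\<close>

definition edge_pmf :: "nat \<Rightarrow> (nat set \<Rightarrow> real) \<Rightarrow> (nat set \<Rightarrow> bool) pmf" where
  "edge_pmf n q = Pi_pmf (possible_edges n) False (\<lambda>e. bernoulli_pmf (q e))"

definition edge_space :: "nat \<Rightarrow> (nat set \<Rightarrow> bool) set" where
  "edge_space n = PiE_dflt (possible_edges n) False (\<lambda>_. UNIV)"

lemma finite_edge_space [simp]: "finite (edge_space n)"
  unfolding edge_space_def by (intro finite_PiE_dflt) auto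

lemma set_edge_pmf: "set_pmf (edge_pmf n q) \<subseteq> edge_space n"
  using set_Pi_pmf_subset'[OF finite_possible_edges, of n False] unfolding edge_pmf_def edge_space_def
  by (fastforce simp: PiE_dflt_def)

lemma pmf_edge_pmf:
  "b \<in> edge_space n \<Longrightarrow> pmf (edge_pmf n q) b = (\<Prod>e\<in>possible_edges n. pmf (bernoulli_pmf (q e)) (b e))"
  unfolding edge_pmf_def edge_space_def by (intro pmf_Pi') (auto simp: PiE_dflt_def)

lemma prob_edge_pmf: "measure_pmf.prob (edge_pmf n q) A = (\<Sum>b\<in>A \<inter> edge_space n. pmf (edge_pmf n q) b)"
proof -
  have "measure_pmf.prob (edge_pmf n q) A = measure_pmf.prob (edge_pmf n q) (A \<inter> edge_space n)"
    using set_edge_pmf[of n q] by (intro measure_pmf.finite_measure_eq_AE) (auto simp: AE_measure_pmf_iff)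
  also have "\<dots> = (\<Sum>b\<in>A \<inter> edge_space n. pmf (edge_pmf n q) b)"
    by (intro measure_measure_pmf_finite) auto
  finally show ?thesis .
qed

lemma sum_edge_pmf: "A \<subseteq> edge_space n \<Longrightarrow> (\<Sum>b\<in>A. pmf (edge_pmf n q) b) \<le> 1"
  using prob_edge_pmf[of n q A] measure_pmf.prob_le_1[of "edge_pmf n q" A] by (simp add: Int_absorb2)

definition random_graphon :: "nat \<Rightarrow> (nat set \<Rightarrow> bool) \<Rightarrow> real \<times> real \<Rightarrow> real" where
  "random_graphon n b = egraphon n 0 (\<lambda>e. if e \<in> possible_edges n \<and> b e then 1 else 0)"

lemma random_graphon_graphon [intro]: "random_graphon n b \<in> graphons"
  unfolding random_graphon_def by (rule egraphon_graphon) auto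

lemma gnp_eq: "gnp n p = map_pmf (\<lambda>b. graphon_class (random_graphon n b)) (edge_pmf n (\<lambda>_. p))"
proof -
  have "graph_graphon n {e \<in> possible_edges n. b e} = random_graphon n b" for b
    by (subst graph_graphon_eq) (auto simp: random_graphon_def)
  then show ?thesis unfolding gnp_def gnp_edges_def edge_pmf_def by (simp add: pmf.map_comp o_def)
qed

lemma pmf_bernoulli_pos: "0 < p \<Longrightarrow> p < 1 \<Longrightarrow> pmf (bernoulli_pmf p) c > 0"
  by (cases c) auto

section \<open>The upper bound\<close>

text \<open>For \<open>m = 0\<close> both sides are 1 even if \<open>q = 0\<close>. This case occurs
  for blocks without edges and, with \<open>1 - q\<close>, for complete blocks.\<close>

lemma power_mult_exp_log_ratio:
  assumes "0 < p" "0 \<le> q" "m > 0 \<Longrightarrow> q > 0"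
  shows "q ^ m * exp (- (real m * ln (q / p))) = p ^ m"
proof (cases "m = 0")
  case False
  then have q: "q > 0" using assms by simp
  have "exp (- (real m * ln (q / p))) = exp (real m * ln (p / q))"
    using q assms by (simp add: ln_div algebra_simps)
  also have "\<dots> = (p / q) ^ m" using q assms by (simp add: exp_of_nat_mult)
  finally show ?thesis using q by (simp add: power_divide)
qed simp

lemma prod_bernoulli:
  assumes "finite F" "0 \<le> q" "q \<le> 1"
  shows "(\<Prod>e\<in>F. pmf (bernoulli_pmf q) (b e)) = q ^ card {e \<in> F. b e} * (1 - q) ^ (card F - card {e \<in> F. b e})"
proof -
  have "(\<Prod>e\<in>F. pmf (bernoulli_pmf q) (b e)) = (\<Prod>e\<in>F. if b e then q else 1 - q)"
    using assms by (intro prod.cong refl) auto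
  also have "\<dots> = q ^ card {e \<in> F. b e} * (1 - q) ^ card (F \<inter> - {e. b e})"
    using assms(1) by (subst prod.If_cases) (auto simp: Int_def)
  also have "card (F \<inter> - {e. b e}) = card F - card {e \<in> F. b e}"
  proof -
    have "F \<inter> - {e. b e} = F - {e \<in> F. b e}" by auto
    then show ?thesis using assms(1) by (simp add: card_Diff_subset)
  qed
  finally show ?thesis .
qed

text \<open>The likelihood ratio of a configuration against the product measure with its own block densities
  is determined by these densities.\<close>

lemma block_likelihood:
  fixes b :: "'a \<Rightarrow> bool" and \<kappa> :: "'a \<Rightarrow> 'k"
  assumes p: "0 < p" "p < 1" and fin: "finite X"
  defines "q \<equiv> \<lambda>e. block_mean X \<kappa> (\<lambda>e. of_bool (b e)) (\<kappa> e)"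
  shows "(\<Prod>e\<in>X. pmf (bernoulli_pmf p) (b e)) =
    (\<Prod>e\<in>X. pmf (bernoulli_pmf (q e)) (b e)) * exp (- (\<Sum>e\<in>X. 2 * rate p (q e)))"
proof -
  have "(\<Prod>e\<in>X. pmf (bernoulli_pmf p) (b e)) = (\<Prod>k\<in>\<kappa> ` X. \<Prod>e\<in>{e \<in> X. \<kappa> e = k}. pmf (bernoulli_pmf p) (b e))"
    using fin by (intro prod.group[symmetric]) auto
  also have "\<dots> = (\<Prod>k\<in>\<kappa> ` X. \<Prod>e\<in>{e \<in> X. \<kappa> e = k}. pmf (bernoulli_pmf (q e)) (b e) * exp (- (2 * rate p (q e))))"
  proof (rule prod.cong[OF refl])
    fix k assume "k \<in> \<kappa> ` X"
    let ?F = "{e \<in> X. \<kappa> e = k}"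
    define N m where "N = card ?F" and "m = card {e \<in> ?F. b e}"
    have F: "finite ?F" using fin by simp
    have N: "N > 0" unfolding N_def using \<open>k \<in> \<kappa> ` X\<close> F by (auto simp: card_gt_0_iff)
    have mN: "m \<le> N" unfolding m_def N_def using F by (intro card_mono) auto
    \<comment> \<open>With the density \<open>r = m / N\<close> both exponents are multiples of
      \<open>N\<close>, namely \<open>m = N * r\<close> and \<open>N - m = N * (1 - r)\<close>, and
      so they add up to \<open>N * (2 * rate p r)\<close>.\<close>
    define r where "r = real m / real N"
    have r: "0 \<le> r" "r \<le> 1" using mN N by (auto simp: r_def)
    have "(\<Sum>e\<in>?F. of_bool (b e)) = real m" using F by (simp add: m_def Int_def)
    then have qr: "q e = r" if "e \<in> ?F" for e
      using that unfolding q_def block_mean_def r_def N_def by simp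
    have Nm: "real (N - m) = real N - real m" using mN by simp
    have 1: "r ^ m * exp (- (real m * ln (r / p))) = p ^ m"
      by (rule power_mult_exp_log_ratio) (use p r N in \<open>auto simp: r_def\<close>)
    have 2: "(1 - r) ^ (N - m) * exp (- (real (N - m) * ln ((1 - r) / (1 - p)))) = (1 - p) ^ (N - m)"
      by (rule power_mult_exp_log_ratio) (use p r N in \<open>auto simp: r_def field_simps\<close>)
    have e: "real N * r = real m" "real N * (1 - r) = real (N - m)" using N Nm by (simp_all add: r_def field_simps)
    have "real m * ln (r / p) + real (N - m) * ln ((1 - r) / (1 - p)) = real N * (2 * rate p r)"
    proof -
      have "2 * rate p r = r * ln (r / p) + (1 - r) * ln ((1 - r) / (1 - p))"
        by (simp add: rate_def distrib_left)
      then have "real N * (2 * rate p r) = (real N * r) * ln (r / p) + (real N * (1 - r)) * ln ((1 - r) / (1 - p))"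
        by (simp only: distrib_left mult.assoc)
      then show ?thesis unfolding e by simp
    qed
    then have ee: "exp (- (real N * (2 * rate p r))) = exp (- (real m * ln (r / p))) * exp (- (real (N - m) * ln ((1 - r) / (1 - p))))"
      by (simp add: exp_add[symmetric])
    have "(\<Prod>e\<in>?F. pmf (bernoulli_pmf (q e)) (b e) * exp (- (2 * rate p (q e)))) =
        (\<Prod>e\<in>?F. pmf (bernoulli_pmf r) (b e)) * (\<Prod>e\<in>?F. exp (- (2 * rate p r)))"
      unfolding prod.distrib[symmetric] using qr by (intro prod.cong refl) simp
    also have "(\<Prod>e\<in>?F. exp (- (2 * rate p r))) = exp (- (real N * (2 * rate p r)))"
      by (simp add: N_def exp_of_nat_mult[symmetric])
    also have "(\<Prod>e\<in>?F. pmf (bernoulli_pmf r) (b e)) = r ^ m * (1 - r) ^ (N - m)"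
      using prod_bernoulli[OF F r, of b] by (simp add: m_def N_def)
    also have "r ^ m * (1 - r) ^ (N - m) * exp (- (real N * (2 * rate p r))) = p ^ m * (1 - p) ^ (N - m)"
      unfolding ee 1[symmetric] 2[symmetric] by (simp add: mult_ac)
    also have "\<dots> = (\<Prod>e\<in>?F. pmf (bernoulli_pmf p) (b e))"
      using prod_bernoulli[OF F, of p b] p by (simp add: m_def N_def)
    finally show "(\<Prod>e\<in>?F. pmf (bernoulli_pmf p) (b e)) = (\<Prod>e\<in>?F. pmf (bernoulli_pmf (q e)) (b e) * exp (- (2 * rate p (q e))))" ..
  qed
  also have "\<dots> = (\<Prod>e\<in>X. pmf (bernoulli_pmf (q e)) (b e) * exp (- (2 * rate p (q e))))"
    using fin by (intro prod.group) auto
  also have "\<dots> = (\<Prod>e\<in>X. pmf (bernoulli_pmf (q e)) (b e)) * exp (- (\<Sum>e\<in>X. 2 * rate p (q e)))"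
    by (simp add: prod.distrib exp_sum[OF fin, symmetric] sum_negf)
  finally show ?thesis .
qed

text \<open>\<open>A\<close> is split by the candidate law assigned to each configuration. On its
  part every candidate has total mass at most 1, whatever the size of the part.\<close>

lemma prob_le_card_change_of_measure:
  assumes Q: "finite Q" and A: "A \<subseteq> edge_space n"
    and \<theta>: "\<And>b. b \<in> A \<Longrightarrow> \<theta> b \<in> Q \<and> pmf (edge_pmf n q0) b \<le> pmf (edge_pmf n (\<theta> b)) b * x"
    and x: "x \<ge> 0"
  shows "(\<Sum>b\<in>A. pmf (edge_pmf n q0) b) \<le> real (card Q) * x"
proof -
  have fin: "finite A" using A finite_edge_space finite_subset by blast
  have "(\<Sum>b\<in>A. pmf (edge_pmf n q0) b) \<le> (\<Sum>b\<in>A. pmf (edge_pmf n (\<theta> b)) b * x)"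
    using \<theta> by (intro sum_mono) auto
  also have "\<dots> = (\<Sum>q\<in>Q. \<Sum>b\<in>{b \<in> A. \<theta> b = q}. pmf (edge_pmf n (\<theta> b)) b * x)"
    using \<theta> fin Q by (intro sum.group[symmetric]) auto
  also have "\<dots> \<le> (\<Sum>q\<in>Q. x)"
  proof (rule sum_mono)
    fix q
    have "(\<Sum>b\<in>{b \<in> A. \<theta> b = q}. pmf (edge_pmf n (\<theta> b)) b * x) = (\<Sum>b\<in>{b \<in> A. \<theta> b = q}. pmf (edge_pmf n q) b) * x"
      unfolding sum_distrib_right by (intro sum.cong) auto
    also have "\<dots> \<le> 1 * x" using A x by (intro mult_right_mono sum_edge_pmf) auto
    finally show "(\<Sum>b\<in>{b \<in> A. \<theta> b = q}. pmf (edge_pmf n (\<theta> b)) b * x) \<le> x" by simp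
  qed
  finally show ?thesis by simp
qed

text \<open>A block density is stored as its number of edges, an integer, so that finitely many
  \<open>M\<close> describe all graphs.\<close>

definition block_weight :: "nat \<Rightarrow> (nat \<Rightarrow> nat) \<Rightarrow> (nat set \<Rightarrow> nat) \<Rightarrow> nat set \<Rightarrow> real" where
  "block_weight n c M e = real (M (c ` e)) / real (card {e' \<in> possible_edges n. c ` e' = c ` e})"

text \<open>Candidate laws are indexed by a colouring and by one count for each set of colours,
  which gives the two counting factors. Under the law built from its own block densities a
  configuration in \<open>A\<close> is more likely by a factor of at least
  \<open>exp s\<close>.\<close>

lemma upper_bound_finite:
  assumes p: "0 < p" "p < 1" and n: "n > 0" and A: "A \<subseteq> edge_space n"
    and c: "\<And>b. b \<in> A \<Longrightarrow> \<exists>c. (\<forall>i. c i < k) \<and>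
      s \<le> (\<Sum>e\<in>possible_edges n. 2 * rate p (colour_mean n c (\<lambda>e. of_bool (b e)) (c ` e)))"
  shows "measure_pmf.prob (edge_pmf n (\<lambda>_. p)) A \<le> real k ^ n * ((real n)\<^sup>2 + 1) ^ (2 ^ k) * exp (- s)"
proof -
  define Q where "Q = (\<lambda>(c, M). block_weight n c M) ` (({1..n} \<rightarrow>\<^sub>E {..<k}) \<times> (Pow {..<k} \<rightarrow>\<^sub>E {0..n\<^sup>2}))"
  have Q: "finite Q" unfolding Q_def by (intro finite_imageI finite_cartesian_product finite_PiE) auto
  have "card Q \<le> card (({1..n} \<rightarrow>\<^sub>E {..<k}) \<times> (Pow {..<k} \<rightarrow>\<^sub>E {0..n\<^sup>2}))"
    unfolding Q_def by (intro card_image_le finite_cartesian_product finite_PiE) auto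
  also have "\<dots> = k ^ n * (n\<^sup>2 + 1) ^ (2 ^ k)" by (simp add: card_cartesian_product card_PiE card_Pow)
  finally have "real (card Q) \<le> real (k ^ n * (n\<^sup>2 + 1) ^ (2 ^ k))" by (rule of_nat_mono)
  then have cQ: "real (card Q) \<le> real k ^ n * ((real n)\<^sup>2 + 1) ^ (2 ^ k)" by (simp add: add.commute)
  have "\<exists>q\<in>Q. pmf (edge_pmf n (\<lambda>_. p)) b \<le> pmf (edge_pmf n q) b * exp (- s)" if b: "b \<in> A" for b
  proof -
    obtain c where c: "\<And>i. c i < k" "s \<le> (\<Sum>e\<in>possible_edges n. 2 * rate p (colour_mean n c (\<lambda>e. of_bool (b e)) (c ` e)))"
      using c[OF b] by blast
    \<comment> \<open>Only the colours of the \<open>n\<close> vertices matter; the restriction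
      belongs to a finite function space.\<close>
    define c' where "c' = restrict c {1..n}"
    define M where "M = (\<lambda>K\<in>Pow {..<k}. card {e \<in> possible_edges n. c ` e = K \<and> b e})"
    have c'e: "c' ` e = c ` e" if "e \<in> possible_edges n" for e
      using that unfolding c'_def possible_edges_def by (intro image_cong) auto
    have "card {e \<in> possible_edges n. c ` e = K \<and> b e} \<le> n\<^sup>2" for K
    proof -
      have "card {e \<in> possible_edges n. c ` e = K \<and> b e} \<le> card (possible_edges n)" by (intro card_mono) auto
      moreover have "real (card (possible_edges n)) \<le> real (n\<^sup>2)"
        using card_possible_edges_le[of n] unfolding of_nat_power by linarith
      then have "card (possible_edges n) \<le> n\<^sup>2" by (simp only: of_nat_le_iff)
      ultimately show ?thesis by (rule order_trans)
    qed
    then have MQ: "M \<in> Pow {..<k} \<rightarrow>\<^sub>E {0..n\<^sup>2}" unfolding M_def by auto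
    have "c' \<in> {1..n} \<rightarrow>\<^sub>E {..<k}" using c(1) unfolding c'_def by auto
    with MQ have inQ: "block_weight n c' M \<in> Q" unfolding Q_def by auto
    have bw: "block_weight n c' M e = colour_mean n c (\<lambda>e. of_bool (b e)) (c ` e)" if e: "e \<in> possible_edges n" for e
    proof -
      have "{e' \<in> possible_edges n. c' ` e' = c' ` e} = {e' \<in> possible_edges n. c ` e' = c ` e}"
        by (rule Collect_cong, rule conj_cong, rule refl) (simp only: c'e e)
      moreover have "M (c' ` e) = card {e' \<in> possible_edges n. c ` e' = c ` e \<and> b e'}"
        using c(1) c'e[OF e] unfolding M_def by auto
      moreover have "(\<Sum>e'\<in>{e' \<in> possible_edges n. c ` e' = c ` e}. of_bool (b e')) = real (card {e' \<in> possible_edges n. c ` e' = c ` e \<and> b e'})"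
        by (simp add: Int_def)
      ultimately show ?thesis by (simp add: block_weight_def block_mean_def)
    qed
    have bE: "b \<in> edge_space n" using b A by auto
    let ?q = "\<lambda>e. colour_mean n c (\<lambda>e. of_bool (b e)) (c ` e)"
    have "pmf (edge_pmf n (\<lambda>_. p)) b = (\<Prod>e\<in>possible_edges n. pmf (bernoulli_pmf (?q e)) (b e)) * exp (- (\<Sum>e\<in>possible_edges n. 2 * rate p (?q e)))"
      unfolding pmf_edge_pmf[OF bE] by (rule block_likelihood[OF p]) simp
    also have "(\<Prod>e\<in>possible_edges n. pmf (bernoulli_pmf (?q e)) (b e)) = pmf (edge_pmf n (block_weight n c' M)) b"
      unfolding pmf_edge_pmf[OF bE] using bw by (intro prod.cong) auto
    also have "\<dots> * exp (- (\<Sum>e\<in>possible_edges n. 2 * rate p (?q e))) \<le> \<dots> * exp (- s)"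
      using c(2) by (intro mult_left_mono) auto
    finally show ?thesis using inQ by blast
  qed
  then obtain \<theta> where "\<And>b. b \<in> A \<Longrightarrow> \<theta> b \<in> Q \<and> pmf (edge_pmf n (\<lambda>_. p)) b \<le> pmf (edge_pmf n (\<theta> b)) b * exp (- s)"
    by metis
  then have "(\<Sum>b\<in>A. pmf (edge_pmf n (\<lambda>_. p)) b) \<le> real (card Q) * exp (- s)"
    by (intro prob_le_card_change_of_measure[OF Q A]) auto
  also have "\<dots> \<le> real k ^ n * ((real n)\<^sup>2 + 1) ^ (2 ^ k) * exp (- s)" using cQ by (intro mult_right_mono) auto
  finally show ?thesis using A by (simp add: prob_edge_pmf Int_absorb2)
qed

text \<open>The hypothesis concerns a \<open>d\<close>-neighbourhood because the rate is evaluated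
  at the step graphon of block densities, not at the graph. Regularity and the diagonal correction
  cost less than \<open>d / 2\<close> plus \<open>d / 2\<close>.\<close>

lemma gnp_upper_bound:
  assumes p: "0 < p" "p < 1" and d: "d > 0" and \<eta>: "\<eta> > 0"
    and s: "\<And>g b. g \<in> graphons \<Longrightarrow> b \<in> graphons \<Longrightarrow> graphon_class b \<in> F \<Longrightarrow> orbit_dist b g < d \<Longrightarrow> s \<le> graphon_rate p g"
  shows "eventually (\<lambda>n. measure_pmf.prob (gnp n p) F \<le> exp (- (s - \<eta>) * (real n)\<^sup>2)) sequentially"
proof -
  obtain k where k: "k > 0" "\<And>n w. \<forall>e. 0 \<le> w e \<and> w e \<le> 1 \<Longrightarrow>
    \<exists>c. (\<forall>i. c i < k) \<and> (\<forall>S\<subseteq>{1..n}. \<forall>T\<subseteq>{1..n}.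
      \<bar>\<Sum>e\<in>possible_edges n. incidence S T e * (w e - colour_mean n c w (c ` e))\<bar> \<le> d / 2 * (real n)\<^sup>2)"
    by (rule weak_regularity[of "d / 2"]) (use d in \<open>simp, blast\<close>)
  \<comment> \<open>The logarithm of the number of candidate laws, absorbed by
    \<open>\<eta>\<close>.\<close>
  have "eventually (\<lambda>n::nat. real n * ln (real k) + 2 ^ k * ln ((real n)\<^sup>2 + 1) \<le> \<eta> * (real n)\<^sup>2) sequentially"
    using \<eta> by real_asymp
  moreover have "eventually (\<lambda>n::nat. 1 / real n < d / 2) sequentially"
    using d by (intro order_tendstoD(2)[OF lim_const_over_n]) auto
  moreover have "eventually (\<lambda>n::nat. n > 0) sequentially" by (rule eventually_gt_at_top)
  ultimately show ?thesis
  proof eventually_elim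
    case (elim n)
    define A where "A = {b \<in> edge_space n. graphon_class (random_graphon n b) \<in> F}"
    have A: "A \<subseteq> edge_space n" by (auto simp: A_def)
    have "measure_pmf.prob (gnp n p) F = measure_pmf.prob (edge_pmf n (\<lambda>_. p)) ((\<lambda>b. graphon_class (random_graphon n b)) -` F)"
      unfolding gnp_eq by (rule measure_map_pmf)
    also have "\<dots> = measure_pmf.prob (edge_pmf n (\<lambda>_. p)) A"
      unfolding prob_edge_pmf by (intro sum.cong) (auto simp: A_def)
    also have "\<dots> \<le> real k ^ n * ((real n)\<^sup>2 + 1) ^ (2 ^ k) * exp (- (s * (real n)\<^sup>2))"
    proof (rule upper_bound_finite[OF p elim(3) A])
      fix b assume b: "b \<in> A"
      let ?w = "\<lambda>e. of_bool (b e) :: real"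
      have w: "\<forall>e. 0 \<le> ?w e \<and> ?w e \<le> 1" by simp
      from k(2)[OF w, of n] obtain c where c0: "(\<forall>i. c i < k) \<and> (\<forall>S\<subseteq>{1..n}. \<forall>T\<subseteq>{1..n}.
        \<bar>\<Sum>e\<in>possible_edges n. incidence S T e * (?w e - colour_mean n c ?w (c ` e))\<bar> \<le> d / 2 * (real n)\<^sup>2)"
        by (rule exE)
      let ?u = "\<lambda>e. colour_mean n c ?w (c ` e)"
      have u: "0 \<le> ?u e \<and> ?u e \<le> 1" for e by (rule block_mean_01) auto
      have G: "egraphon n p ?u \<in> graphons" using p u by (intro egraphon_graphon) auto
      have "cut_dist (random_graphon n b) (egraphon n p ?u) \<le> d / 2 + 1 / real n"
        unfolding random_graphon_def
      proof (rule cut_dist_egraphon_le[OF elim(3)])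
        fix S T assume ST: "S \<subseteq> {1..n}" "T \<subseteq> {1..n}"
        have "(\<Sum>e\<in>possible_edges n. incidence S T e * ((if e \<in> possible_edges n \<and> b e then 1 else 0) - ?u e)) =
           (\<Sum>e\<in>possible_edges n. incidence S T e * (?w e - ?u e))"
          by (intro sum.cong) auto
        then show "\<bar>\<Sum>e\<in>possible_edges n. incidence S T e * ((if e \<in> possible_edges n \<and> b e then 1 else 0) - ?u e)\<bar> \<le> d / 2 * (real n)\<^sup>2"
          using c0 ST by simp
      qed (use p u in auto)
      then have "orbit_dist (random_graphon n b) (egraphon n p ?u) < d"
        using orbit_dist_le_cut_dist[OF random_graphon_graphon[of n b] G] elim(2) by linarith
      then have "s \<le> graphon_rate p (egraphon n p ?u)" using b by (intro s[OF G random_graphon_graphon]) (auto simp: A_def)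
      then have "s * (real n)\<^sup>2 \<le> graphon_rate p (egraphon n p ?u) * (real n)\<^sup>2" by (intro mult_right_mono) auto
      also have "\<dots> = (\<Sum>e\<in>possible_edges n. 2 * rate p (?u e))"
        using graphon_rate_egraphon[OF p elim(3) u] by (simp add: sum_distrib_left)
      finally show "\<exists>c. (\<forall>i. c i < k) \<and> s * (real n)\<^sup>2 \<le> (\<Sum>e\<in>possible_edges n. 2 * rate p (colour_mean n c ?w (c ` e)))"
        using c0 by blast
    qed
    also have "\<dots> = exp (real n * ln (real k) + 2 ^ k * ln ((real n)\<^sup>2 + 1)) * exp (- (s * (real n)\<^sup>2))"
    proof -
      have "exp (real n * ln (real k)) = real k ^ n" using k(1) by (simp add: exp_of_nat_mult)
      moreover have "exp (2 ^ k * ln ((real n)\<^sup>2 + 1)) = ((real n)\<^sup>2 + 1) ^ (2 ^ k)"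
        using exp_of_nat_mult[of "2 ^ k" "ln ((real n)\<^sup>2 + 1)"] by (simp add: add_nonneg_pos)
      ultimately show ?thesis by (simp add: exp_add)
    qed
    also have "\<dots> = exp (real n * ln (real k) + 2 ^ k * ln ((real n)\<^sup>2 + 1) - s * (real n)\<^sup>2)"
      by (simp add: exp_diff exp_minus field_simps)
    also have "\<dots> \<le> exp (- (s - \<eta>) * (real n)\<^sup>2)"
      using elim(1) by (simp add: algebra_simps)
    finally show ?case .
  qed
qed

section \<open>The lower bound\<close>

lemma expectation_edge:
  fixes f :: "bool \<Rightarrow> real"
  assumes "0 \<le> q e" "q e \<le> 1" "e \<in> possible_edges n"
  shows "measure_pmf.expectation (edge_pmf n q) (\<lambda>b. f (b e)) = q e * f True + (1 - q e) * f False"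
  proof -
  have "measure_pmf.expectation (edge_pmf n q) (\<lambda>b. f (b e)) = measure_pmf.expectation (map_pmf (\<lambda>b. b e) (edge_pmf n q)) f"
    by simp
  also have "map_pmf (\<lambda>b. b e) (edge_pmf n q) = bernoulli_pmf (q e)"
    unfolding edge_pmf_def using assms(3) by (subst Pi_pmf_component) auto
  finally show ?thesis using assms by simp
qed

text \<open>The bound rests on \<open>exp (- L) \<ge> exp (- a) * (1 + a - L)\<close> for the log-likelihood ratio \<open>L\<close>,
  so that only the expectation of \<open>L\<close> (the relative entropy) enters.\<close>

lemma change_of_measure_lower:
  assumes p: "0 < p" "p < 1" and q: "\<And>e. 0 \<le> q e \<and> q e \<le> 1" and A: "A \<subseteq> edge_space n"
    and Q: "measure_pmf.prob (edge_pmf n q) A > 0" (is "?Q > 0")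
  shows "exp (- ((\<Sum>e\<in>possible_edges n. 2 * rate p (q e)) + 2) / ?Q) \<le> measure_pmf.prob (edge_pmf n (\<lambda>_. p)) A"
proof -
  let ?E = "possible_edges n"
  define P0 where "P0 b = pmf (edge_pmf n (\<lambda>_. p)) b" for b
  define P1 where "P1 b = pmf (edge_pmf n q) b" for b
  \<comment> \<open>If \<open>q e\<close> is 0 or 1, one of the two logarithms is a default value,
    met only at configurations of mass 0 under \<open>P1\<close>. Hence \<open>ratio\<close> assumes
    positive mass.\<close>
  define l where "l e c = (if c then ln (q e / p) else ln ((1 - q e) / (1 - p)))" for e c
  define L where "L b = (\<Sum>e\<in>?E. l e (b e))" for b
  define H where "H = (\<Sum>e\<in>?E. 2 * rate p (q e))"
  have P0: "P0 b > 0" if "b \<in> edge_space n" for b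
    using p that by (simp add: P0_def pmf_edge_pmf prod_pos pmf_bernoulli_pos)
  have P1nn: "0 \<le> P1 b" for b by (simp add: P1_def)
  have ratio: "P0 b = P1 b * exp (- L b)" if b: "b \<in> edge_space n" "P1 b > 0" for b
  proof -
    have nz: "pmf (bernoulli_pmf (q e)) (b e) > 0" if "e \<in> ?E" for e
    proof (rule ccontr)
      assume "\<not> pmf (bernoulli_pmf (q e)) (b e) > 0"
      then have "pmf (bernoulli_pmf (q e)) (b e) = 0" using pmf_nonneg[of "bernoulli_pmf (q e)" "b e"] by linarith
      then have "P1 b = 0" using that b(1) by (auto simp: P1_def pmf_edge_pmf intro!: prod_zero)
      then show False using b(2) by simp
    qed
    have "pmf (bernoulli_pmf p) (b e) = pmf (bernoulli_pmf (q e)) (b e) * exp (- l e (b e))" if "e \<in> ?E" for e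
    proof -
      have q': "0 \<le> q e" "q e \<le> 1" using q by auto
      show ?thesis
      proof (cases "b e")
        case True
        then have "q e > 0" using nz[OF that] q' by simp
        then show ?thesis using True p q' by (simp add: l_def exp_minus)
      next
        case False
        then have "1 - q e > 0" using nz[OF that] q' by simp
        then show ?thesis using False p q' by (simp add: l_def exp_minus)
      qed
    qed
    then have "P0 b = (\<Prod>e\<in>?E. pmf (bernoulli_pmf (q e)) (b e) * exp (- l e (b e)))"
      unfolding P0_def pmf_edge_pmf[OF b(1)] by (intro prod.cong) auto
    then show ?thesis unfolding P1_def pmf_edge_pmf[OF b(1)] L_def
      by (simp add: prod.distrib exp_sum[symmetric] sum_negf)
  qed
  have EL: "(\<Sum>b\<in>edge_space n. P1 b * L b) = H"
  proof -
    have "(\<Sum>b\<in>edge_space n. P1 b * L b) = measure_pmf.expectation (edge_pmf n q) L"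
      unfolding P1_def using set_edge_pmf[of n q]
      by (subst integral_measure_pmf[where A = "edge_space n"]) (auto simp: mult.commute)
    also have "\<dots> = (\<Sum>e\<in>?E. measure_pmf.expectation (edge_pmf n q) (\<lambda>b. l e (b e)))"
      unfolding L_def
      by (rule Bochner_Integration.integral_sum)
         (rule integrable_measure_pmf_finite, rule finite_subset[OF set_edge_pmf finite_edge_space])
    also have "\<dots> = H"
      unfolding H_def
    proof (rule sum.cong[OF refl])
      fix e assume e: "e \<in> ?E"
      have "2 * rate p (q e) = q e * ln (q e / p) + (1 - q e) * ln ((1 - q e) / (1 - p))"
        by (simp add: rate_def distrib_left)
      then show "measure_pmf.expectation (edge_pmf n q) (\<lambda>b. l e (b e)) = 2 * rate p (q e)"
        using expectation_edge[of q e n "l e"] q e by (simp add: l_def)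
    qed
    finally show ?thesis .
  qed
  \<comment> \<open>The exponential inequality with \<open>a = 0\<close> gives
    \<open>P1 b * L b \<ge> - P0 b\<close>, so the complement contributes at least
    \<open>- 1\<close> and \<open>A\<close> at most \<open>H + 1\<close>.\<close>
  have compl: "- 1 \<le> (\<Sum>b\<in>edge_space n - A. P1 b * L b)"
  proof -
    have "(\<Sum>b\<in>edge_space n - A. - P0 b) \<le> (\<Sum>b\<in>edge_space n - A. P1 b * L b)"
    proof (rule sum_mono)
      fix b assume "b \<in> edge_space n - A"
      then have b: "b \<in> edge_space n" by simp
      show "- P0 b \<le> P1 b * L b"
      proof (cases "P1 b > 0")
        case True
        have "P0 b \<ge> P1 b * (1 + (- L b))"
          unfolding ratio[OF b True] using exp_ge_add_one_self[of "- L b"] P1nn by (intro mult_left_mono) auto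
        then show ?thesis using P1nn[of b] by (simp add: algebra_simps)
      next
        case False
        then have "P1 b = 0" using P1nn[of b] by simp
        then show ?thesis using P0[OF b] by simp
      qed
    qed
    moreover have "(\<Sum>b\<in>edge_space n - A. P0 b) \<le> 1" unfolding P0_def by (rule sum_edge_pmf) auto
    ultimately show ?thesis by (simp add: sum_negf)
  qed
  have "(\<Sum>b\<in>edge_space n. P1 b * L b) = (\<Sum>b\<in>A. P1 b * L b) + (\<Sum>b\<in>edge_space n - A. P1 b * L b)"
    using A by (simp add: sum.subset_diff add.commute)
  then have AL: "(\<Sum>b\<in>A. P1 b * L b) \<le> H + 1" using EL compl by simp
  have QA: "?Q = (\<Sum>b\<in>A. P1 b)" using A by (simp add: prob_edge_pmf Int_absorb2 P1_def)
  \<comment> \<open>Chosen so that \<open>(1 + a) * ?Q\<close> is \<open>H + 2\<close>, one more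
    than the bound on the sum of \<open>P1 b * L b\<close> over \<open>A\<close>; the bracket below
    is then at least 1.\<close>
  define a where "a = (H + 2) / ?Q - 1"
  have "(1 + a) * ?Q = H + 2" using Q by (simp add: a_def)
  then have "exp (- a) * 1 \<le> exp (- a) * ((1 + a) * ?Q - (\<Sum>b\<in>A. P1 b * L b))"
    using AL by (intro mult_left_mono) auto
  also have "\<dots> = (\<Sum>b\<in>A. P1 b * (exp (- a) * (1 + a - L b)))"
    unfolding QA sum_distrib_left sum_subtractf[symmetric] by (intro sum.cong refl) (simp add: algebra_simps)
  also have "\<dots> \<le> (\<Sum>b\<in>A. P0 b)"
  proof (rule sum_mono)
    fix b assume "b \<in> A"
    then have b: "b \<in> edge_space n" using A by auto
    show "P1 b * (exp (- a) * (1 + a - L b)) \<le> P0 b"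
    proof (cases "P1 b > 0")
      case True
      have "exp (- a) * (1 + (a - L b)) \<le> exp (- a) * exp (a - L b)"
        by (intro mult_left_mono exp_ge_add_one_self) auto
      also have "\<dots> = exp (- L b)" by (simp add: exp_add[symmetric])
      finally show ?thesis unfolding ratio[OF b True] using P1nn by (intro mult_left_mono) (auto simp: add_diff_eq)
    next
      case False
      then have "P1 b = 0" using P1nn[of b] by simp
      then show ?thesis using P0[OF b] by simp
    qed
  qed
  also have "\<dots> = measure_pmf.prob (edge_pmf n (\<lambda>_. p)) A" using A by (simp add: prob_edge_pmf Int_absorb2 P0_def)
  finally have "exp (- a) \<le> measure_pmf.prob (edge_pmf n (\<lambda>_. p)) A" by simp
  moreover have "- (H + 2) / ?Q \<le> - a" unfolding a_def minus_divide_left[symmetric] by simp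
  then have "exp (- (H + 2) / ?Q) \<le> exp (- a)" by (simp only: exp_le_cancel_iff)
  ultimately show ?thesis unfolding H_def by linarith
qed

text \<open>Summands lie in \<open>[0, 2]\<close>, so the squared ranges add up to at most
  \<open>2 * n^2\<close>, which gives the exponent. Being quadratic in \<open>n\<close>, it absorbs
  a union over \<open>4 ^ n\<close> pairs. For \<open>n \<ge> 2\<close> there is an edge, so the sum
  of squared ranges is positive.\<close>

lemma hoeffding_incidence:
  assumes n: "n \<ge> 2" and q: "\<And>e. 0 \<le> q e \<and> q e \<le> 1" and t: "t > 0"
  shows "measure_pmf.prob (edge_pmf n q)
    {b. \<bar>\<Sum>e\<in>possible_edges n. incidence S T e * (of_bool (b e) - q e)\<bar> \<ge> t * (real n)\<^sup>2} \<le> 2 * exp (- (t\<^sup>2 * (real n)\<^sup>2))"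
proof -
  define X where "X e b = incidence S T e * of_bool (b e)" for e and b :: "nat set \<Rightarrow> bool"
  define \<mu> where "\<mu> = (\<Sum>e\<in>possible_edges n. measure_pmf.expectation (edge_pmf n q) (X e))"
  interpret Hoeffding_ineq "measure_pmf (edge_pmf n q)" "possible_edges n" X "\<lambda>_. 0" "\<lambda>_. 2" \<mu>
  proof unfold_locales
    show "prob_space.indep_vars (measure_pmf (edge_pmf n q)) (\<lambda>_. borel) X (possible_edges n)"
      unfolding edge_pmf_def X_def[abs_def]
      by (intro prob_space.indep_vars_compose2[OF _ indep_vars_Pi_pmf]) (auto simp: measure_pmf.prob_space_axioms)
    show "AE b in measure_pmf (edge_pmf n q). X e b \<in> {0..2}" if "e \<in> possible_edges n" for e
      using incidence_le_2[OF that, of S T] by (auto simp: X_def)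
  qed (simp_all add: \<mu>_def)
  have "{1, 2} \<in> possible_edges n" using n by (intro pair_possible_edge) auto
  then have c: "card (possible_edges n) > 0" by (auto simp: card_gt_0_iff)
  have s: "(\<Sum>e\<in>possible_edges n. (2 - 0 :: real)\<^sup>2) = 4 * real (card (possible_edges n))" by simp
  have \<mu>: "\<mu> = (\<Sum>e\<in>possible_edges n. incidence S T e * q e)"
    unfolding \<mu>_def
  proof (intro sum.cong refl)
    fix e assume "e \<in> possible_edges n"
    then show "measure_pmf.expectation (edge_pmf n q) (X e) = incidence S T e * q e"
      unfolding X_def using q expectation_edge[of q e n "\<lambda>c. incidence S T e * of_bool c"] by simp
  qed
  have "measure_pmf.prob (edge_pmf n q) {b \<in> space (measure_pmf (edge_pmf n q)). \<bar>(\<Sum>e\<in>possible_edges n. X e b) - \<mu>\<bar> \<ge> t * (real n)\<^sup>2}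
     \<le> 2 * exp (- 2 * (t * (real n)\<^sup>2)\<^sup>2 / (\<Sum>e\<in>possible_edges n. (2 - 0)\<^sup>2))"
    by (rule Hoeffding_ineq_abs_ge) (use t c s in auto)
  also have "\<dots> \<le> 2 * exp (- (t\<^sup>2 * (real n)\<^sup>2))"
  proof -
    have "t\<^sup>2 * (real n)\<^sup>2 * (4 * real (card (possible_edges n))) \<le> t\<^sup>2 * (real n)\<^sup>2 * (2 * (real n)\<^sup>2)"
      using card_possible_edges_le[of n] by (intro mult_left_mono) auto
    also have "\<dots> = 2 * (t * (real n)\<^sup>2)\<^sup>2" by (simp add: power2_eq_square mult_ac)
    finally have "t\<^sup>2 * (real n)\<^sup>2 \<le> 2 * (t * (real n)\<^sup>2)\<^sup>2 / (4 * real (card (possible_edges n)))"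
      using c by (simp add: pos_le_divide_eq mult_ac)
    then show ?thesis unfolding s by simp
  qed
  also have "{b \<in> space (measure_pmf (edge_pmf n q)). \<bar>(\<Sum>e\<in>possible_edges n. X e b) - \<mu>\<bar> \<ge> t * (real n)\<^sup>2} =
     {b. \<bar>\<Sum>e\<in>possible_edges n. incidence S T e * (of_bool (b e) - q e)\<bar> \<ge> t * (real n)\<^sup>2}"
    by (simp add: X_def \<mu> sum_subtractf right_diff_distrib)
  finally show ?thesis .
qed

text \<open>The event \<open>A\<close> says that no pair of vertex sets tells the sample from its
  edge probabilities. It has probability near 1 under the inhomogeneous law, so dividing the entropy
  by this probability changes the exponent little.\<close>

lemma gnp_lower_bound:
  assumes p: "0 < p" "p < 1" and h: "h \<in> graphons" and \<epsilon>: "\<epsilon> > 0" and \<eta>: "\<eta> > 0"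
    and F: "\<And>g. g \<in> graphons \<Longrightarrow> orbit_dist h g < \<epsilon> \<Longrightarrow> graphon_class g \<in> F"
  shows "eventually (\<lambda>n. exp (- (graphon_rate p h + \<eta>) * (real n)\<^sup>2) \<le> measure_pmf.prob (gnp n p) F) sequentially"
proof -
  \<comment> \<open>One \<open>t\<close> is spent on averaging \<open>h\<close> and two on sampling
    and the diagonal, together less than \<open>\<epsilon>\<close>.\<close>
  define t where "t = \<epsilon> / 4"
  have t: "t > 0" using \<epsilon> by (simp add: t_def)
  define R where "R = graphon_rate p h"
  have R: "R \<ge> 0" unfolding R_def by (rule graphon_rate_nonneg[OF p h])
  \<comment> \<open>The second term makes \<open>R / (1 - \<theta>) \<le> R + \<eta> / 2\<close>;
    the first keeps \<open>2 / (1 - \<theta>)\<close> below 4.\<close>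
  define \<theta> where "\<theta> = min (1/2) (\<eta> / (2 * R + \<eta>))"
  have "\<theta> > 0" using R \<eta> by (simp add: \<theta>_def)
  moreover have "\<theta> \<le> 1/2" unfolding \<theta>_def by (rule min.cobounded1)
  ultimately have \<theta>: "\<theta> > 0" "\<theta> \<le> 1/2" by blast+
  have "eventually (\<lambda>n::nat. 2 * 4 ^ n * exp (- (t\<^sup>2 * (real n)\<^sup>2)) < \<theta>) sequentially"
  proof -
    have "((\<lambda>n::nat. 2 * 4 ^ n * exp (- (t\<^sup>2 * (real n)\<^sup>2))) \<longlongrightarrow> 0) sequentially"
      using t by real_asymp
    then show ?thesis using \<theta> by (intro order_tendstoD(2)) auto
  qed
  moreover have "eventually (\<lambda>n::nat. 1 / real n < t) sequentially"
    using t by (intro order_tendstoD(2)[OF lim_const_over_n]) auto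
  moreover have "eventually (\<lambda>n. l1_dist h (egraphon n p (avg_weight n h)) < t) sequentially"
    by (rule l1_dist_avg[OF p h t])
  moreover have "eventually (\<lambda>n::nat. n \<ge> 2) sequentially" by (rule eventually_ge_at_top)
  moreover have "eventually (\<lambda>n::nat. 4 \<le> \<eta> / 2 * (real n)\<^sup>2) sequentially" using \<eta> by real_asymp
  ultimately show ?thesis
  proof eventually_elim
    case (elim n)
    have n: "n > 0" using elim by simp
    define q where "q = avg_weight n h"
    have q: "0 \<le> q e \<and> q e \<le> 1" for e unfolding q_def by (rule avg_weight_01[OF h])
    have G: "egraphon n p q \<in> graphons" unfolding q_def using p h by auto
    define bad where "bad S T = {b. \<bar>\<Sum>e\<in>possible_edges n. incidence S T e * (of_bool (b e) - q e)\<bar> \<ge> t * (real n)\<^sup>2}" for S T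
    define A where "A = edge_space n - (\<Union>S\<in>Pow {1..n}. \<Union>T\<in>Pow {1..n}. bad S T)"
    have A: "A \<subseteq> edge_space n" by (auto simp: A_def)
    have AF: "graphon_class (random_graphon n b) \<in> F" if b: "b \<in> A" for b
    proof (rule F[OF random_graphon_graphon])
      have "cut_dist (random_graphon n b) (egraphon n p q) \<le> t + 1 / real n"
        unfolding random_graphon_def
      proof (rule cut_dist_egraphon_le[OF n])
        fix S T assume ST: "S \<subseteq> {1..n}" "T \<subseteq> {1..n}"
        have "b \<notin> bad S T" using b ST by (auto simp: A_def)
        moreover have "(\<Sum>e\<in>possible_edges n. incidence S T e * ((if e \<in> possible_edges n \<and> b e then 1 else 0) - q e)) =
           (\<Sum>e\<in>possible_edges n. incidence S T e * (of_bool (b e) - q e))"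
          by (intro sum.cong) auto
        ultimately show "\<bar>\<Sum>e\<in>possible_edges n. incidence S T e * ((if e \<in> possible_edges n \<and> b e then 1 else 0) - q e)\<bar> \<le> t * (real n)\<^sup>2"
          by (simp add: bad_def)
      qed (use p q in auto)
      then have "orbit_dist (egraphon n p q) (random_graphon n b) < 2 * t"
        using orbit_dist_le_cut_dist[OF G random_graphon_graphon[of n b]] elim(2) by (simp add: cut_dist_commute)
      moreover have "orbit_dist h (egraphon n p q) < t"
        using orbit_dist_le_cut_dist[OF h G] cut_dist_le_l1_dist[OF h G] elim(3) by (simp add: q_def)
      ultimately show "orbit_dist h (random_graphon n b) < \<epsilon>"
        using orbit_dist_triangle[OF h G random_graphon_graphon[of n b]] t unfolding t_def by linarith
    qed
    let ?Q = "measure_pmf.prob (edge_pmf n q)"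
    have "?Q (\<Union>S\<in>Pow {1..n}. \<Union>T\<in>Pow {1..n}. bad S T) \<le> (\<Sum>S\<in>Pow {1..n}. ?Q (\<Union>T\<in>Pow {1..n}. bad S T))"
      by (intro measure_pmf.finite_measure_subadditive_finite) auto
    also have "\<dots> \<le> (\<Sum>S\<in>Pow {1..n}. \<Sum>T\<in>Pow {1..n}. ?Q (bad S T))"
      by (intro sum_mono measure_pmf.finite_measure_subadditive_finite) auto
    also have "\<dots> \<le> (\<Sum>S\<in>Pow {1..n}. \<Sum>T\<in>Pow {1..n}. 2 * exp (- (t\<^sup>2 * (real n)\<^sup>2)))"
      unfolding bad_def by (intro sum_mono hoeffding_incidence elim q t)
    also have "\<dots> = 2 * 4 ^ n * exp (- (t\<^sup>2 * (real n)\<^sup>2))"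
      by (simp add: card_Pow power_mult_distrib[symmetric])
    finally have bad: "?Q (\<Union>S\<in>Pow {1..n}. \<Union>T\<in>Pow {1..n}. bad S T) \<le> \<theta>" using elim(1) by simp
    have "?Q A = ?Q (- (\<Union>S\<in>Pow {1..n}. \<Union>T\<in>Pow {1..n}. bad S T))"
      unfolding prob_edge_pmf by (intro sum.cong) (auto simp: A_def)
    also have "\<dots> = 1 - ?Q (\<Union>S\<in>Pow {1..n}. \<Union>T\<in>Pow {1..n}. bad S T)"
      using measure_pmf.prob_compl[of "\<Union>S\<in>Pow {1..n}. \<Union>T\<in>Pow {1..n}. bad S T" "edge_pmf n q"] by (simp add: Compl_eq_Diff_UNIV)
    finally have QA: "1 - \<theta> \<le> ?Q A" using bad by simp
    define H where "H = (\<Sum>e\<in>possible_edges n. 2 * rate p (q e))"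
    have "H = graphon_rate p (egraphon n p q) * (real n)\<^sup>2"
      unfolding H_def using graphon_rate_egraphon[OF p n q] by (simp add: sum_distrib_left)
    also have "\<dots> \<le> R * (real n)\<^sup>2"
      unfolding R_def q_def using graphon_rate_avg_le[OF p n h] by (intro mult_right_mono) auto
    finally have H: "H \<le> R * (real n)\<^sup>2" .
    have H0: "0 \<le> H" unfolding H_def using p q by (intro sum_nonneg) (auto intro!: rate_nonneg)
    have "(H + 2) / ?Q A \<le> (H + 2) / (1 - \<theta>)"
      using QA \<theta> H0 by (intro divide_left_mono mult_pos_pos) auto
    also have "\<dots> = H / (1 - \<theta>) + 2 / (1 - \<theta>)" by (rule add_divide_distrib)
    also have "\<dots> \<le> (R + \<eta> / 2) * (real n)\<^sup>2 + 4"
    proof (rule add_mono)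
      have "\<theta> * (2 * R + \<eta>) \<le> \<eta> / (2 * R + \<eta>) * (2 * R + \<eta>)"
        using R \<eta> by (intro mult_right_mono) (auto simp: \<theta>_def)
      also have "\<dots> = \<eta>" using R \<eta> by simp
      finally have "R \<le> (R + \<eta> / 2) * (1 - \<theta>)" by (simp add: algebra_simps)
      then have "R * (real n)\<^sup>2 \<le> (R + \<eta> / 2) * (1 - \<theta>) * (real n)\<^sup>2" by (intro mult_right_mono) auto
      with H have "H \<le> (R + \<eta> / 2) * (real n)\<^sup>2 * (1 - \<theta>)" by (simp add: mult_ac)
      then show "H / (1 - \<theta>) \<le> (R + \<eta> / 2) * (real n)\<^sup>2" using \<theta> by (simp add: pos_divide_le_eq)
      show "2 / (1 - \<theta>) \<le> 4" using \<theta> by (simp add: pos_divide_le_eq)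
    qed
    also have "\<dots> \<le> (R + \<eta>) * (real n)\<^sup>2" using elim(5) by (simp add: algebra_simps)
    finally have "- (R + \<eta>) * (real n)\<^sup>2 \<le> - (H + 2) / ?Q A"
      unfolding minus_mult_left[symmetric] minus_divide_left[symmetric] by simp
    then have "exp (- (R + \<eta>) * (real n)\<^sup>2) \<le> exp (- (H + 2) / ?Q A)" by (simp only: exp_le_cancel_iff)
    also have "\<dots> \<le> measure_pmf.prob (edge_pmf n (\<lambda>_. p)) A"
      unfolding H_def using QA \<theta> by (intro change_of_measure_lower p q A) auto
    also have "\<dots> \<le> measure_pmf.prob (edge_pmf n (\<lambda>_. p)) ((\<lambda>b. graphon_class (random_graphon n b)) -` F)"
      using AF by (intro measure_pmf.finite_measure_mono) auto
    also have "\<dots> = measure_pmf.prob (gnp n p) F" unfolding gnp_eq by (rule measure_map_pmf[symmetric])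
    finally show ?case unfolding R_def .
  qed
qed

section \<open>Minimizers of the rate function\<close>

lemma graphon_topology_eq: "graphon_topology = graphon.mtopology"
  by (simp add: graphon_topology_def)

lemma graphon_compactin_subset: "compactin graphon.mtopology K \<Longrightarrow> K \<subseteq> graphon_space"
  using compactin_subset_topspace[of graphon.mtopology K] by simp

lemma graphon_closedin_subset: "closedin graphon.mtopology K \<Longrightarrow> K \<subseteq> graphon_space"
  using closedin_subset[of graphon.mtopology K] by simp

lemma graphon_compactin_closedin: "closedin graphon.mtopology K \<Longrightarrow> compactin graphon.mtopology K"
  by (rule closedin_compact_space[OF compact_space_graphon])

lemma graphon_compactinD:
  fixes s :: "nat \<Rightarrow> (real \<times> real \<Rightarrow> real) set"
  assumes K: "compactin graphon.mtopology K" and s: "\<And>n. s n \<in> K"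
  obtains l r where "l \<in> K" "strict_mono r" "(\<lambda>n. delta_cut l (s (r n))) \<longlonglongrightarrow> 0"
    "limitin graphon.mtopology (s \<circ> r) l sequentially"
proof -
  have sub: "K \<subseteq> graphon_space" using K by (intro graphon_compactin_subset)
  obtain l r where l: "l \<in> K" "strict_mono r" "limitin graphon.mtopology (s \<circ> r) l sequentially"
    using K s unfolding graphon.compactin_sequentially by (metis image_subsetI)
  have "(\<lambda>n. delta_cut l (s (r n))) \<longlonglongrightarrow> 0"
  proof (rule LIMSEQ_I)
    fix e :: real assume "e > 0"
    then obtain N where "\<forall>n\<ge>N. delta_cut ((s \<circ> r) n) l < e"
      using l(3) unfolding graphon.limitin_metric eventually_sequentially by blast
    then have "norm (delta_cut l (s (r n)) - 0) < e" if "n \<ge> N" for n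
      using that by (simp add: graphon.commute[of l])
    then show "\<exists>N. \<forall>n\<ge>N. norm (delta_cut l (s (r n)) - 0) < e" by blast
  qed
  then show ?thesis using l that by blast
qed

lemma class_rate_limit_le:
  assumes p: "0 < p" "p < 1" and l: "l \<in> graphon_space" and B: "\<And>n. B n \<in> graphon_space"
    and lim: "(\<lambda>n. delta_cut l (B n)) \<longlonglongrightarrow> 0" and s: "eventually (\<lambda>n. class_rate p (B n) \<le> s) sequentially"
  shows "class_rate p l \<le> s"
proof (rule ccontr)
  assume "\<not> class_rate p l \<le> s"
  then obtain d where d: "d > 0" "\<And>A. A \<in> graphon_space \<Longrightarrow> delta_cut l A < d \<Longrightarrow> s < class_rate p A"
    using class_rate_lsc[OF p l, of s] by (metis not_le)
  have "eventually (\<lambda>n. delta_cut l (B n) < d) sequentially" using lim d(1) by (rule order_tendstoD(2))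
  with s have "eventually (\<lambda>n. False) sequentially"
  proof eventually_elim
    case (elim n) then show ?case using d(2)[OF B, of n] by simp
  qed
  then show False by simp
qed

lemma class_rate_nonneg: "0 < p \<Longrightarrow> p < 1 \<Longrightarrow> A \<in> graphon_space \<Longrightarrow> 0 \<le> class_rate p A"
  unfolding class_rate_def by (intro graphon_rate_nonneg class_rep)

text \<open>The direct method: a minimizing sequence has a convergent subsequence, and
  semicontinuity bounds the rate at its limit.\<close>

lemma class_rate_attains_min:
  assumes p: "0 < p" "p < 1" and K: "compactin graphon.mtopology K" "K \<noteq> {}"
  obtains h where "h \<in> K" "\<And>g. g \<in> K \<Longrightarrow> class_rate p h \<le> class_rate p g"
proof -
  have sub: "K \<subseteq> graphon_space" using K by (intro graphon_compactin_subset)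
  have bdd: "bdd_below (class_rate p ` K)"
    using class_rate_nonneg[OF p] sub by (intro bdd_belowI[where m = 0]) auto
  define r where "r = (INF g\<in>K. class_rate p g)"
  have "\<exists>g\<in>K. class_rate p g < r + 1 / real (Suc n)" for n
  proof -
    have "r < r + 1 / real (Suc n)" by simp
    then show ?thesis unfolding r_def using K(2) bdd by (subst (asm) cINF_less_iff) auto
  qed
  then obtain s where s: "\<And>n. s n \<in> K" "\<And>n. class_rate p (s n) < r + 1 / real (Suc n)" by metis
  obtain l q where l: "l \<in> K" "strict_mono q" "(\<lambda>n. delta_cut l (s (q n))) \<longlonglongrightarrow> 0"
    by (rule graphon_compactinD[OF K(1) s(1)])
  have "class_rate p l \<le> r + e" if e: "e > 0" for e
  proof (rule class_rate_limit_le[OF p _ _ l(3)])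
    show "l \<in> graphon_space" "s (q n) \<in> graphon_space" for n using l s sub by auto
    have "(\<lambda>n. 1 / real (Suc n)) \<longlonglongrightarrow> 0" by (rule LIMSEQ_Suc[OF lim_const_over_n])
    then have "eventually (\<lambda>n. 1 / real (Suc n) < e) sequentially" using e by (rule order_tendstoD(2))
    then show "eventually (\<lambda>n. class_rate p (s (q n)) \<le> r + e) sequentially"
    proof eventually_elim
      case (elim n)
      have "1 / real (Suc (q n)) \<le> 1 / real (Suc n)"
        using seq_suble[OF l(2), of n] by (intro divide_left_mono) auto
      then show ?case using s(2)[of "q n"] elim by linarith
    qed
  qed
  then have "class_rate p l \<le> r" by (rule field_le_epsilon)
  then have "class_rate p l \<le> class_rate p g" if "g \<in> K" for g
    using cINF_lower[OF bdd that] unfolding r_def by linarith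
  then show ?thesis using l(1) that by blast
qed

text \<open>One distance works for all of \<open>K\<close>. Otherwise classes of rate at most
  \<open>s\<close> come arbitrarily close to \<open>K\<close>, a subsequence converges to a class of
  \<open>K\<close>, and semicontinuity gives that class rate at most \<open>s\<close>. This provides
  the neighbourhood required by \<open>gnp_upper_bound\<close>.\<close>

lemma class_rate_gap:
  assumes p: "0 < p" "p < 1" and K: "compactin graphon.mtopology K"
    and s: "\<And>g. g \<in> K \<Longrightarrow> s < class_rate p g"
  obtains d where "d > 0" "\<And>g B. g \<in> K \<Longrightarrow> B \<in> graphon_space \<Longrightarrow> delta_cut g B < d \<Longrightarrow> s < class_rate p B"
proof (rule ccontr)
  assume a: "\<not> thesis"
  have sub: "K \<subseteq> graphon_space" using K by (intro graphon_compactin_subset)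
  have "\<exists>g B. g \<in> K \<and> B \<in> graphon_space \<and> delta_cut g B < 1 / real (Suc n) \<and> class_rate p B \<le> s" for n
  proof (rule ccontr)
    assume "\<not> ?thesis"
    then have "s < class_rate p B" if "g \<in> K" "B \<in> graphon_space" "delta_cut g B < 1 / real (Suc n)" for g B
      using that by (meson not_le)
    then show False using a that[of "1 / real (Suc n)"] by simp
  qed
  then obtain g B where gB: "\<And>n. g n \<in> K" "\<And>n. B n \<in> graphon_space" "\<And>n. delta_cut (g n) (B n) < 1 / real (Suc n)" "\<And>n. class_rate p (B n) \<le> s"
    by metis
  obtain l q where l: "l \<in> K" "strict_mono q" "(\<lambda>n. delta_cut l (g (q n))) \<longlonglongrightarrow> 0"
    by (rule graphon_compactinD[OF K gB(1)])
  have lM: "l \<in> graphon_space" "g n \<in> graphon_space" for n using l gB sub by auto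
  have "(\<lambda>n. delta_cut l (B (q n))) \<longlonglongrightarrow> 0"
  proof (rule tendsto_sandwich[where f = "\<lambda>_. 0" and h = "\<lambda>n. delta_cut l (g (q n)) + 1 / real (Suc n)"])
    show "eventually (\<lambda>n. delta_cut l (B (q n)) \<le> delta_cut l (g (q n)) + 1 / real (Suc n)) sequentially"
    proof (rule always_eventually, rule allI)
      fix n
      have "1 / real (Suc (q n)) \<le> 1 / real (Suc n)"
        using seq_suble[OF l(2), of n] by (intro divide_left_mono) auto
      then show "delta_cut l (B (q n)) \<le> delta_cut l (g (q n)) + 1 / real (Suc n)"
        using graphon.triangle[OF lM(1) lM(2) gB(2), of "q n" "q n"] gB(3)[of "q n"] by linarith
    qed
    show "(\<lambda>n. delta_cut l (g (q n)) + 1 / real (Suc n)) \<longlonglongrightarrow> 0"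
      using tendsto_add[OF l(3) LIMSEQ_Suc[OF lim_const_over_n[of 1]]] by simp
  qed auto
  then have "class_rate p l \<le> s"
    using gB lM by (intro class_rate_limit_le[OF p, of l "\<lambda>n. B (q n)"]) auto
  then show False using s[OF l(1)] by simp
qed

section \<open>Distance to a set of classes\<close>

lemma delta_cut_set_bdd: "bdd_below (delta_cut g ` A)"
  by (intro bdd_belowI[where m = 0]) auto

lemma delta_cut_set_le: "h \<in> A \<Longrightarrow> delta_cut_set g A \<le> delta_cut g h"
  unfolding delta_cut_set_def by (rule cINF_lower[OF delta_cut_set_bdd])

lemma delta_cut_set_triangle:
  assumes "A \<subseteq> graphon_space" "A \<noteq> {}" "g \<in> graphon_space" "l \<in> graphon_space"
  shows "delta_cut_set g A \<le> delta_cut g l + delta_cut_set l A"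
proof -
  have "delta_cut_set g A - delta_cut g l \<le> (INF h\<in>A. delta_cut l h)"
  proof (rule cINF_greatest)
    fix h assume "h \<in> A"
    then show "delta_cut_set g A - delta_cut g l \<le> delta_cut l h"
      using delta_cut_set_le[of h A g] graphon.triangle[of g l h] assms by auto
  qed (rule assms)
  then show ?thesis by (simp add: delta_cut_set_def)
qed

text \<open>The minimizers form a sublevel set of the rate within \<open>F\<close>, closed under
  limits by semicontinuity.\<close>

lemma rate_minimizers_compact:
  assumes p: "0 < p" "p < 1" and F: "closedin graphon.mtopology F" "F \<noteq> {}"
  shows "rate_minimizers p F \<noteq> {}" "compactin graphon.mtopology (rate_minimizers p F)"
proof -
  have cF: "compactin graphon.mtopology F" by (rule graphon_compactin_closedin[OF F(1)])
  have sub: "F \<subseteq> graphon_space" using cF by (rule graphon_compactin_subset)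
  obtain h where h: "h \<in> F" "\<And>g. g \<in> F \<Longrightarrow> class_rate p h \<le> class_rate p g"
    by (rule class_rate_attains_min[OF p cF F(2)]) blast
  then show "rate_minimizers p F \<noteq> {}" by (auto simp: rate_minimizers_def)
  have eq: "rate_minimizers p F = {g \<in> F. class_rate p g \<le> class_rate p h}"
    using h by (auto simp: rate_minimizers_def intro: order_trans)
  show "compactin graphon.mtopology (rate_minimizers p F)"
    unfolding graphon.compactin_sequentially
  proof (intro conjI allI impI)
    show "rate_minimizers p F \<subseteq> graphon_space" using sub by (auto simp: rate_minimizers_def)
    fix s :: "nat \<Rightarrow> (real \<times> real \<Rightarrow> real) set" assume "range s \<subseteq> rate_minimizers p F"
    then have s: "s n \<in> F" "class_rate p (s n) \<le> class_rate p h" for n by (auto simp: eq)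
    obtain l q where l: "l \<in> F" "strict_mono q" "(\<lambda>n. delta_cut l (s (q n))) \<longlonglongrightarrow> 0"
      "limitin graphon.mtopology (s \<circ> q) l sequentially"
      by (rule graphon_compactinD[OF cF s(1)])
    have "class_rate p l \<le> class_rate p h"
      using s l sub by (intro class_rate_limit_le[OF p, of l "\<lambda>n. s (q n)"]) auto
    then show "\<exists>l r. l \<in> rate_minimizers p F \<and> strict_mono r \<and> limitin graphon.mtopology (s \<circ> r) l sequentially"
      using l by (auto simp: eq)
  qed
qed

section \<open>Concentration near the minimizers\<close>

text \<open>\<open>F1\<close> is compact, as the distance to a set is 1-Lipschitz, so its smallest
  rate is attained. A class attaining it is no minimizer on \<open>F\<close>, since minimizers have
  distance 0 from their own set. The midpoint \<open>s\<close> of the gap leaves strict room for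
  \<open>class_rate_gap\<close>.\<close>

lemma rate_gap_away_from_minimizers:
  assumes p: "0 < p" "p < 1" and F: "closedin graphon.mtopology F" "F \<noteq> {}" and \<epsilon>: "\<epsilon> > 0"
    and h: "h \<in> rate_minimizers p F"
  defines "F1 \<equiv> {g \<in> F. \<epsilon> \<le> delta_cut_set g (rate_minimizers p F)}"
  obtains s d where "s > class_rate p h" "d > 0"
    "\<And>g B. g \<in> F1 \<Longrightarrow> B \<in> graphon_space \<Longrightarrow> delta_cut g B < d \<Longrightarrow> s < class_rate p B"
proof (cases "F1 = {}")
  case True
  then show ?thesis using that[of "class_rate p h + 1" 1] by simp
next
  case False
  let ?M = "rate_minimizers p F"
  have cF: "compactin graphon.mtopology F" by (rule graphon_compactin_closedin[OF F(1)])
  have sub: "F \<subseteq> graphon_space" using cF by (rule graphon_compactin_subset)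
  have M: "?M \<noteq> {}" "?M \<subseteq> graphon_space" using h sub by (auto simp: rate_minimizers_def)
  have "compactin graphon.mtopology F1"
    unfolding graphon.compactin_sequentially
  proof (intro conjI allI impI)
    show "F1 \<subseteq> graphon_space" using sub by (auto simp: F1_def)
    fix s :: "nat \<Rightarrow> (real \<times> real \<Rightarrow> real) set" assume "range s \<subseteq> F1"
    then have s: "s n \<in> F" "\<epsilon> \<le> delta_cut_set (s n) ?M" for n by (auto simp: F1_def)
    obtain l q where l: "l \<in> F" "strict_mono q" "(\<lambda>n. delta_cut l (s (q n))) \<longlonglongrightarrow> 0"
      "limitin graphon.mtopology (s \<circ> q) l sequentially"
      by (rule graphon_compactinD[OF cF s(1)])
    have "\<epsilon> \<le> delta_cut_set l ?M + e" if e: "e > 0" for e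
    proof -
      obtain n where "delta_cut (s (q n)) l < e"
        using l(4) e unfolding graphon.limitin_metric eventually_sequentially o_def by blast
      then show ?thesis
        using delta_cut_set_triangle[OF M(2) M(1), of "s (q n)" l] s[of "q n"] l(1) sub by force
    qed
    then have "\<epsilon> \<le> delta_cut_set l ?M" by (rule field_le_epsilon)
    then show "\<exists>l r. l \<in> F1 \<and> strict_mono r \<and> limitin graphon.mtopology (s \<circ> r) l sequentially"
      using l by (auto simp: F1_def)
  qed
  then obtain g1 where g1: "g1 \<in> F1" "\<And>g. g \<in> F1 \<Longrightarrow> class_rate p g1 \<le> class_rate p g"
    using class_rate_attains_min[OF p _ False] by blast
  have "g1 \<notin> ?M"
  proof
    assume m: "g1 \<in> ?M"
    then have "delta_cut_set g1 ?M \<le> delta_cut g1 g1" by (rule delta_cut_set_le)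
    also have "\<dots> = 0" using m M(2) by auto
    finally show False using g1(1) \<epsilon> by (simp add: F1_def)
  qed
  then obtain g where "g \<in> F" "class_rate p g < class_rate p g1"
    using g1(1) by (auto simp: rate_minimizers_def F1_def not_le)
  then have lt: "class_rate p h < class_rate p g1" using h by (force simp: rate_minimizers_def)
  define s where "s = (class_rate p h + class_rate p g1) / 2"
  have s: "class_rate p h < s" "s < class_rate p g1" using lt by (auto simp: s_def)
  obtain d where "d > 0" "\<And>g B. g \<in> F1 \<Longrightarrow> B \<in> graphon_space \<Longrightarrow> delta_cut g B < d \<Longrightarrow> s < class_rate p B"
    using class_rate_gap[OF p \<open>compactin graphon.mtopology F1\<close>, of s] g1(2) s(2) by (metis order_less_le_trans)
  then show ?thesis using that s(1) by blast
qed

lemma gnp_concentration: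
  assumes p: "0 < p" "p < 1" and F: "closedin graphon.mtopology F" "F \<noteq> {}"
    and INF: "(INF h \<in> graphon.mtopology interior_of F. ereal (class_rate p h)) = (INF h \<in> F. ereal (class_rate p h))"
    and \<epsilon>: "\<epsilon> > 0"
  obtains C where "C > 0" "eventually (\<lambda>n. measure_pmf.prob (gnp n p) F > 0 \<and>
     measure_pmf.prob (gnp n p) {g \<in> F. \<epsilon> \<le> delta_cut_set g (rate_minimizers p F)} / measure_pmf.prob (gnp n p) F
       \<le> exp (- C * (real n)\<^sup>2)) sequentially"
proof -
  let ?F1 = "{g \<in> F. \<epsilon> \<le> delta_cut_set g (rate_minimizers p F)}"
  have sub: "F \<subseteq> graphon_space" using F(1) by (rule graphon_closedin_subset)
  obtain h where h: "h \<in> rate_minimizers p F" using rate_minimizers_compact(1)[OF p F] by blast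
  define r where "r = class_rate p h"
  obtain s d where sd: "s > r" "d > 0"
    "\<And>g B. g \<in> ?F1 \<Longrightarrow> B \<in> graphon_space \<Longrightarrow> delta_cut g B < d \<Longrightarrow> s < class_rate p B"
    by (rule rate_gap_away_from_minimizers[OF p F \<epsilon> h, folded r_def], rule that)
  \<comment> \<open>Now \<open>s = r + 4 * \<eta>\<close>. The upper bound has exponent
    \<open>r + 3 * \<eta>\<close> and the lower bound at most \<open>r + 2 * \<eta>\<close>, so the
    quotient decays with constant \<open>\<eta>\<close>.\<close>
  define \<eta> where "\<eta> = (s - r) / 4"
  have \<eta>: "\<eta> > 0" using sd(1) by (simp add: \<eta>_def)
  \<comment> \<open>The infimum over \<open>F\<close> is finite, so the one over the interior is
    too. An empty interior would make it infinite; hence the class \<open>k\<close> below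
    exists.\<close>
  have "(INF h \<in> F. ereal (class_rate p h)) \<le> ereal r"
    unfolding r_def using h by (intro INF_lower) (auto simp: rate_minimizers_def)
  then have "(INF h \<in> graphon.mtopology interior_of F. ereal (class_rate p h)) < ereal (r + \<eta>)"
    unfolding INF using \<eta> by (auto intro: le_less_trans)
  then obtain k where k: "k \<in> graphon.mtopology interior_of F" "class_rate p k < r + \<eta>"
    by (auto simp: INF_less_iff)
  obtain \<delta> where \<delta>: "\<delta> > 0" "graphon.mball k \<delta> \<subseteq> graphon.mtopology interior_of F"
    using k(1) openin_interior_of[of graphon.mtopology F] unfolding graphon.openin_mtopology by blast
  then have \<delta>F: "graphon.mball k \<delta> \<subseteq> F" using interior_of_subset[of graphon.mtopology F] by blast
  have kM: "k \<in> graphon_space" using k(1) interior_of_subset[of graphon.mtopology F] sub by blast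
  define f where "f = class_rep k"
  have f: "f \<in> graphons" "graphon_class f = k" using class_rep[OF kM] by (auto simp: f_def)
  have Rf: "graphon_rate p f < r + \<eta>" using k(2) by (simp add: class_rate_def f_def)
  have lower: "eventually (\<lambda>n. exp (- (graphon_rate p f + \<eta>) * (real n)\<^sup>2) \<le> measure_pmf.prob (gnp n p) F) sequentially"
  proof (rule gnp_lower_bound[OF p f(1) \<delta>(1) \<eta>])
    fix g assume g: "g \<in> graphons" "orbit_dist f g < \<delta>"
    then have "graphon_class g \<in> graphon.mball k \<delta>"
      using f kM by (auto simp: delta_cut_class f(2)[symmetric])
    then show "graphon_class g \<in> F" using \<delta>F by blast
  qed
  have upper: "eventually (\<lambda>n. measure_pmf.prob (gnp n p) ?F1 \<le> exp (- (s - \<eta>) * (real n)\<^sup>2)) sequentially"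
  proof (rule gnp_upper_bound[OF p sd(2) \<eta>])
    fix g b assume g: "g \<in> graphons" "b \<in> graphons" "graphon_class b \<in> ?F1" "orbit_dist b g < d"
    have "s < class_rate p (graphon_class g)"
      by (rule sd(3)[OF g(3)]) (use g in \<open>auto simp: delta_cut_class\<close>)
    then show "s \<le> graphon_rate p g" using class_rate_class[OF p g(1)] by simp
  qed
  show ?thesis
  proof (rule that[OF \<eta>])
    show "eventually (\<lambda>n. measure_pmf.prob (gnp n p) F > 0 \<and>
     measure_pmf.prob (gnp n p) ?F1 / measure_pmf.prob (gnp n p) F \<le> exp (- \<eta> * (real n)\<^sup>2)) sequentially"
      using lower upper
    proof eventually_elim
      case (elim n)
      have "- (r + 2 * \<eta>) * (real n)\<^sup>2 \<le> - (graphon_rate p f + \<eta>) * (real n)\<^sup>2"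
        using Rf by (intro mult_right_mono) auto
      then have lo: "exp (- (r + 2 * \<eta>) * (real n)\<^sup>2) \<le> measure_pmf.prob (gnp n p) F"
        using elim(1) by (metis exp_le_cancel_iff order_trans)
      then have pos: "measure_pmf.prob (gnp n p) F > 0" by (metis exp_gt_zero less_le_trans)
      have "measure_pmf.prob (gnp n p) ?F1 / measure_pmf.prob (gnp n p) F \<le> exp (- (s - \<eta>) * (real n)\<^sup>2) / exp (- (r + 2 * \<eta>) * (real n)\<^sup>2)"
        using elim(2) lo by (intro frac_le) auto
      also have "\<dots> = exp (- (s - \<eta>) * (real n)\<^sup>2 - (- (r + 2 * \<eta>) * (real n)\<^sup>2))"
        by (simp only: exp_diff)
      also have "- (s - \<eta>) * (real n)\<^sup>2 - (- (r + 2 * \<eta>) * (real n)\<^sup>2) = - \<eta> * (real n)\<^sup>2"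
      proof -
        have "s = r + 4 * \<eta>" by (simp add: \<eta>_def field_simps)
        then show ?thesis by (simp add: algebra_simps)
      qed
      finally show ?case using pos by simp
    qed
  qed
qed

section \<open>Expectations under the conditional law\<close>

lemma finite_set_gnp: "finite (set_pmf (gnp n p))"
  unfolding gnp_eq using finite_subset[OF set_edge_pmf finite_edge_space] by simp

text \<open>Off \<open>A\<close> the deviation from \<open>c\<close> is at most \<open>e\<close>; on
  \<open>A\<close> the crude bound \<open>B\<close> is weighted by the conditional probability of
  \<open>A\<close>.\<close>

lemma expectation_cond_pmf_le:
  fixes \<phi> :: "'a \<Rightarrow> real"
  assumes fin: "finite (set_pmf \<mu>)" and pos: "measure_pmf.prob \<mu> F > 0"
    and good: "\<And>x. x \<in> set_pmf \<mu> \<Longrightarrow> x \<in> F \<Longrightarrow> x \<notin> A \<Longrightarrow> \<bar>\<phi> x - c\<bar> \<le> e"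
    and bad: "\<And>x. x \<in> set_pmf \<mu> \<Longrightarrow> x \<in> F \<Longrightarrow> \<bar>\<phi> x - c\<bar> \<le> B" and e: "e \<ge> 0" and B: "B \<ge> 0"
  shows "\<bar>measure_pmf.expectation (cond_pmf \<mu> F) \<phi> - c\<bar> \<le> e + B * (measure_pmf.prob \<mu> (A \<inter> F) / measure_pmf.prob \<mu> F)"
proof -
  have ne: "set_pmf \<mu> \<inter> F \<noteq> {}" using pos measure_pmf_zero_iff[of \<mu> F] by (auto simp: Int_commute)
  let ?S = "set_pmf \<mu> \<inter> F" and ?\<nu> = "cond_pmf \<mu> F"
  have S: "finite ?S" "set_pmf ?\<nu> = ?S" using fin set_cond_pmf[OF ne] by auto
  have one: "(\<Sum>x\<in>?S. pmf ?\<nu> x) = 1" using S by (intro sum_pmf_eq_1) auto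
  have "measure_pmf.expectation ?\<nu> \<phi> = (\<Sum>x\<in>?S. pmf ?\<nu> x * \<phi> x)"
    using S by (subst integral_measure_pmf[of ?S]) auto
  then have "measure_pmf.expectation ?\<nu> \<phi> - c = (\<Sum>x\<in>?S. pmf ?\<nu> x * (\<phi> x - c))"
    using one by (simp add: right_diff_distrib sum_subtractf sum_distrib_right[symmetric])
  then have "\<bar>measure_pmf.expectation ?\<nu> \<phi> - c\<bar> \<le> (\<Sum>x\<in>?S. \<bar>pmf ?\<nu> x * (\<phi> x - c)\<bar>)" by simp
  also have "\<dots> \<le> (\<Sum>x\<in>?S. pmf ?\<nu> x * e + (if x \<in> A then pmf ?\<nu> x * B else 0))"
  proof (rule sum_mono)
    fix x assume x: "x \<in> ?S"
    show "\<bar>pmf ?\<nu> x * (\<phi> x - c)\<bar> \<le> pmf ?\<nu> x * e + (if x \<in> A then pmf ?\<nu> x * B else 0)"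
    proof (cases "x \<in> A")
      case True
      have "pmf ?\<nu> x * \<bar>\<phi> x - c\<bar> \<le> pmf ?\<nu> x * B" using bad x by (intro mult_left_mono) auto
      moreover have "0 \<le> pmf ?\<nu> x * e" using e by simp
      ultimately show ?thesis using True by (simp add: abs_mult)
    next
      case False
      have "pmf ?\<nu> x * \<bar>\<phi> x - c\<bar> \<le> pmf ?\<nu> x * e" using good x False by (intro mult_left_mono) auto
      then show ?thesis using False by (simp add: abs_mult)
    qed
  qed
  also have "\<dots> = e + B * (\<Sum>x\<in>A \<inter> ?S. pmf ?\<nu> x)"
    using S one by (simp add: sum.distrib sum_distrib_left[symmetric] sum.inter_restrict[symmetric] Int_commute mult.commute)
  also have "(\<Sum>x\<in>A \<inter> ?S. pmf ?\<nu> x) = (\<Sum>x\<in>A \<inter> ?S. pmf \<mu> x) / measure_pmf.prob \<mu> F"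
    unfolding sum_divide_distrib by (intro sum.cong refl) (simp add: pmf_cond[OF ne])
  also have "(\<Sum>x\<in>A \<inter> ?S. pmf \<mu> x) = measure_pmf.prob \<mu> (A \<inter> ?S)"
    using S by (intro measure_measure_pmf_finite[symmetric]) auto
  also have "measure_pmf.prob \<mu> (A \<inter> ?S) = measure_pmf.prob \<mu> (A \<inter> F)"
    by (intro measure_pmf.finite_measure_eq_AE) (auto simp: AE_measure_pmf_iff)
  finally show ?thesis .
qed

text \<open>With a single minimizer, concentration confines the conditional law to a ball around
  \<open>h\<close> on which \<open>\<phi>\<close> is nearly constant. \<open>F\<close> has positive
  probability for large \<open>n\<close>, so unspecified conditional laws at null events do not
  affect the limit.\<close>

lemma gnp_weak_convergence:
  assumes p: "0 < p" "p < 1" and F: "closedin graphon.mtopology F" "F \<noteq> {}"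
    and INF: "(INF h \<in> graphon.mtopology interior_of F. ereal (class_rate p h)) = (INF h \<in> F. ereal (class_rate p h))"
    and h: "rate_minimizers p F = {h}"
  shows "weakly_converges graphon.mtopology (\<lambda>n. cond_pmf (gnp n p) F) (return_pmf h)"
  unfolding weakly_converges_def
proof (intro allI impI, elim conjE)
  fix \<phi> :: "(real \<times> real \<Rightarrow> real) set \<Rightarrow> real"
  assume cont: "continuous_map graphon.mtopology euclideanreal \<phi>" and bdd: "bounded (\<phi> ` topspace graphon.mtopology)"
  have sub: "F \<subseteq> graphon_space" using F(1) by (rule graphon_closedin_subset)
  have hF: "h \<in> graphon_space" using h sub by (auto simp: rate_minimizers_def)
  obtain B where B: "B > 0" "\<And>x. x \<in> graphon_space \<Longrightarrow> \<bar>\<phi> x\<bar> \<le> B"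
    using bdd unfolding bounded_pos by auto
  have "(\<lambda>n. measure_pmf.expectation (cond_pmf (gnp n p) F) \<phi>) \<longlonglongrightarrow> \<phi> h"
  proof (rule tendstoI)
    fix e :: real assume e: "e > 0"
    have "openin graphon.mtopology {x \<in> topspace graphon.mtopology. \<phi> x \<in> ball (\<phi> h) (e / 2)}"
      using cont by (rule openin_continuous_map_preimage) auto
    moreover have "h \<in> {x \<in> topspace graphon.mtopology. \<phi> x \<in> ball (\<phi> h) (e / 2)}" using hF e by simp
    ultimately obtain \<delta> where \<delta>: "\<delta> > 0" "graphon.mball h \<delta> \<subseteq> {x \<in> topspace graphon.mtopology. \<phi> x \<in> ball (\<phi> h) (e / 2)}"
      unfolding graphon.openin_mtopology by blast
    let ?A = "{g. \<delta> \<le> delta_cut_set g (rate_minimizers p F)}"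
    obtain C where C: "C > 0" "eventually (\<lambda>n. measure_pmf.prob (gnp n p) F > 0 \<and>
      measure_pmf.prob (gnp n p) {g \<in> F. \<delta> \<le> delta_cut_set g (rate_minimizers p F)} / measure_pmf.prob (gnp n p) F
       \<le> exp (- C * (real n)\<^sup>2)) sequentially"
      by (rule gnp_concentration[OF p F INF \<delta>(1)])
    have "((\<lambda>n::nat. exp (- C * (real n)\<^sup>2)) \<longlongrightarrow> 0) sequentially" using C(1) by real_asymp
    \<comment> \<open>The deviation of \<open>\<phi>\<close> is at most \<open>2 * B\<close>
      everywhere, so this threshold makes the exceptional part smaller than
      \<open>e / 2\<close>.\<close>
    then have "eventually (\<lambda>n::nat. exp (- C * (real n)\<^sup>2) < e / (4 * B)) sequentially"
      using e B by (intro order_tendstoD(2)) auto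
    with C(2) show "eventually (\<lambda>n. dist (measure_pmf.expectation (cond_pmf (gnp n p) F) \<phi>) (\<phi> h) < e) sequentially"
    proof eventually_elim
      case (elim n)
      have eq: "?A \<inter> F = {g \<in> F. \<delta> \<le> delta_cut_set g (rate_minimizers p F)}" by auto
      have "\<bar>measure_pmf.expectation (cond_pmf (gnp n p) F) \<phi> - \<phi> h\<bar> \<le>
        e / 2 + 2 * B * (measure_pmf.prob (gnp n p) (?A \<inter> F) / measure_pmf.prob (gnp n p) F)"
      proof (rule expectation_cond_pmf_le[OF finite_set_gnp])
        show "measure_pmf.prob (gnp n p) F > 0" using elim by simp
        fix x assume x: "x \<in> set_pmf (gnp n p)" "x \<in> F"
        then have xM: "x \<in> graphon_space" using sub by auto
        show "\<bar>\<phi> x - \<phi> h\<bar> \<le> 2 * B" using B(2)[OF xM] B(2)[OF hF] by linarith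
        assume "x \<notin> ?A"
        then have "delta_cut h x < \<delta>" by (simp add: h delta_cut_set_def graphon.commute[of h])
        then have "x \<in> graphon.mball h \<delta>" using xM hF by simp
        then have "\<phi> x \<in> ball (\<phi> h) (e / 2)" using \<delta>(2) by blast
        then show "\<bar>\<phi> x - \<phi> h\<bar> \<le> e / 2"
          by (simp add: dist_real_def abs_minus_commute[of "\<phi> x"])
      qed (use e B in auto)
      also have "\<dots> \<le> e / 2 + 2 * B * exp (- C * (real n)\<^sup>2)"
        unfolding eq using elim B by (intro add_left_mono mult_left_mono) auto
      also have "\<dots> < e / 2 + 2 * B * (e / (4 * B))"
        using elim B by (intro add_strict_left_mono mult_strict_left_mono) auto
      also have "\<dots> = e" using B by simp
      finally show ?case by (simp add: dist_real_def)
    qed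
  qed
  then show "(\<lambda>n. measure_pmf.expectation (cond_pmf (gnp n p) F) \<phi>) \<longlonglongrightarrow> measure_pmf.expectation (return_pmf h) \<phi>"
    by simp
qed

text \<open>The bound is for large \<open>n\<close> because \<open>G(1,p)\<close> is deterministic:
  if its class lies in \<open>F\<close> away from the minimizers, the conditional probability is 1.
  Positivity of the conditioning event is asserted as well, since a conditional probability given a
  null event is 0 by convention. The infima are extended reals, so that an empty interior has
  infimum infinity; an empty \<open>F\<close> would satisfy the conditions on infima and is excluded
  separately.\<close>

theorem theorem3p1:
  fixes p :: real and F :: "(real \<times> real \<Rightarrow> real) set set"
  assumes "0 < p" "p < 1"
    and "closedin graphon_topology F" "F \<noteq> {}"
    and "(INF h \<in> graphon_topology interior_of F. ereal (class_rate p h)) =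
         (INF h \<in> F. ereal (class_rate p h))"
    and "(INF h \<in> F. ereal (class_rate p h)) > 0"
  shows "rate_minimizers p F \<noteq> {} \<and>
    compactin graphon_topology (rate_minimizers p F) \<and>
    (\<forall>\<epsilon>>0. \<exists>C>0. \<exists>N::nat. \<forall>n\<ge>N.
       \<P>(G in measure_pmf (gnp n p). G \<in> F) > 0 \<and>
       \<P>(G in measure_pmf (gnp n p). delta_cut_set G (rate_minimizers p F) \<ge> \<epsilon> \<bar> G \<in> F)
         \<le> exp (- C * (real n)\<^sup>2)) \<and>
    (\<forall>h. rate_minimizers p F = {h} \<longrightarrow>
       weakly_converges graphon_topology (\<lambda>n. cond_pmf (gnp n p) F) (return_pmf h))"
proof (intro conjI allI impI)
  note F = assms(3)[unfolded graphon_topology_eq] assms(4) and INF = assms(5)[unfolded graphon_topology_eq]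
  show "rate_minimizers p F \<noteq> {}" by (rule rate_minimizers_compact(1)[OF assms(1,2) F])
  show "compactin graphon_topology (rate_minimizers p F)"
    unfolding graphon_topology_eq by (rule rate_minimizers_compact(2)[OF assms(1,2) F])
  show "weakly_converges graphon_topology (\<lambda>n. cond_pmf (gnp n p) F) (return_pmf h)"
    if "rate_minimizers p F = {h}" for h
    unfolding graphon_topology_eq by (rule gnp_weak_convergence[OF assms(1,2) F INF that])
  fix \<epsilon> :: real assume "\<epsilon> > 0"
  then obtain C where C: "C > 0" "eventually (\<lambda>n. measure_pmf.prob (gnp n p) F > 0 \<and>
    measure_pmf.prob (gnp n p) {g \<in> F. \<epsilon> \<le> delta_cut_set g (rate_minimizers p F)} / measure_pmf.prob (gnp n p) F
      \<le> exp (- C * (real n)\<^sup>2)) sequentially"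
    using gnp_concentration[OF assms(1,2) F INF] by blast
  have "{G. \<epsilon> \<le> delta_cut_set G (rate_minimizers p F) \<and> G \<in> F} = {g \<in> F. \<epsilon> \<le> delta_cut_set g (rate_minimizers p F)}"
    by auto
  with C show "\<exists>C>0. \<exists>N::nat. \<forall>n\<ge>N. \<P>(G in measure_pmf (gnp n p). G \<in> F) > 0 \<and>
    \<P>(G in measure_pmf (gnp n p). delta_cut_set G (rate_minimizers p F) \<ge> \<epsilon> \<bar> G \<in> F) \<le> exp (- C * (real n)\<^sup>2)"
    unfolding eventually_sequentially cond_prob_def by (intro exI[of _ C]) simp
qed

end
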